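(* Let $(w,F)\in C^2(\overline R)\times\mathbb R$, with $w$ of finite $C^2$ norm, be a solution of the height equation such that $w>0$ in $R\cup T$, $F>F_{\mathrm{cr}}$, and $w,Dw,D^2w\to0$ uniformly as $q\to-\infty$ (or as $q\to+\infty$). Then there exists $q_*\in\mathbb R$ such that $q\mapsto w(q,\cdot)$ is even about $q=q_*$ and $$\pm w_q>0\quad\text{for }\pm(q_*-q)>0,\ -1<p\le0.$$
   Context: Fix $\alpha\in(0,1)$, $\rho\in C^{2+\alpha}([-1,0])$ with $\rho>0$, $\rho_p\le0$, and $H\in C^{3+\alpha}([-1,0])$ with $H(-1)=0$, $H(0)=1$, $H_p>0$. Let $R=\mathbb R\times(-1,0)$ (coordinates $(q,p)$), $T=\mathbb R\times\{0\}$, $B=\mathbb R\times\{-1\}$. For $F>0$, $(w,F)$ solves the height equation if $h=H+w$ satisfies $\big(-\frac{1+h_q^2}{2h_p^2}+\frac1{2H_p^2}\big)_p+\big(\frac{h_q}{h_p}\big)_q-\frac1{F^2}\rho_p(h-H)=0$ in $R$, $\frac{1+h_q^2}{2h_p^2}-\frac1{2H_p^2}+\frac1{F^2}\rho(h-1)=0$ on $T$, $h=0$ on $B$, and $0<\inf_R(H_p+w_p)<\infty$. $\mu_{\mathrm{cr}}$ is the smallest positive $\mu$ for which $(\phi_p/H_p^3)_p-\mu\rho_p\phi=0$ on $(-1,0)$, $\phi(-1)=0$, $-\phi_p(0)/H_p(0)^3+\mu\rho(0)\phi(0)=0$ has a nontrivial solution, and $F_{\mathrm{cr}}=\mu_{\mathrm{cr}}^{-1/2}$.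 *)

theory Defs
  imports "HOL-Analysis.Analysis"
begin

definition strip :: "(real \<times> real) set" where
  "strip = {z. -1 \<le> snd z \<and> snd z \<le> 0}"

definition C_k_alpha :: "nat \<Rightarrow> real \<Rightarrow> (real \<Rightarrow> real) \<Rightarrow> bool" where
  "C_k_alpha k \<alpha> f \<longleftrightarrow> (\<exists>D :: nat \<Rightarrow> real \<Rightarrow> real.
     (\<forall>x\<in>{-1..0}. D 0 x = f x) \<and>
     (\<forall>j<k. \<forall>x\<in>{-1..0}. (D j has_real_derivative D (Suc j) x) (at x within {-1..0})) \<and>
     continuous_on {-1..0} (D k) \<and>
     (\<exists>C. \<forall>x\<in>{-1..0}. \<forall>y\<in>{-1..0}. \<bar>D k x - D k y\<bar> \<le> C * \<bar>x - y\<bar> powr \<alpha>))"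

definition C2_strip ::
  "(real \<Rightarrow> real \<Rightarrow> real) \<Rightarrow> (real \<Rightarrow> real \<Rightarrow> real) \<Rightarrow> (real \<Rightarrow> real \<Rightarrow> real) \<Rightarrow>
   (real \<Rightarrow> real \<Rightarrow> real) \<Rightarrow> (real \<Rightarrow> real \<Rightarrow> real) \<Rightarrow> (real \<Rightarrow> real \<Rightarrow> real) \<Rightarrow>
   (real \<Rightarrow> real \<Rightarrow> real) \<Rightarrow> bool" where
  "C2_strip w wq wp wqq wqp wpq wpp \<longleftrightarrow>
     (\<forall>z\<in>strip.
        ((\<lambda>y. w (fst y) (snd y)) has_derivative
           (\<lambda>d. wq (fst z) (snd z) * fst d + wp (fst z) (snd z) * snd d)) (at z within strip) \<and>
        ((\<lambda>y. wq (fst y) (snd y)) has_derivative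
           (\<lambda>d. wqq (fst z) (snd z) * fst d + wqp (fst z) (snd z) * snd d)) (at z within strip) \<and>
        ((\<lambda>y. wp (fst y) (snd y)) has_derivative
           (\<lambda>d. wpq (fst z) (snd z) * fst d + wpp (fst z) (snd z) * snd d)) (at z within strip)) \<and>
     (\<forall>g\<in>{w, wq, wp, wqq, wqp, wpq, wpp}. continuous_on strip (\<lambda>y. g (fst y) (snd y)))"

definition C2_bounded ::
  "(real \<Rightarrow> real \<Rightarrow> real) list \<Rightarrow> bool" where
  "C2_bounded gs \<longleftrightarrow> (\<forall>g\<in>set gs. \<exists>M. \<forall>z\<in>strip. \<bar>g (fst z) (snd z)\<bar> \<le> M)"

definition has_eigensolution ::
  "(real \<Rightarrow> real) \<Rightarrow> (real \<Rightarrow> real) \<Rightarrow> (real \<Rightarrow> real) \<Rightarrow> real \<Rightarrow> bool" where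
  "has_eigensolution Hp \<rho> \<rho>p \<mu> \<longleftrightarrow> (\<exists>\<phi> \<phi>p :: real \<Rightarrow> real.
     (\<forall>x\<in>{-1..0}. (\<phi> has_real_derivative \<phi>p x) (at x within {-1..0})) \<and>
     continuous_on {-1..0} \<phi>p \<and>
     (\<forall>x\<in>{-1<..<0}. \<exists>g. ((\<lambda>y. \<phi>p y / Hp y ^ 3) has_real_derivative g) (at x) \<and>
                         g - \<mu> * \<rho>p x * \<phi> x = 0) \<and>
     \<phi> (-1) = 0 \<and>
     - \<phi>p 0 / Hp 0 ^ 3 + \<mu> * \<rho> 0 * \<phi> 0 = 0 \<and>
     (\<exists>x\<in>{-1..0}. \<phi> x \<noteq> 0))"

text \<open>The height equation for (w,F), h = H + w, with the given partial derivatives of w.\<close>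
definition height_eq ::
  "(real \<Rightarrow> real) \<Rightarrow> (real \<Rightarrow> real) \<Rightarrow> (real \<Rightarrow> real) \<Rightarrow> (real \<Rightarrow> real) \<Rightarrow>
   (real \<Rightarrow> real \<Rightarrow> real) \<Rightarrow> (real \<Rightarrow> real \<Rightarrow> real) \<Rightarrow> (real \<Rightarrow> real \<Rightarrow> real) \<Rightarrow> real \<Rightarrow> bool" where
  "height_eq H Hp \<rho> \<rho>p w wq wp F \<longleftrightarrow>
     F > 0 \<and>
     (\<forall>q p. -1 < p \<and> p < 0 \<longrightarrow>
        (\<exists>A B.
          ((\<lambda>p'. - (1 + (wq q p')\<^sup>2) / (2 * (Hp p' + wp q p')\<^sup>2) + 1 / (2 * (Hp p')\<^sup>2))
              has_real_derivative A) (at p) \<and>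
          ((\<lambda>q'. wq q' p / (Hp p + wp q' p)) has_real_derivative B) (at q) \<and>
          A + B - (1 / F\<^sup>2) * \<rho>p p * ((H p + w q p) - H p) = 0)) \<and>
     (\<forall>q. (1 + (wq q 0)\<^sup>2) / (2 * (Hp 0 + wp q 0)\<^sup>2) - 1 / (2 * (Hp 0)\<^sup>2)
           + (1 / F\<^sup>2) * \<rho> 0 * ((H 0 + w q 0) - 1) = 0) \<and>
     (\<forall>q. H (-1) + w q (-1) = 0) \<and>
     (\<exists>c>0. \<forall>q p. -1 < p \<and> p < 0 \<longrightarrow> c \<le> Hp p + wp q p)"

definition decays_left :: "(real \<Rightarrow> real \<Rightarrow> real) list \<Rightarrow> bool" where
  "decays_left gs \<longleftrightarrow> (\<forall>\<epsilon>>0. \<exists>M. \<forall>q p. q \<le> M \<and> -1 \<le> p \<and> p \<le> 0 \<longrightarrow>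
       (\<forall>g\<in>set gs. \<bar>g q p\<bar> < \<epsilon>))"

definition decays_right :: "(real \<Rightarrow> real \<Rightarrow> real) list \<Rightarrow> bool" where
  "decays_right gs \<longleftrightarrow> (\<forall>\<epsilon>>0. \<exists>M. \<forall>q p. q \<ge> M \<and> -1 \<le> p \<and> p \<le> 0 \<longrightarrow>
       (\<forall>g\<in>set gs. \<bar>g q p\<bar> < \<epsilon>))"

end

theory Submission
  imports Defs
begin

text \<open>
  The proof is by moving planes. For supercritical \<open>F\<close>, shooting from the bed produces a positive
  strict supersolution \<open>\<Phi>\<close> of the linearized problem; were it to lose positivity, an eigenvalue below
  \<open>\<mu>cr\<close> would appear on the way. If the difference between the reflected wave and the wave is negative
  somewhere, the minimum of its quotient by a perturbation \<open>P\<close> of \<open>\<Phi>\<close> is attained, and there a negative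
  multiple of \<open>P\<close> added to the wave touches the reflected wave from below, which the height equation
  forbids: far upstream by linearization, near the bed and near the reflection line by concavity of \<open>P\<close>.
  This starts the planes and moves them on.

  Since only two derivatives of \<open>w\<close> are available, all comparisons are made between jets at a touching
  point, with coefficients that are merely bounded; explicit Gaussian barriers on discs that overlap the
  surface replace the Hopf lemma. If the planes never stop, the wave is a front; its limit at infinity is
  a conjugate flow of the same flow force, and the two flow forces differ by the integral of a positive
  cubic expression.
\<close>

section \<open>One-variable calculus\<close>

lemma has_real_derivative_unique_Icc:
  fixes f :: "real \<Rightarrow> real"
  assumes "(f has_real_derivative D) (at x within {a..b})" "(f has_real_derivative E) (at x within {a..b})"
    and "x \<in> {a..b}" "a < b"
  shows "D = E"
  using assms has_field_derivative_unique trivial_limit_within islimpt_Icc by blast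

lemma has_real_derivative_transform:
  fixes f g :: "real \<Rightarrow> real"
  assumes "(f has_real_derivative D) (at x within S)" "x \<in> S" "\<And>y. y \<in> S \<Longrightarrow> g y = f y"
  shows "(g has_real_derivative D) (at x within S)"
  using assms has_derivative_transform unfolding has_field_derivative_def by blast

lemma continuous_on_Icc_bounded:
  fixes f :: "real \<Rightarrow> real"
  assumes "continuous_on {a..b} f"
  obtains B where "B > 0" "\<And>t. t \<in> {a..b} \<Longrightarrow> \<bar>f t\<bar> \<le> B"
  using compact_imp_bounded[OF compact_continuous_image[OF assms]] by (auto simp: bounded_pos)

lemma has_integral_derivative_Icc:
  fixes f f' :: "real \<Rightarrow> real"
  assumes "s \<le> t" "{s..t} \<subseteq> S"
    and "\<And>x. x \<in> {s..t} \<Longrightarrow> (f has_real_derivative f' x) (at x within S)"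
  shows "(f' has_integral f t - f s) {s..t}"
proof (rule fundamental_theorem_of_calculus[OF \<open>s \<le> t\<close>])
  fix x assume "x \<in> {s..t}"
  from DERIV_subset[OF assms(3)[OF this] assms(2)]
  show "(f has_vector_derivative f' x) (at x within {s..t})"
    by (simp add: has_real_derivative_iff_has_vector_derivative)
qed

lemma has_real_derivative_flux:
  fixes x y :: "real \<Rightarrow> real"
  assumes "(y has_real_derivative y') (at s within S)" "(x has_real_derivative x') (at s within S)"
    and nz: "x s \<noteq> 0"
  shows "((\<lambda>t. (1 + (y t)\<^sup>2) / (2 * (x t)\<^sup>2)) has_real_derivative
      y s * y' / (x s)\<^sup>2 - (1 + (y s)\<^sup>2) * x' / x s ^ 3) (at s within S)"
  by (rule derivative_eq_intros assms(1,2) refl | simp add: nz)+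
    (use nz in \<open>simp add: field_simps power2_eq_square power3_eq_cube power4_eq_xxxx\<close>)

lemma local_min_second_derivative:
  fixes g g' :: "real \<Rightarrow> real"
  assumes "e > 0"
    and g: "\<And>t. \<bar>t\<bar> < e \<Longrightarrow> (g has_real_derivative g' t) (at t)"
    and g': "(g' has_real_derivative D) (at 0)"
    and min: "\<And>t. \<bar>t\<bar> < e \<Longrightarrow> g 0 \<le> g t"
  shows "g' 0 = 0" "D \<ge> 0"
proof -
  show g0: "g' 0 = 0"
    using DERIV_local_min[of g "g' 0" 0 e] g[of 0] min \<open>e > 0\<close> by auto
  show "D \<ge> 0"
  proof (rule ccontr)
    assume "\<not> D \<ge> 0"
    then obtain d where d: "d > 0" "\<And>h. h > 0 \<Longrightarrow> h < d \<Longrightarrow> g' (0 + h) < g' 0"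
      using DERIV_neg_dec_right[OF g'] by auto
    define t where "t = min d e / 2"
    have t: "0 < t" "t < d" "t < e" using d(1) \<open>e > 0\<close> by (auto simp: t_def)
    obtain \<xi> where \<xi>: "0 < \<xi>" "\<xi> < t" "g t - g 0 = (t - 0) * g' \<xi>"
      using MVT2[of 0 t g g'] t g by force
    have "g' \<xi> < 0" using d(2)[of \<xi>] \<xi> t g0 by simp
    then have "g t < g 0" using \<xi>(3) t(1) mult_pos_neg[of t "g' \<xi>"] by simp
    then show False using min[of t] t by simp
  qed
qed

section \<open>Second-order jets on the strip\<close>

text \<open>The entries of a jet are the value, the gradient and the Hessian \<open>(dqq, dqp, dpp)\<close>.\<close>

type_synonym jet = "real \<times> (real \<times> real) \<times> (real \<times> real \<times> real)"

definition val :: "jet \<Rightarrow> real" where "val j = fst j"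
definition dq :: "jet \<Rightarrow> real" where "dq j = fst (fst (snd j))"
definition dp :: "jet \<Rightarrow> real" where "dp j = snd (fst (snd j))"
definition dqq :: "jet \<Rightarrow> real" where "dqq j = fst (snd (snd j))"
definition dqp :: "jet \<Rightarrow> real" where "dqp j = fst (snd (snd (snd j)))"
definition dpp :: "jet \<Rightarrow> real" where "dpp j = snd (snd (snd (snd j)))"

lemmas jet_entry_defs = val_def dq_def dp_def dqq_def dqp_def dpp_def

lemma jet_entries [simp]:
  "val (u, (a, b), (r, s, t)) = u" "dq (u, (a, b), (r, s, t)) = a" "dp (u, (a, b), (r, s, t)) = b"
  "dqq (u, (a, b), (r, s, t)) = r" "dqp (u, (a, b), (r, s, t)) = s" "dpp (u, (a, b), (r, s, t)) = t"
  by (simp_all add: jet_entry_defs)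

lemma bounded_linear_jet_entries:
  "bounded_linear val" "bounded_linear dq" "bounded_linear dp"
  "bounded_linear dqq" "bounded_linear dqp" "bounded_linear dpp"
  unfolding jet_entry_defs
  by (intro bounded_linear_intros bounded_linear_compose[OF bounded_linear_fst]
      bounded_linear_compose[OF bounded_linear_snd] bounded_linear_fst bounded_linear_snd)+

lemmas jet_entry_linear [simp] =
  bounded_linear_jet_entries[THEN linear_simps(1)] bounded_linear_jet_entries[THEN linear_simps(2)]
  bounded_linear_jet_entries[THEN linear_simps(3)] bounded_linear_jet_entries[THEN linear_simps(4)]
  bounded_linear_jet_entries[THEN linear_simps(5), unfolded real_scaleR_def]

lemmas jet_entry_continuous [continuous_intros] =
  bounded_linear_jet_entries[THEN bounded_linear.continuous_on]

lemmas jet_entry_tendsto [tendsto_intros] = bounded_linear_jet_entries[THEN bounded_linear.tendsto]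

lemma jet_entry_le_norm:
  "\<bar>val j\<bar> \<le> norm j" "\<bar>dq j\<bar> \<le> norm j" "\<bar>dp j\<bar> \<le> norm j"
  "\<bar>dqq j\<bar> \<le> norm j" "\<bar>dqp j\<bar> \<le> norm j" "\<bar>dpp j\<bar> \<le> norm j"
proof -
  obtain u a b r s t where j: "j = (u, (a, b), (r, s, t))" by (metis prod.exhaust)
  have "norm (a, b) \<le> norm j" "norm (r, s, t) \<le> norm j" "norm (s, t) \<le> norm j"
    unfolding j by (meson norm_snd_le norm_fst_le order_trans)+
  then show "\<bar>val j\<bar> \<le> norm j" "\<bar>dq j\<bar> \<le> norm j" "\<bar>dp j\<bar> \<le> norm j"
    "\<bar>dqq j\<bar> \<le> norm j" "\<bar>dqp j\<bar> \<le> norm j" "\<bar>dpp j\<bar> \<le> norm j"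
    using norm_fst_le[of u "((a, b), (r, s, t))"] norm_fst_le[of a b] norm_snd_le[of b a]
      norm_fst_le[of r "(s, t)"] norm_fst_le[of s t] norm_snd_le[of t s]
    by (simp_all add: j)
qed

lemma norm_jet_le:
  "norm ((u, (a, b), (r, s, t)) :: jet) \<le> \<bar>u\<bar> + (\<bar>a\<bar> + \<bar>b\<bar>) + (\<bar>r\<bar> + (\<bar>s\<bar> + \<bar>t\<bar>))" for u a b r s t
  using norm_Pair_le[of u "((a, b), (r, s, t))"] norm_Pair_le[of "(a, b)" "(r, s, t)"]
    norm_Pair_le[of a b] norm_Pair_le[of r "(s, t)"] norm_Pair_le[of s t] by simp

lemma mem_strip [simp]: "(q, p) \<in> strip \<longleftrightarrow> -1 \<le> p \<and> p \<le> 0"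
  by (simp add: strip_def)

definition holonomic :: "(real \<times> real \<Rightarrow> jet) \<Rightarrow> bool" where
  "holonomic J \<longleftrightarrow> (\<forall>z\<in>strip.
     ((\<lambda>y. val (J y)) has_derivative (\<bullet>) (dq (J z), dp (J z))) (at z within strip) \<and>
     ((\<lambda>y. dq (J y)) has_derivative (\<bullet>) (dqq (J z), dqp (J z))) (at z within strip) \<and>
     ((\<lambda>y. dp (J y)) has_derivative (\<bullet>) (dqp (J z), dpp (J z))) (at z within strip))"

lemma holonomicD:
  assumes "holonomic J" "z \<in> strip"
  shows "((\<lambda>y. val (J y)) has_derivative (\<bullet>) (dq (J z), dp (J z))) (at z within strip)"
    "((\<lambda>y. dq (J y)) has_derivative (\<bullet>) (dqq (J z), dqp (J z))) (at z within strip)"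
    "((\<lambda>y. dp (J y)) has_derivative (\<bullet>) (dqp (J z), dpp (J z))) (at z within strip)"
  using assms by (simp_all add: holonomic_def)

lemma holonomic_continuous_on_val: "holonomic J \<Longrightarrow> continuous_on strip (\<lambda>z. val (J z))"
  unfolding continuous_on_eq_continuous_within by (blast dest: holonomicD(1) has_derivative_continuous)

lemma holonomic_add:
  assumes "holonomic J" "holonomic K"
  shows "holonomic (\<lambda>z. J z + K z)"
proof -
  have add: "((\<lambda>y. f y + g y) has_derivative (\<bullet>) (a + a', b + b')) F"
    if "(f has_derivative (\<bullet>) (a, b)) F" "(g has_derivative (\<bullet>) (a', b')) F"
    for f g :: "real \<times> real \<Rightarrow> real" and a b a' b' F
    using has_derivative_add[OF that] by (simp flip: inner_add_left)
  show ?thesis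
    using assms by (simp add: holonomic_def add)
qed

lemma holonomic_scaleR:
  assumes "holonomic J"
  shows "holonomic (\<lambda>z. k *\<^sub>R J z)"
proof -
  have scale: "((\<lambda>y. k * f y) has_derivative (\<bullet>) (k * a, k * b)) F"
    if "(f has_derivative (\<bullet>) (a, b)) F" for f :: "real \<times> real \<Rightarrow> real" and a b F
    using has_derivative_mult_right[OF that, of k]
    by (rule has_derivative_eq_rhs) (simp add: fun_eq_iff algebra_simps)
  show ?thesis
    using assms by (simp add: holonomic_def scale)
qed

lemma holonomic_diff: "holonomic J \<Longrightarrow> holonomic K \<Longrightarrow> holonomic (\<lambda>z. J z - K z)"
  using holonomic_add[of J "\<lambda>z. (-1) *\<^sub>R K z"] holonomic_scaleR[of K "-1"] by simp

lemma holonomic_const: "holonomic (\<lambda>z. (k, 0, 0))"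
proof -
  have "(\<bullet>) (0, 0) = (\<lambda>d :: real \<times> real. 0 :: real)" by (simp add: fun_eq_iff)
  then show ?thesis by (simp add: holonomic_def jet_entry_defs)
qed

definition product_jet :: "(real \<Rightarrow> real) \<Rightarrow> (real \<Rightarrow> real) \<Rightarrow> (real \<Rightarrow> real) \<Rightarrow>
    (real \<Rightarrow> real) \<Rightarrow> (real \<Rightarrow> real) \<Rightarrow> (real \<Rightarrow> real) \<Rightarrow> real \<times> real \<Rightarrow> jet" where
  "product_jet A A' A'' B B' B'' z =
     (A (fst z) * B (snd z), (A' (fst z) * B (snd z), A (fst z) * B' (snd z)),
      (A'' (fst z) * B (snd z), A' (fst z) * B' (snd z), A (fst z) * B'' (snd z)))"

lemma has_derivative_product_strip:
  fixes A B :: "real \<Rightarrow> real"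
  assumes A: "(A has_real_derivative A') (at (fst z))"
    and B: "(B has_real_derivative B') (at (snd z) within {-1..0})"
  shows "((\<lambda>y. A (fst y) * B (snd y)) has_derivative (\<bullet>) (A' * B (snd z), A (fst z) * B'))
    (at z within strip)"
proof -
  have "((\<lambda>y. A (fst y)) has_derivative (\<lambda>d. A' * fst d)) (at z within strip)"
    by (rule has_derivative_compose[where g = A and g' = "\<lambda>x. A' * x"])
      (use A in \<open>auto simp: has_field_derivative_def intro: derivative_eq_intros\<close>)
  moreover have "((\<lambda>y. B (snd y)) has_derivative (\<lambda>d. B' * snd d)) (at z within strip)"
  proof (rule has_derivative_in_compose[where g = B and g' = "\<lambda>x. B' * x"])
    show "(snd has_derivative snd) (at z within strip)"
      by (auto intro: derivative_eq_intros)
    have "snd ` strip \<subseteq> {-1..0}" by (auto simp: strip_def)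
    then show "(B has_derivative (\<lambda>x. B' * x)) (at (snd z) within snd ` strip)"
      using B has_derivative_subset by (auto simp: has_field_derivative_def)
  qed
  ultimately show ?thesis
    by (rule has_derivative_eq_rhs[OF has_derivative_mult])
      (auto simp: inner_prod_def algebra_simps)
qed

lemma holonomic_product_jet:
  fixes A A' A'' B B' B'' :: "real \<Rightarrow> real"
  assumes "\<And>q. (A has_real_derivative A' q) (at q)" "\<And>q. (A' has_real_derivative A'' q) (at q)"
    and "\<And>p. p \<in> {-1..0} \<Longrightarrow> (B has_real_derivative B' p) (at p within {-1..0})"
    and "\<And>p. p \<in> {-1..0} \<Longrightarrow> (B' has_real_derivative B'' p) (at p within {-1..0})"
  shows "holonomic (product_jet A A' A'' B B' B'')"
  unfolding holonomic_def product_jet_def jet_entries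
  by (intro ballI conjI has_derivative_product_strip assms) (auto simp: strip_def)

definition reflect :: "jet \<Rightarrow> jet" where
  "reflect j = (val j, (- dq j, dp j), (dqq j, - dqp j, dpp j))"

lemma reflect_entries [simp]:
  "val (reflect j) = val j" "dq (reflect j) = - dq j" "dp (reflect j) = dp j"
  "dqq (reflect j) = dqq j" "dqp (reflect j) = - dqp j" "dpp (reflect j) = dpp j"
  by (simp_all add: reflect_def)

lemma norm_reflect [simp]: "norm (reflect j) = norm j"
  by (simp add: reflect_def jet_entry_defs norm_prod_def)

lemma has_derivative_strip_affine:
  fixes f :: "real \<times> real \<Rightarrow> real"
  assumes "(f has_derivative (\<bullet>) (a, b)) (at (s * fst z + k, snd z) within strip)"
  shows "((\<lambda>y. f (s * fst y + k, snd y)) has_derivative (\<bullet>) (s * a, b)) (at z within strip)"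
proof -
  let ?T = "\<lambda>y::real \<times> real. (s * fst y + k, snd y)"
  have T: "(?T has_derivative (\<lambda>d. (s * fst d, snd d))) (at z within strip)"
    by (auto intro!: derivative_eq_intros)
  have "?T ` strip \<subseteq> strip" by (auto simp: strip_def)
  then have "(f has_derivative (\<bullet>) (a, b)) (at (?T z) within ?T ` strip)"
    using assms has_derivative_subset by blast
  from has_derivative_in_compose[OF T this] show ?thesis
    by (auto simp: inner_prod_def mult_ac elim!: has_derivative_eq_rhs)
qed

lemma holonomic_translate:
  assumes "holonomic J"
  shows "holonomic (\<lambda>z. J (fst z + k, snd z))"
  unfolding holonomic_def
proof
  fix z :: "real \<times> real" assume "z \<in> strip"
  then have "(fst z + k, snd z) \<in> strip" by (simp add: strip_def)
  note holonomicD[OF assms this, THEN has_derivative_strip_affine[where s = 1, simplified]]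
  then show "((\<lambda>y. val (J (fst y + k, snd y))) has_derivative
        (\<bullet>) (dq (J (fst z + k, snd z)), dp (J (fst z + k, snd z)))) (at z within strip) \<and>
      ((\<lambda>y. dq (J (fst y + k, snd y))) has_derivative
        (\<bullet>) (dqq (J (fst z + k, snd z)), dqp (J (fst z + k, snd z)))) (at z within strip) \<and>
      ((\<lambda>y. dp (J (fst y + k, snd y))) has_derivative
        (\<bullet>) (dqp (J (fst z + k, snd z)), dpp (J (fst z + k, snd z)))) (at z within strip)"
    by simp
qed

lemma holonomic_reflect:
  assumes "holonomic J"
  shows "holonomic (\<lambda>z. reflect (J (k - fst z, snd z)))"
  unfolding holonomic_def reflect_entries
proof (intro ballI conjI)
  fix z :: "real \<times> real" assume "z \<in> strip"
  then have z: "(-1 * fst z + k, snd z) \<in> strip" by (simp add: strip_def)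
  note affine = holonomicD[OF assms z, THEN has_derivative_strip_affine]
  show "((\<lambda>y. val (J (k - fst y, snd y))) has_derivative
      (\<bullet>) (- dq (J (k - fst z, snd z)), dp (J (k - fst z, snd z)))) (at z within strip)"
    using affine(1) by simp
  show "((\<lambda>y. - dq (J (k - fst y, snd y))) has_derivative
      (\<bullet>) (dqq (J (k - fst z, snd z)), - dqp (J (k - fst z, snd z)))) (at z within strip)"
    by (rule has_derivative_eq_rhs[OF has_derivative_minus[OF affine(2)[unfolded mult_minus1]], simplified])
      (simp add: fun_eq_iff)
  show "((\<lambda>y. dp (J (k - fst y, snd y))) has_derivative
      (\<bullet>) (- dqp (J (k - fst z, snd z)), dpp (J (k - fst z, snd z)))) (at z within strip)"
    using affine(3) by simp
qed

lemma has_derivative_strip_q: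
  fixes f :: "real \<times> real \<Rightarrow> real"
  assumes "(f has_derivative (\<bullet>) (a, b)) (at (q, p) within strip)" "p \<in> {-1..0}"
  shows "((\<lambda>t. f (t, p)) has_real_derivative a) (at q)"
proof -
  have line: "((\<lambda>t. (t, p)) has_derivative (\<lambda>s. (s, 0))) (at q)"
    by (auto intro!: derivative_eq_intros)
  have "(\<lambda>t. (t, p)) ` UNIV \<subseteq> strip" using assms by auto
  then have "(f has_derivative (\<bullet>) (a, b)) (at (q, p) within (\<lambda>t. (t, p)) ` UNIV)"
    using assms(1) has_derivative_subset by blast
  from has_derivative_in_compose[OF line this] show ?thesis
    unfolding has_field_derivative_def
    by (rule has_derivative_eq_rhs) (simp add: fun_eq_iff inner_prod_def)
qed

lemma has_derivative_strip_p:
  fixes f :: "real \<times> real \<Rightarrow> real"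
  assumes "(f has_derivative (\<bullet>) (a, b)) (at (q, p) within strip)"
  shows "((\<lambda>t. f (q, t)) has_real_derivative b) (at p within {-1..0})"
proof -
  have line: "((\<lambda>t. (q, t)) has_derivative (\<lambda>s. (0, s))) (at p within {-1..0})"
    by (auto intro!: derivative_eq_intros)
  have "(\<lambda>t. (q, t)) ` {-1..0} \<subseteq> strip" by auto
  then have "(f has_derivative (\<bullet>) (a, b)) (at (q, p) within (\<lambda>t. (q, t)) ` {-1..0})"
    using assms(1) has_derivative_subset by blast
  from has_derivative_in_compose[OF line this] show ?thesis
    unfolding has_field_derivative_def
    by (rule has_derivative_eq_rhs) (simp add: fun_eq_iff inner_prod_def)
qed

lemma holonomic_partials:
  assumes "holonomic J" "p \<in> {-1..0}"
  shows "((\<lambda>t. val (J (t, p))) has_real_derivative dq (J (q, p))) (at q)"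
    "((\<lambda>t. dq (J (t, p))) has_real_derivative dqq (J (q, p))) (at q)"
    "((\<lambda>t. dp (J (t, p))) has_real_derivative dqp (J (q, p))) (at q)"
    "((\<lambda>t. val (J (q, t))) has_real_derivative dp (J (q, p))) (at p within {-1..0})"
    "((\<lambda>t. dq (J (q, t))) has_real_derivative dqp (J (q, p))) (at p within {-1..0})"
    "((\<lambda>t. dp (J (q, t))) has_real_derivative dpp (J (q, p))) (at p within {-1..0})"
proof -
  have "(q, p) \<in> strip" using assms(2) by simp
  note d = holonomicD[OF assms(1) this]
  show "((\<lambda>t. val (J (t, p))) has_real_derivative dq (J (q, p))) (at q)"
    "((\<lambda>t. dq (J (t, p))) has_real_derivative dqq (J (q, p))) (at q)"
    "((\<lambda>t. dp (J (t, p))) has_real_derivative dqp (J (q, p))) (at q)"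
    "((\<lambda>t. val (J (q, t))) has_real_derivative dp (J (q, p))) (at p within {-1..0})"
    "((\<lambda>t. dq (J (q, t))) has_real_derivative dqp (J (q, p))) (at p within {-1..0})"
    "((\<lambda>t. dp (J (q, t))) has_real_derivative dpp (J (q, p))) (at p within {-1..0})"
    by (fact d[THEN has_derivative_strip_q, OF assms(2)] d[THEN has_derivative_strip_p])+
qed

lemma continuous_on_strip_slice:
  assumes "continuous_on strip f" "S \<subseteq> {-1..0}"
  shows "continuous_on S (\<lambda>p. f (q, p))"
  by (rule continuous_on_compose2[OF assms(1)]) (use assms(2) in \<open>auto intro!: continuous_intros\<close>)

lemma strip_leibniz:
  fixes f fq :: "real \<times> real \<Rightarrow> real"
  assumes deriv: "\<And>q p. p \<in> {a..b} \<Longrightarrow> ((\<lambda>t. f (t, p)) has_real_derivative fq (q, p)) (at q)"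
    and cont: "continuous_on strip f" "continuous_on strip fq" and ab: "{a..b} \<subseteq> {-1..0}"
  shows "((\<lambda>q. integral {a..b} (\<lambda>p. f (q, p))) has_real_derivative integral {a..b} (\<lambda>p. fq (q, p))) (at q)"
proof -
  have "((\<lambda>q. integral (cbox a b) (\<lambda>p. f (q, p))) has_field_derivative
      integral (cbox a b) (\<lambda>p. fq (q, p))) (at q within UNIV)"
  proof (rule leibniz_rule_field_derivative)
    show "continuous_on (UNIV \<times> cbox a b) (\<lambda>(x, t). fq (x, t))"
      unfolding case_prod_eta using ab by (intro continuous_on_subset[OF cont(2)]) auto
    show "(\<lambda>p. f (x, p)) integrable_on cbox a b" for x
      using continuous_on_strip_slice[OF cont(1) ab] by (simp add: integrable_continuous_real)
  qed (use deriv in auto)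
  then show ?thesis by simp
qed

lemma C2_strip_mixed_partials:
  assumes C2: "C2_strip w wq wp wqq wqp wpq wpp" and p: "p \<in> {-1..0}"
  shows "wqp q p = wpq q p"
proof -
  have "((\<lambda>y. w (fst y) (snd y)) has_derivative (\<bullet>) (wq q p, wp q p)) (at (q, p) within strip)"
    "((\<lambda>y. wq (fst y) (snd y)) has_derivative (\<bullet>) (wqq q p, wqp q p)) (at (q, p) within strip)"
    "((\<lambda>y. wp (fst y) (snd y)) has_derivative (\<bullet>) (wpq q p, wpp q p)) (at (q, p) within strip)"
    if "p \<in> {-1..0}" for q p
    using C2[unfolded C2_strip_def, THEN conjunct1, rule_format, of "(q, p)"] that
    by (simp_all add: inner_prod_def[abs_def])
  note d = this[THEN has_derivative_strip_q] this[THEN has_derivative_strip_p]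
  have cont: "continuous_on strip (\<lambda>y. wp (fst y) (snd y))" "continuous_on strip (\<lambda>y. wpq (fst y) (snd y))"
    using C2 by (auto simp: C2_strip_def)
  have wq: "wq q t = wq q (-1) + integral {-1..t} (wpq q)" if t: "t \<in> {-1..0}" for t
  proof -
    have "w q t = w q (-1) + integral {-1..t} (wp q)" for q
      using has_integral_derivative_Icc[of "-1" t "{-1..0}" "w q" "wp q"] d(4)[of _ q] t
      by (auto dest: integral_unique)
    moreover have "((\<lambda>q. w q (-1) + integral {-1..t} (wp q)) has_real_derivative
        wq q (-1) + integral {-1..t} (wpq q)) (at q)"
      using strip_leibniz[OF _ cont, of "-1" t q] d(1)[of "-1" q] d(3) t
      by (intro DERIV_add) auto
    ultimately have "((\<lambda>q. w q t) has_real_derivative wq q (-1) + integral {-1..t} (wpq q)) (at q)"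
      by presburger
    then show ?thesis using d(1)[OF t t, of q] DERIV_unique by fastforce
  qed
  have "continuous_on {-1..0} (wpq q)" using continuous_on_strip_slice[OF cont(2), of "{-1..0}" q] by simp
  then have "((\<lambda>t. wq q (-1) + integral {-1..t} (wpq q)) has_real_derivative wpq q p) (at p within {-1..0})"
    by (auto intro!: derivative_eq_intros integral_has_real_derivative p)
  then have "(wq q has_real_derivative wpq q p) (at p within {-1..0})"
    by (rule has_real_derivative_transform[OF _ p]) (rule wq)
  then show ?thesis
    using has_real_derivative_unique_Icc d(5)[OF p, of q] p by fastforce
qed

definition jet_of :: "(real \<Rightarrow> real \<Rightarrow> real) \<Rightarrow> (real \<Rightarrow> real \<Rightarrow> real) \<Rightarrow> (real \<Rightarrow> real \<Rightarrow> real) \<Rightarrow>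
    (real \<Rightarrow> real \<Rightarrow> real) \<Rightarrow> (real \<Rightarrow> real \<Rightarrow> real) \<Rightarrow> (real \<Rightarrow> real \<Rightarrow> real) \<Rightarrow> real \<times> real \<Rightarrow> jet" where
  "jet_of w wq wp wqq wqp wpp z = (w (fst z) (snd z), (wq (fst z) (snd z), wp (fst z) (snd z)),
     (wqq (fst z) (snd z), wqp (fst z) (snd z), wpp (fst z) (snd z)))"

lemma C2_strip_jet_of:
  assumes "C2_strip w wq wp wqq wqp wpq wpp"
  shows "holonomic (jet_of w wq wp wqq wqp wpp)" "continuous_on strip (jet_of w wq wp wqq wqp wpp)"
proof -
  have "wpq (fst z) (snd z) = wqp (fst z) (snd z)" if "z \<in> strip" for z
    using C2_strip_mixed_partials[OF assms, of "snd z" "fst z"] that by (simp add: strip_def)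
  then show "holonomic (jet_of w wq wp wqq wqp wpp)"
    using assms by (simp add: holonomic_def C2_strip_def jet_of_def inner_prod_def[abs_def])
  show "continuous_on strip (jet_of w wq wp wqq wqp wpp)"
    unfolding jet_of_def using assms by (auto simp: C2_strip_def intro!: continuous_intros)
qed

lemma at_within_strip_interior: "-1 < snd z \<Longrightarrow> snd z < 0 \<Longrightarrow> at z within strip = at z"
  by (rule at_within_open_subset[of _ "snd -` {-1<..<0}"]) (auto simp: strip_def open_vimage_snd)

lemma has_derivative_along_line:
  fixes f :: "real \<times> real \<Rightarrow> real"
  assumes "(f has_derivative (\<bullet>) (r, s)) (at (z + t *\<^sub>R (a, b)) within strip)"
    and "-1 < snd z + t * b" "snd z + t * b < 0"
  shows "((\<lambda>t. f (z + t *\<^sub>R (a, b))) has_real_derivative r * a + s * b) (at t)"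
proof -
  have "((\<lambda>t. z + t *\<^sub>R (a, b)) has_derivative (\<lambda>s. s *\<^sub>R (a, b))) (at t)"
    by (auto intro!: derivative_eq_intros)
  moreover have "(f has_derivative (\<bullet>) (r, s)) (at (z + t *\<^sub>R (a, b)))"
    using assms at_within_strip_interior[of "z + t *\<^sub>R (a, b)"] by simp
  ultimately show ?thesis
    unfolding has_field_derivative_def
    by (rule has_derivative_eq_rhs[OF has_derivative_compose])
      (simp add: fun_eq_iff inner_prod_def algebra_simps)
qed

lemma holonomic_min_interior:
  assumes J: "holonomic J" and z: "-1 < snd z" "snd z < 0"
    and min: "\<forall>\<^sub>F y in at z. val (J z) \<le> val (J y)"
  shows "dq (J z) = 0" "dp (J z) = 0"
    "dqq (J z) * a\<^sup>2 + 2 * dqp (J z) * a * b + dpp (J z) * b\<^sup>2 \<ge> 0"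
proof -
  have along_line: "dq (J z) * a + dp (J z) * b = 0 \<and>
      dqq (J z) * a\<^sup>2 + 2 * dqp (J z) * a * b + dpp (J z) * b\<^sup>2 \<ge> 0" for a b
  proof -
    define l where "l t = z + t *\<^sub>R (a, b)" for t
    have l0: "l 0 = z" by (simp add: l_def flip: zero_prod_def)
    have "isCont l 0" unfolding l_def by (intro continuous_intros)
    then have lim: "(l \<longlongrightarrow> z) (nhds 0)"
      unfolding isCont_def tendsto_at_iff_tendsto_nhds by (simp only: l0)
    have "open {y :: real \<times> real. -1 < snd y \<and> snd y < 0}"
      by (intro open_Collect_conj open_Collect_less continuous_intros)
    from eventually_nhds_in_open[OF this, of z] z
    have "\<forall>\<^sub>F y in nhds z. -1 < snd y \<and> snd y < 0" by simp
    moreover have "\<forall>\<^sub>F y in nhds z. val (J z) \<le> val (J y)"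
      using min by (auto simp: eventually_at_filter elim!: eventually_mono)
    ultimately have "\<forall>\<^sub>F y in nhds z. (-1 < snd y \<and> snd y < 0) \<and> val (J z) \<le> val (J y)"
      by (rule eventually_conj)
    from filterlim_iff[THEN iffD1, OF lim, rule_format, OF this]
    obtain e where e: "e > 0" "\<And>t. \<bar>t\<bar> < e \<Longrightarrow> -1 < snd (l t) \<and> snd (l t) < 0 \<and> val (J z) \<le> val (J (l t))"
      by (auto simp: eventually_nhds_metric)
    have d: "((\<lambda>t. val (J (l t))) has_real_derivative dq (J (l t)) * a + dp (J (l t)) * b) (at t)"
        "((\<lambda>t. dq (J (l t))) has_real_derivative dqq (J (l t)) * a + dqp (J (l t)) * b) (at t)"
        "((\<lambda>t. dp (J (l t))) has_real_derivative dqp (J (l t)) * a + dpp (J (l t)) * b) (at t)"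
      if "\<bar>t\<bar> < e" for t
    proof -
      have "l t \<in> strip" "-1 < snd z + t * b" "snd z + t * b < 0"
        using e(2)[OF that] by (simp_all add: l_def strip_def)
      note has_derivative_along_line[OF holonomicD(1)[OF J this(1)[unfolded l_def]] this(2,3)]
        has_derivative_along_line[OF holonomicD(2)[OF J this(1)[unfolded l_def]] this(2,3)]
        has_derivative_along_line[OF holonomicD(3)[OF J this(1)[unfolded l_def]] this(2,3)]
      then show "((\<lambda>t. val (J (l t))) has_real_derivative dq (J (l t)) * a + dp (J (l t)) * b) (at t)"
        "((\<lambda>t. dq (J (l t))) has_real_derivative dqq (J (l t)) * a + dqp (J (l t)) * b) (at t)"
        "((\<lambda>t. dp (J (l t))) has_real_derivative dqp (J (l t)) * a + dpp (J (l t)) * b) (at t)"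
        unfolding l_def .
    qed
    have "((\<lambda>t. dq (J (l t)) * a + dp (J (l t)) * b) has_real_derivative
        (dqq (J z) * a + dqp (J z) * b) * a + (dqp (J z) * a + dpp (J z) * b) * b) (at 0)"
      using d(2,3)[of 0] e(1) unfolding l0 by (intro DERIV_add DERIV_cmult_right) auto
    from local_min_second_derivative[OF e(1) d(1) this] e(2)
    show ?thesis by (simp add: l0 algebra_simps power2_eq_square)
  qed
  show "dq (J z) = 0" "dp (J z) = 0" using along_line[of 1 0] along_line[of 0 1] by auto
  show "dqq (J z) * a\<^sup>2 + 2 * dqp (J z) * a * b + dpp (J z) * b\<^sup>2 \<ge> 0" using along_line by blast
qed

lemma holonomic_min_top:
  assumes J: "holonomic J" and min: "\<forall>\<^sub>F y in at (q, 0) within strip. val (J (q, 0)) \<le> val (J y)"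
  shows "dq (J (q, 0)) = 0" "dp (J (q, 0)) \<le> 0"
proof -
  obtain e where e: "e > 0"
    "\<And>y. y \<in> strip \<Longrightarrow> dist y (q, 0) < e \<Longrightarrow> val (J (q, 0)) \<le> val (J y)"
    using min unfolding eventually_at by (metis order_refl)
  note d = holonomic_partials[OF J, of 0 q]
  have "val (J (q, 0)) \<le> val (J (t, 0))" if "\<bar>q - t\<bar> < e" for t
    using e(2)[of "(t, 0)"] that by (simp add: dist_Pair_Pair dist_real_def abs_minus_commute)
  then show "dq (J (q, 0)) = 0"
    using DERIV_local_min[of "\<lambda>t. val (J (t, 0))" _ q e] d(1) e(1) by auto
  show "dp (J (q, 0)) \<le> 0"
  proof (rule ccontr)
    assume "\<not> dp (J (q, 0)) \<le> 0"
    then obtain r where r: "r > 0"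
      "\<And>h. h > 0 \<Longrightarrow> 0 - h \<in> {-1..0} \<Longrightarrow> h < r \<Longrightarrow> val (J (q, 0 - h)) < val (J (q, 0))"
      using has_real_derivative_pos_inc_left[of "\<lambda>t. val (J (q, t))" "dp (J (q, 0))" 0 "{-1..0}"] d(4)
      by auto
    define h where "h = min (min r e) 1 / 2"
    have h: "h > 0" "h < r" "h < e" "h \<le> 1" using r(1) e(1) by (auto simp: h_def)
    then have "val (J (q, 0)) \<le> val (J (q, - h))"
      by (intro e(2)) (simp_all add: dist_Pair_Pair dist_real_def)
    then show False using r(2)[of h] h by simp
  qed
qed

definition touches_below :: "(real \<times> real \<Rightarrow> jet) \<Rightarrow> (real \<times> real \<Rightarrow> jet) \<Rightarrow> real \<times> real \<Rightarrow> bool" where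
  "touches_below W U z \<longleftrightarrow> val (W z) = val (U z) \<and> (\<forall>\<^sub>F y in at z within strip. val (W y) \<le> val (U y))"

lemma touches_below_interior:
  assumes "holonomic W" "holonomic U" "touches_below W U z" "-1 < snd z" "snd z < 0"
  shows "dq (W z) = dq (U z)" "dp (W z) = dp (U z)"
    "dqq (W z) * a\<^sup>2 + 2 * dqp (W z) * a * b + dpp (W z) * b\<^sup>2
      \<le> dqq (U z) * a\<^sup>2 + 2 * dqp (U z) * a * b + dpp (U z) * b\<^sup>2"
proof -
  have "\<forall>\<^sub>F y in at z. val (U z - W z) \<le> val (U y - W y)"
    using assms(3-5) by (simp add: touches_below_def at_within_strip_interior)
  note min = holonomic_min_interior[OF holonomic_diff[OF assms(2,1)] assms(4,5) this]
  show "dq (W z) = dq (U z)" "dp (W z) = dp (U z)" using min(1,2) by simp_all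
  show "dqq (W z) * a\<^sup>2 + 2 * dqp (W z) * a * b + dpp (W z) * b\<^sup>2
      \<le> dqq (U z) * a\<^sup>2 + 2 * dqp (U z) * a * b + dpp (U z) * b\<^sup>2"
    using min(3)[of a b] by (simp add: algebra_simps)
qed

lemma touches_below_top:
  assumes "holonomic W" "holonomic U" "touches_below W U (q, 0)"
  shows "dq (W (q, 0)) = dq (U (q, 0))" "dp (U (q, 0)) \<le> dp (W (q, 0))"
proof -
  have "\<forall>\<^sub>F y in at (q, 0) within strip. val (U (q, 0) - W (q, 0)) \<le> val (U y - W y)"
    using assms(3) by (simp add: touches_below_def)
  from holonomic_min_top[OF holonomic_diff[OF assms(2,1)] this]
  show "dq (W (q, 0)) = dq (U (q, 0))" "dp (U (q, 0)) \<le> dp (W (q, 0))" by simp_all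
qed

section \<open>The height equation as a pair of operators on jets\<close>

text \<open>A solution enters through the jet of \<open>w\<close>; \<open>\<mu>\<close> is \<open>1/F\<^sup>2\<close> and \<open>\<rho>0\<close> the density at the surface.
  The constants \<open>M\<close> and \<open>c\<close> bound the jets of all solutions under consideration.\<close>

locale height_problem =
  fixes Hp Hpp \<rho>p :: "real \<Rightarrow> real" and \<rho>0 \<mu> M c :: real
  assumes Hp_deriv: "p \<in> {-1..0} \<Longrightarrow> (Hp has_real_derivative Hpp p) (at p within {-1..0})"
    and Hpp_cont: "continuous_on {-1..0} Hpp"
    and \<rho>p_cont: "continuous_on {-1..0} \<rho>p"
    and Hp_pos: "p \<in> {-1..0} \<Longrightarrow> Hp p > 0"
    and \<rho>p_nonpos: "p \<in> {-1..0} \<Longrightarrow> \<rho>p p \<le> 0"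
    and \<rho>0_pos: "\<rho>0 > 0"
    and \<mu>_pos: "\<mu> > 0"
    and M_ge_1: "M \<ge> 1"
    and c_pos: "c > 0"
begin

lemma M_pos: "M > 0"
  using M_ge_1 by simp

lemma Hp_cont: "continuous_on {-1..0} Hp"
  using Hp_deriv by (rule DERIV_continuous_on)

definition interior_op :: "real \<Rightarrow> jet \<Rightarrow> real" where
  "interior_op p j = (Hp p + dp j)\<^sup>2 * dqq j - 2 * (Hp p + dp j) * dq j * dqp j
     + (1 + (dq j)\<^sup>2) * (Hpp p + dpp j)
     - (Hp p + dp j) ^ 3 * (Hpp p / Hp p ^ 3 + \<mu> * \<rho>p p * val j)"

definition top_op :: "jet \<Rightarrow> real" where
  "top_op j = (1 + (dq j)\<^sup>2) / (2 * (Hp 0 + dp j)\<^sup>2) - 1 / (2 * (Hp 0)\<^sup>2) + \<mu> * \<rho>0 * val j"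

definition interior_op' :: "real \<Rightarrow> jet \<Rightarrow> jet \<Rightarrow> real" where
  "interior_op' p j k = 2 * (Hp p + dp j) * dp k * dqq j + (Hp p + dp j)\<^sup>2 * dqq k
     - 2 * (dp k * dq j + (Hp p + dp j) * dq k) * dqp j - 2 * (Hp p + dp j) * dq j * dqp k
     + 2 * dq j * dq k * (Hpp p + dpp j) + (1 + (dq j)\<^sup>2) * dpp k
     - 3 * (Hp p + dp j)\<^sup>2 * dp k * (Hpp p / Hp p ^ 3 + \<mu> * \<rho>p p * val j)
     - (Hp p + dp j) ^ 3 * (\<mu> * \<rho>p p * val k)"

definition top_op' :: "jet \<Rightarrow> jet \<Rightarrow> real" where
  "top_op' j k = dq j * dq k / (Hp 0 + dp j)\<^sup>2 - (1 + (dq j)\<^sup>2) * dp k / (Hp 0 + dp j) ^ 3 + \<mu> * \<rho>0 * val k"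

lemma interior_op_mvt:
  obtains t where "0 < t" "t < 1"
    "interior_op p (j + k) = interior_op p j + interior_op' p (j + t *\<^sub>R k) k"
proof -
  define r where "r = Hpp p / Hp p ^ 3"
  have "((\<lambda>t. interior_op p (j + t *\<^sub>R k)) has_real_derivative interior_op' p (j + t *\<^sub>R k) k) (at t)" for t
    unfolding interior_op_def interior_op'_def r_def[symmetric]
    by (auto intro!: derivative_eq_intros simp: algebra_simps power2_eq_square)
  from MVT2[of 0 1, OF _ this] that show thesis by force
qed

lemma top_op_mvt:
  assumes "\<And>t. t \<in> {0..1} \<Longrightarrow> Hp 0 + dp (j + t *\<^sub>R k) > 0"
  obtains t where "0 < t" "t < 1" "top_op (j + k) = top_op j + top_op' (j + t *\<^sub>R k) k"
proof -
  have "((\<lambda>t. top_op (j + t *\<^sub>R k)) has_real_derivative top_op' (j + t *\<^sub>R k) k) (at t)"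
    if "0 \<le> t" "t \<le> 1" for t
  proof -
    have "((\<lambda>t. dq (j + t *\<^sub>R k)) has_real_derivative dq k) (at t)"
      "((\<lambda>t. Hp 0 + dp (j + t *\<^sub>R k)) has_real_derivative dp k) (at t)"
      "((\<lambda>t. \<mu> * \<rho>0 * val (j + t *\<^sub>R k)) has_real_derivative \<mu> * \<rho>0 * val k) (at t)"
      by (auto intro!: derivative_eq_intros)
    note DERIV_add[OF DERIV_diff[OF has_real_derivative_flux[OF this(1,2)] DERIV_const] this(3)]
    then show ?thesis
      unfolding top_op_def top_op'_def diff_0_right using assms[of t] that by simp
  qed
  from MVT2[of 0 1, OF _ this] that show thesis by force
qed

lemma interior_op'_scaleR: "interior_op' p j (s *\<^sub>R k) = s * interior_op' p j k"
  by (simp add: interior_op'_def algebra_simps)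

lemma top_op'_scaleR: "top_op' j (s *\<^sub>R k) = s * top_op' j k"
  by (simp add: top_op'_def algebra_simps)

lemma continuous_on_coefficient:
  assumes "continuous_on S g" "\<And>z. z \<in> S \<Longrightarrow> g z \<in> {-1..0}"
  shows "continuous_on S (\<lambda>z. Hp (g z))" "continuous_on S (\<lambda>z. Hpp (g z))" "continuous_on S (\<lambda>z. \<rho>p (g z))"
  using assms by (auto intro: continuous_on_compose2[OF Hp_cont] continuous_on_compose2[OF Hpp_cont]
      continuous_on_compose2[OF \<rho>p_cont])

lemma continuous_on_interior_op:
  assumes "continuous_on S g" "\<And>z. z \<in> S \<Longrightarrow> g z \<in> {-1..0}" "continuous_on S J"
  shows "continuous_on S (\<lambda>z. interior_op (g z) (J z))"
proof -
  have "Hp (g z) ^ 3 \<noteq> 0" if "z \<in> S" for z using Hp_pos assms(2) that by fastforce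
  then show ?thesis
    unfolding interior_op_def by (intro continuous_intros continuous_on_coefficient assms) auto
qed

lemma continuous_on_interior_op':
  assumes "continuous_on S g" "\<And>z. z \<in> S \<Longrightarrow> g z \<in> {-1..0}" "continuous_on S J" "continuous_on S K"
  shows "continuous_on S (\<lambda>z. interior_op' (g z) (J z) (K z))"
proof -
  have "Hp (g z) ^ 3 \<noteq> 0" if "z \<in> S" for z using Hp_pos assms(2) that by fastforce
  then show ?thesis
    unfolding interior_op'_def by (intro continuous_intros continuous_on_coefficient assms) auto
qed

lemma continuous_on_top_op':
  assumes "continuous_on S J" "continuous_on S K" "\<And>z. z \<in> S \<Longrightarrow> Hp 0 + dp (J z) > 0"
  shows "continuous_on S (\<lambda>z. top_op' (J z) (K z))"
  unfolding top_op'_def using assms by (auto intro!: continuous_intros simp: less_le)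

lemma interior_op_reflect [simp]: "interior_op p (reflect j) = interior_op p j"
  by (simp add: interior_op_def)

lemma top_op_reflect [simp]: "top_op (reflect j) = top_op j"
  by (simp add: top_op_def)

definition solution :: "(real \<times> real \<Rightarrow> jet) \<Rightarrow> bool" where
  "solution U \<longleftrightarrow> holonomic U \<and> continuous_on strip U \<and>
     (\<forall>z\<in>strip. norm (U z) \<le> M \<and> Hp (snd z) + dp (U z) \<in> {c..M}) \<and>
     (\<forall>z\<in>strip. -1 < snd z \<longrightarrow> snd z < 0 \<longrightarrow> interior_op (snd z) (U z) = 0) \<and>
     (\<forall>q. top_op (U (q, 0)) = 0) \<and> (\<forall>q. val (U (q, -1)) = 0)"

lemma solutionD:
  assumes "solution U"
  shows "holonomic U" "continuous_on strip U" "top_op (U (q, 0)) = 0" "val (U (q, -1)) = 0"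
    "z \<in> strip \<Longrightarrow> norm (U z) \<le> M" "z \<in> strip \<Longrightarrow> c \<le> Hp (snd z) + dp (U z)"
    "z \<in> strip \<Longrightarrow> Hp (snd z) + dp (U z) \<le> M"
    "-1 < snd z \<Longrightarrow> snd z < 0 \<Longrightarrow> interior_op (snd z) (U z) = 0"
proof -
  show "holonomic U" "continuous_on strip U" "top_op (U (q, 0)) = 0" "val (U (q, -1)) = 0"
    "z \<in> strip \<Longrightarrow> norm (U z) \<le> M" "z \<in> strip \<Longrightarrow> c \<le> Hp (snd z) + dp (U z)"
    "z \<in> strip \<Longrightarrow> Hp (snd z) + dp (U z) \<le> M"
    using assms by (simp_all add: solution_def)
  assume "-1 < snd z" "snd z < 0"
  moreover from this have "z \<in> strip" by (simp add: strip_def)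
  ultimately show "interior_op (snd z) (U z) = 0" using assms by (simp add: solution_def)
qed

lemma solution_entry_bounds:
  assumes "solution U" "z \<in> strip"
  shows "\<bar>val (U z)\<bar> \<le> M" "\<bar>dq (U z)\<bar> \<le> M" "\<bar>dp (U z)\<bar> \<le> M"
    "\<bar>dqq (U z)\<bar> \<le> M" "\<bar>dqp (U z)\<bar> \<le> M" "\<bar>dpp (U z)\<bar> \<le> M"
  using solutionD(5)[OF assms] jet_entry_le_norm order_trans by blast+

lemma solution_interior_op:
  assumes U: "solution U" and p: "p \<in> {-1..0}"
  shows "interior_op p (U (q, p)) = 0"
proof (rule continuous_constant_on_closure[of "{-1<..<0}" "\<lambda>p. interior_op p (U (q, p))"])
  have "continuous_on {-1..0} (\<lambda>p. U (q, p))"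
    using continuous_on_strip_slice[OF solutionD(2)[OF U]] by simp
  then show "continuous_on (closure {-1<..<0}) (\<lambda>p. interior_op p (U (q, p)))"
    using continuous_on_interior_op[of "{-1..0}" "\<lambda>p. p"] by (simp add: continuous_on_id)
next
  fix t :: real assume "t \<in> {-1<..<0}"
  then show "interior_op t (U (q, t)) = 0" using solutionD(8)[OF U, of "(q, t)"] by simp
qed (use p in simp)

lemma solution_translate:
  assumes U: "solution U"
  shows "solution (\<lambda>z. U (fst z + k, snd z))"
  unfolding solution_def
proof (intro conjI ballI allI impI)
  show "continuous_on strip (\<lambda>z. U (fst z + k, snd z))"
    using solutionD(2)[OF U]
    by (rule continuous_on_compose2) (auto simp: strip_def intro!: continuous_intros)
  fix z :: "real \<times> real" assume "z \<in> strip"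
  then have "(fst z + k, snd z) \<in> strip" by (simp add: strip_def)
  note solutionD(5-8)[OF U, of "(fst z + k, snd z)"] this
  then show "norm (U (fst z + k, snd z)) \<le> M" "Hp (snd z) + dp (U (fst z + k, snd z)) \<in> {c..M}"
    "-1 < snd z \<Longrightarrow> snd z < 0 \<Longrightarrow> interior_op (snd z) (U (fst z + k, snd z)) = 0"
    by simp_all
qed (simp_all add: holonomic_translate solutionD[OF U])

lemma solution_reflect:
  assumes U: "solution U"
  shows "solution (\<lambda>z. reflect (U (k - fst z, snd z)))"
  unfolding solution_def interior_op_reflect
proof (intro conjI ballI allI impI)
  have "continuous_on strip (\<lambda>z. U (k - fst z, snd z))"
    using solutionD(2)[OF U]
    by (rule continuous_on_compose2) (auto simp: strip_def intro!: continuous_intros)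
  then show "continuous_on strip (\<lambda>z. reflect (U (k - fst z, snd z)))"
    unfolding reflect_def by (intro continuous_intros)
  fix z :: "real \<times> real" assume "z \<in> strip"
  then have "(k - fst z, snd z) \<in> strip" by (simp add: strip_def)
  note solutionD(5-8)[OF U, of "(k - fst z, snd z)"] this
  then show "norm (reflect (U (k - fst z, snd z))) \<le> M"
    "Hp (snd z) + dp (reflect (U (k - fst z, snd z))) \<in> {c..M}"
    "-1 < snd z \<Longrightarrow> snd z < 0 \<Longrightarrow> interior_op (snd z) (U (k - fst z, snd z)) = 0"
    by simp_all
qed (simp_all add: holonomic_reflect solutionD[OF U])

section \<open>Touching a solution from below\<close>

text \<open>The quadratic form of \<open>interior_op\<close> in the direction \<open>(x, - y)\<close> plus the one in direction
  \<open>(0, 1)\<close>; hence \<open>interior_op\<close> is degenerate elliptic.\<close>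

definition symbol :: "real \<Rightarrow> real \<Rightarrow> jet \<Rightarrow> real" where
  "symbol x y k = x\<^sup>2 * dqq k - 2 * x * y * dqp k + (1 + y\<^sup>2) * dpp k"

lemma interior_op_symbol:
  assumes "val j' = val j" "dq j' = dq j" "dp j' = dp j"
  shows "interior_op p j' = interior_op p j + symbol (Hp p + dp j) (dq j) (j' - j)"
  using assms by (simp add: interior_op_def symbol_def algebra_simps)

lemma touching_interior:
  assumes U: "solution U" and W: "holonomic W" "touches_below W U z" and z: "-1 < snd z" "snd z < 0"
  shows "interior_op (snd z) (W z) \<le> 0"
proof -
  note touch = touches_below_interior[OF W(1) solutionD(1)[OF U] W(2) z]
  define x y where "x = Hp (snd z) + dp (W z)" and "y = dq (W z)"
  have "val (U z) = val (W z)" using W(2) by (simp add: touches_below_def)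
  then have "interior_op (snd z) (U z) = interior_op (snd z) (W z) + symbol x y (U z - W z)"
    unfolding x_def y_def using touch(1,2) by (intro interior_op_symbol) simp_all
  moreover have "interior_op (snd z) (U z) = 0"
    by (rule solutionD(8)[OF U z])
  moreover have "symbol x y (U z - W z) \<ge> 0"
    using touch(3)[where a = x and b = "- y"] touch(3)[where a = 0 and b = 1]
    by (simp add: symbol_def algebra_simps)
  ultimately show ?thesis by simp
qed

lemma touching_top:
  assumes U: "solution U" and W: "holonomic W" "touches_below W U (q, 0)"
  shows "top_op (W (q, 0)) \<le> 0"
proof -
  note touch = touches_below_top[OF W(1) solutionD(1)[OF U] W(2)]
  have "0 < Hp 0 + dp (U (q, 0))" using solutionD(6)[OF U, of "(q, 0)"] c_pos by simp
  then have "(1 + (dq (U (q, 0)))\<^sup>2) / (2 * (Hp 0 + dp (W (q, 0)))\<^sup>2)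
      \<le> (1 + (dq (U (q, 0)))\<^sup>2) / (2 * (Hp 0 + dp (U (q, 0)))\<^sup>2)"
    using touch(2) by (intro divide_left_mono mult_left_mono power_mono mult_pos_pos) auto
  then have "top_op (W (q, 0)) \<le> top_op (U (q, 0))"
    using W(2) touch(1) by (simp add: top_op_def touches_below_def)
  then show ?thesis using solutionD(3)[OF U] by simp
qed

definition load :: "jet \<Rightarrow> real" where
  "load k = \<bar>dq k\<bar> + \<bar>dp k\<bar> + max 0 (- val k)"

definition interior_lower_bound :: "real \<Rightarrow> bool" where
  "interior_lower_bound L \<longleftrightarrow> (\<forall>p\<in>{-1..0}. \<forall>j k.
     norm j \<le> M \<longrightarrow> \<bar>val (j + k)\<bar> \<le> M \<longrightarrow> \<bar>dq (j + k)\<bar> \<le> M \<longrightarrow> Hp p + dp (j + k) \<in> {0..M} \<longrightarrow>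
     interior_op p j + symbol (Hp p + dp (j + k)) (dq (j + k)) k - L * load k \<le> interior_op p (j + k))"

lemma interior_op_lipschitz:
  obtains L where "L > 0" "\<And>p j k. p \<in> {-1..0} \<Longrightarrow> norm j \<le> R \<Longrightarrow> norm (j + k) \<le> R \<Longrightarrow>
    \<bar>interior_op p (j + k) - interior_op p j\<bar> \<le> L * norm k"
proof -
  let ?S = "{-1..0} \<times> cball 0 R \<times> cball (0 :: jet) 1"
  have "continuous_on ?S (\<lambda>z. interior_op' (fst z) (fst (snd z)) (snd (snd z)))"
    by (intro continuous_on_interior_op' continuous_intros) auto
  then have "bounded ((\<lambda>z. interior_op' (fst z) (fst (snd z)) (snd (snd z))) ` ?S)"
    by (intro compact_imp_bounded compact_continuous_image compact_Times) auto
  then obtain L where L: "L > 0"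
    "\<And>z. z \<in> ?S \<Longrightarrow> \<bar>interior_op' (fst z) (fst (snd z)) (snd (snd z))\<bar> \<le> L"
    by (auto simp: bounded_pos)
  show thesis
  proof (rule that[OF L(1)])
    fix p :: real and j k :: jet
    assume p: "p \<in> {-1..0}" and j: "norm j \<le> R" "norm (j + k) \<le> R"
    obtain t where t: "0 < t" "t < 1"
      "interior_op p (j + k) = interior_op p j + interior_op' p (j + t *\<^sub>R k) k"
      by (rule interior_op_mvt)
    have "j + t *\<^sub>R k = (1 - t) *\<^sub>R j + t *\<^sub>R (j + k)" by (simp add: algebra_simps)
    also have "\<dots> \<in> cball 0 R" using j t(1,2) by (intro convexD[OF convex_cball]) auto
    finally have "(p, j + t *\<^sub>R k, sgn k) \<in> ?S" using p by (simp add: norm_sgn)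
    from L(2)[OF this] have "\<bar>norm k * interior_op' p (j + t *\<^sub>R k) (sgn k)\<bar> \<le> norm k * L"
      by (simp add: abs_mult mult_left_mono)
    moreover have "norm k *\<^sub>R sgn k = k" by (cases "k = 0") (simp_all add: sgn_div_norm)
    ultimately show "\<bar>interior_op p (j + k) - interior_op p j\<bar> \<le> L * norm k"
      using t(3) interior_op'_scaleR[of p "j + t *\<^sub>R k" "norm k" "sgn k"] by (simp add: mult.commute)
  qed
qed

lemma interior_lower_bound_exists: "\<exists>L>0. interior_lower_bound L"
proof -
  obtain B where B: "\<And>p. p \<in> {-1..0} \<Longrightarrow> \<bar>Hp p\<bar> \<le> B"
    using continuous_on_Icc_bounded[OF Hp_cont] by blast
  define R where "R = 6 * M + B"
  obtain L where L: "L > 0" "\<And>p j k. p \<in> {-1..0} \<Longrightarrow> norm j \<le> R \<Longrightarrow> norm (j + k) \<le> R \<Longrightarrow>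
    \<bar>interior_op p (j + k) - interior_op p j\<bar> \<le> L * norm k"
    using interior_op_lipschitz[of R] by blast
  have "interior_op p j + symbol (Hp p + dp (j + k)) (dq (j + k)) k - L * load k \<le> interior_op p (j + k)"
    if p: "p \<in> {-1..0}" and j: "norm j \<le> M" and jk: "\<bar>val (j + k)\<bar> \<le> M" "\<bar>dq (j + k)\<bar> \<le> M"
      and x: "Hp p + dp (j + k) \<in> {0..M}" for p j k
  proof -
    define l :: jet where "l = (min 0 (val k), (dq k, dp k), (0, 0, 0))"
    note jb = jet_entry_le_norm[of j, THEN order_trans[OF _ j]]
    have "norm l \<le> load k"
      unfolding l_def load_def by (rule order_trans[OF norm_jet_le]) simp
    moreover have "norm (j + l) \<le> R"
    proof -
      have "j + l = (val (j + l), (dq (j + l), dp (j + l)), (dqq j, dqp j, dpp j))"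
        by (simp add: prod_eq_iff jet_entry_defs l_def)
      then have "norm (j + l) \<le> \<bar>val (j + l)\<bar> + (\<bar>dq (j + l)\<bar> + \<bar>dp (j + l)\<bar>) + (\<bar>dqq j\<bar> + (\<bar>dqp j\<bar> + \<bar>dpp j\<bar>))"
        by (metis norm_jet_le)
      moreover have "\<bar>val (j + l)\<bar> \<le> M" using jb(1) jk(1) by (auto simp: l_def)
      moreover have "\<bar>dq (j + l)\<bar> \<le> M" "\<bar>dp (j + l)\<bar> \<le> M + B" using jk(2) x B[OF p] by (auto simp: l_def)
      ultimately show ?thesis using jb(4-6) by (simp add: R_def)
    qed
    moreover have "norm j \<le> R" using j B[OF p] M_pos by (simp add: R_def)
    ultimately have "interior_op p (j + l) \<ge> interior_op p j - L * load k"
      using L(2)[OF p, of j l] mult_left_mono[of "norm l" "load k" L] L(1) by linarith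
    moreover have "interior_op p (j + k) = interior_op p (j + l) + symbol (Hp p + dp (j + k)) (dq (j + k)) k
        + (Hp p + dp (j + k)) ^ 3 * (- (\<mu> * \<rho>p p)) * (val k - min 0 (val k))"
      by (simp add: interior_op_def symbol_def l_def algebra_simps)
    moreover have "(Hp p + dp (j + k)) ^ 3 * (- (\<mu> * \<rho>p p)) * (val k - min 0 (val k)) \<ge> 0"
      using x \<rho>p_nonpos[OF p] \<mu>_pos by (intro mult_nonneg_nonneg) (auto simp: mult_nonneg_nonpos)
    ultimately show ?thesis by linarith
  qed
  then show ?thesis using L(1) unfolding interior_lower_bound_def by blast
qed

definition \<Lambda> :: real where "\<Lambda> = (SOME L. L > 0 \<and> interior_lower_bound L)"

lemma \<Lambda>: "\<Lambda> > 0" "interior_lower_bound \<Lambda>"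
  using someI_ex[OF interior_lower_bound_exists] by (simp_all add: \<Lambda>_def)

definition excess :: "real \<Rightarrow> real \<Rightarrow> jet \<Rightarrow> real" where
  "excess x y k = symbol x y k - \<Lambda> * load k"

lemma interior_op_add_ge:
  assumes "p \<in> {-1..0}" "norm j \<le> M" "\<bar>val (j + k)\<bar> \<le> M" "\<bar>dq (j + k)\<bar> \<le> M" "Hp p + dp (j + k) \<in> {0..M}"
  shows "interior_op p j + excess (Hp p + dp (j + k)) (dq (j + k)) k \<le> interior_op p (j + k)"
  using \<Lambda>(2) assms unfolding interior_lower_bound_def excess_def add_diff_eq by blast

definition top_excess :: "jet \<Rightarrow> real" where
  "top_excess k = - dp k / M ^ 3 - \<bar>dq k\<bar> * (M / c\<^sup>2) + \<mu> * \<rho>0 * val k"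

text \<open>Adding such a jet to the jet of a solution produces a strict subsolution at height \<open>p\<close>, whatever the
  solution.\<close>

definition strict_increment :: "real \<Rightarrow> jet \<Rightarrow> bool" where
  "strict_increment p k \<longleftrightarrow> (if p < 0 then \<forall>x\<in>{c..M}. \<forall>y\<in>{-M..M}. excess x y k > 0
     else dp k \<le> 0 \<and> top_excess k > 0)"

lemma load_add: "load (j + k) \<le> load j + load k"
proof -
  have "max 0 (- (val j + val k)) \<le> max 0 (- val j) + max 0 (- val k)" by simp
  then show ?thesis
    using abs_triangle_ineq[of "dq j" "dq k"] abs_triangle_ineq[of "dp j" "dp k"]
    unfolding load_def jet_entry_linear by linarith
qed

lemma load_scaleR: "m \<ge> 0 \<Longrightarrow> load (m *\<^sub>R k) = m * load k"
  by (simp add: load_def abs_mult distrib_left max_mult_distrib_left)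

lemma load_le_norm: "load k \<le> 3 * norm k"
  using jet_entry_le_norm(1-3)[of k] by (simp add: load_def)

lemma symbol_add: "symbol x y (j + k) = symbol x y j + symbol x y k"
  by (simp add: symbol_def algebra_simps)

lemma symbol_ge_norm:
  assumes "\<bar>x\<bar> \<le> M" "\<bar>y\<bar> \<le> M"
  shows "symbol x y k \<ge> - (5 * M\<^sup>2 * norm k)"
proof -
  have x: "x\<^sup>2 \<le> M\<^sup>2" "1 + y\<^sup>2 \<le> 2 * M\<^sup>2" "\<bar>2 * x * y\<bar> \<le> 2 * M\<^sup>2"
  proof -
    show "x\<^sup>2 \<le> M\<^sup>2" using assms(1) abs_le_square_iff[of x M] by simp
    have "y\<^sup>2 \<le> M\<^sup>2" using assms(2) abs_le_square_iff[of y M] by simp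
    then show "1 + y\<^sup>2 \<le> 2 * M\<^sup>2" using one_le_power[OF M_ge_1, of 2] by linarith
    show "\<bar>2 * x * y\<bar> \<le> 2 * M\<^sup>2"
      using assms by (simp add: abs_mult power2_eq_square mult_mono)
  qed
  have "\<bar>x\<^sup>2 * dqq k\<bar> \<le> M\<^sup>2 * norm k" "\<bar>2 * x * y * dqp k\<bar> \<le> 2 * M\<^sup>2 * norm k"
    "\<bar>(1 + y\<^sup>2) * dpp k\<bar> \<le> 2 * M\<^sup>2 * norm k"
    unfolding abs_mult[of _ "dqq k"] abs_mult[of _ "dqp k"] abs_mult[of _ "dpp k"]
    by (intro mult_mono jet_entry_le_norm; use x in simp)+
  then show ?thesis unfolding symbol_def by linarith
qed

lemma excess_add: "excess x y j + excess x y k \<le> excess x y (j + k)"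
  using mult_left_mono[OF load_add[of j k], of \<Lambda>] \<Lambda>(1) by (simp add: excess_def symbol_add algebra_simps)

lemma excess_ge_norm:
  assumes "\<bar>x\<bar> \<le> M" "\<bar>y\<bar> \<le> M"
  shows "excess x y k \<ge> - ((5 * M\<^sup>2 + 3 * \<Lambda>) * norm k)"
proof -
  have "\<Lambda> * load k \<le> \<Lambda> * (3 * norm k)" using \<Lambda>(1) load_le_norm by simp
  then show ?thesis
    using symbol_ge_norm[OF assms, of k] unfolding excess_def distrib_right by linarith
qed

lemma strict_increment_scaleR:
  assumes "strict_increment p k" "m > 0"
  shows "strict_increment p (m *\<^sub>R k)"
proof -
  have "excess x y (m *\<^sub>R k) = m * excess x y k" for x y
    using assms(2) by (simp add: excess_def symbol_def load_scaleR algebra_simps)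
  moreover have "top_excess (m *\<^sub>R k) = m * top_excess k"
    using assms(2) by (simp add: top_excess_def abs_mult algebra_simps)
  ultimately show ?thesis
    using assms by (simp add: strict_increment_def mult_nonneg_nonpos)
qed

lemma strict_increment_mono_val:
  assumes "strict_increment p (u, a, b)" "u \<le> v"
  shows "strict_increment p (v, a, b)"
proof -
  obtain a1 a2 b1 b2 b3 where ab: "a = (a1, a2)" "b = (b1, b2, b3)" by (metis prod.exhaust)
  have "load (v, a, b) \<le> load (u, a, b)" using assms(2) by (simp add: load_def ab)
  then have "excess x y (u, a, b) \<le> excess x y (v, a, b)" for x y
    using \<Lambda>(1) by (simp add: excess_def symbol_def ab)
  moreover have "top_excess (u, a, b) \<le> top_excess (v, a, b)"
    using assms(2) \<mu>_pos \<rho>0_pos by (simp add: top_excess_def ab)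
  moreover have "dp (v, a, b) = dp (u, a, b)" by (simp add: ab)
  ultimately show ?thesis
    using assms(1) unfolding strict_increment_def by (smt (verit))
qed

lemma top_op_lower:
  assumes j: "Hp 0 + dp j \<le> M" "\<bar>dq j\<bar> \<le> M" and jk: "c \<le> Hp 0 + dp (j + k)" "\<bar>dq (j + k)\<bar> \<le> M"
    and k: "dp k \<le> 0"
  shows "top_op j + top_excess k \<le> top_op (j + k)"
proof -
  have x: "Hp 0 + dp (j + t *\<^sub>R k) \<in> {c..M}" if "t \<in> {0..1}" for t
  proof -
    have "dp k \<le> t * dp k" "t * dp k \<le> 0"
      using k that by (auto simp: mult_le_cancel_right1 mult_nonneg_nonpos)
    then show ?thesis using j(1) jk(1) by simp
  qed
  then have "Hp 0 + dp (j + t *\<^sub>R k) > 0" if "t \<in> {0..1}" for t using c_pos that by fastforce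
  then obtain t where t: "0 < t" "t < 1" "top_op (j + k) = top_op j + top_op' (j + t *\<^sub>R k) k"
    by (rule top_op_mvt)
  define X Y where "X = Hp 0 + dp (j + t *\<^sub>R k)" and "Y = dq (j + t *\<^sub>R k)"
  have X: "c \<le> X" "X \<le> M" "X > 0" using x[of t] t c_pos by (auto simp: X_def)
  have "Y = (1 - t) *\<^sub>R dq j + t *\<^sub>R dq (j + k)" by (simp add: Y_def algebra_simps)
  also have "\<dots> \<in> cball 0 M" using j(2) jk(2) t by (intro convexD[OF convex_cball]) auto
  finally have "\<bar>Y\<bar> \<le> M" by simp
  then have "\<bar>Y * dq k / X\<^sup>2\<bar> \<le> M * \<bar>dq k\<bar> / c\<^sup>2"
    using X c_pos by (auto simp: abs_mult intro!: frac_le mult_right_mono power_mono)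
  moreover have "- dp k * (1 / M ^ 3) \<le> - dp k * ((1 + Y\<^sup>2) / X ^ 3)"
    using X k by (intro mult_left_mono frac_le power_mono) auto
  ultimately have "top_excess k \<le> Y * dq k / X\<^sup>2 - (1 + Y\<^sup>2) * dp k / X ^ 3 + \<mu> * \<rho>0 * val k"
    unfolding top_excess_def abs_le_iff by (simp add: mult_ac)
  also have "\<dots> = top_op' (j + t *\<^sub>R k) k" by (simp add: top_op'_def X_def Y_def)
  finally show ?thesis by (simp add: t(3))
qed

lemma no_strict_touching:
  assumes U: "solution U" and V: "solution V" and K: "holonomic K"
    and touch: "touches_below (\<lambda>z. V z + K z) U z" and z: "z \<in> strip" "-1 < snd z"
  shows "\<not> strict_increment (snd z) (K z)"
proof
  assume strict: "strict_increment (snd z) (K z)"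
  note W = holonomic_add[OF solutionD(1)[OF V] K]
  note Ub = solution_entry_bounds[OF U z(1)] solutionD(6,7)[OF U z(1)]
  note Vb = solution_entry_bounds[OF V z(1)] solutionD(5-7)[OF V z(1)]
  show False
  proof (cases "snd z = 0")
    case False
    then have p: "snd z < 0" "snd z \<in> {-1..0}" using z by (auto simp: strip_def)
    note eq = touches_below_interior(1,2)[OF W solutionD(1)[OF U] touch z(2) p(1)]
    have "val (V z + K z) = val (U z)" using touch by (simp add: touches_below_def)
    then have "interior_op (snd z) (V z) + excess (Hp (snd z) + dp (U z)) (dq (U z)) (K z)
        \<le> interior_op (snd z) (V z + K z)"
      using interior_op_add_ge[OF p(2) Vb(7), of "K z"] Ub(1,2,7,8) c_pos unfolding eq by simp
    moreover have "interior_op (snd z) (V z) = 0" by (rule solutionD(8)[OF V z(2) p(1)])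
    moreover have "excess (Hp (snd z) + dp (U z)) (dq (U z)) (K z) > 0"
      using strict p(1) Ub by (auto simp: strict_increment_def abs_le_iff)
    ultimately show False using touching_interior[OF U W touch z(2) p(1)] by linarith
  next
    case True
    then obtain q where q: "z = (q, 0)" by (metis prod.collapse)
    note le = touches_below_top[OF W solutionD(1)[OF U] touch[unfolded q]]
    have "c \<le> Hp 0 + dp (V (q, 0) + K (q, 0))" using Ub(7) le(2) unfolding q by simp
    moreover have "\<bar>dq (V (q, 0) + K (q, 0))\<bar> \<le> M" using Ub(2) unfolding le(1) q .
    ultimately have "top_op (V (q, 0)) + top_excess (K (q, 0)) \<le> top_op (V (q, 0) + K (q, 0))"
      using strict Vb(2,9) by (intro top_op_lower) (simp_all add: q strict_increment_def)
    then show False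
      using touching_top[OF U W touch[unfolded q]] solutionD(3)[OF V] strict
      by (simp add: q strict_increment_def)
  qed
qed

end

section \<open>Barriers and the strong maximum principle\<close>

lemma dist_prod_power2:
  fixes z a :: "real \<times> real"
  shows "(dist z a)\<^sup>2 = (fst z - fst a)\<^sup>2 + (snd z - snd a)\<^sup>2"
  by (simp add: dist_prod_def dist_real_def)

definition gauss :: "real \<Rightarrow> real \<Rightarrow> real \<Rightarrow> real" where
  "gauss \<alpha> s t = exp (- \<alpha> * (t - s)\<^sup>2)"

definition gaussian_jet :: "real \<Rightarrow> real \<times> real \<Rightarrow> real \<times> real \<Rightarrow> jet" where
  "gaussian_jet \<alpha> a = product_jet
     (gauss \<alpha> (fst a)) (\<lambda>q. - 2 * \<alpha> * (q - fst a) * gauss \<alpha> (fst a) q)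
     (\<lambda>q. (4 * \<alpha>\<^sup>2 * (q - fst a)\<^sup>2 - 2 * \<alpha>) * gauss \<alpha> (fst a) q)
     (gauss \<alpha> (snd a)) (\<lambda>p. - 2 * \<alpha> * (p - snd a) * gauss \<alpha> (snd a) p)
     (\<lambda>p. (4 * \<alpha>\<^sup>2 * (p - snd a)\<^sup>2 - 2 * \<alpha>) * gauss \<alpha> (snd a) p)"

lemma gaussian_jet_eq:
  "gaussian_jet \<alpha> a z = exp (- \<alpha> * (dist z a)\<^sup>2) *\<^sub>R
     (1, (- 2 * \<alpha> * (fst z - fst a), - 2 * \<alpha> * (snd z - snd a)),
      (4 * \<alpha>\<^sup>2 * (fst z - fst a)\<^sup>2 - 2 * \<alpha>, 4 * \<alpha>\<^sup>2 * (fst z - fst a) * (snd z - snd a),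
       4 * \<alpha>\<^sup>2 * (snd z - snd a)\<^sup>2 - 2 * \<alpha>))"
proof -
  have "gauss \<alpha> (fst a) (fst z) * gauss \<alpha> (snd a) (snd z) = exp (- \<alpha> * (dist z a)\<^sup>2)"
    by (simp add: gauss_def dist_prod_power2 distrib_left exp_add[symmetric])
  then show ?thesis
    by (simp add: gaussian_jet_def product_jet_def power2_eq_square)
qed

lemma holonomic_gaussian_jet: "holonomic (gaussian_jet \<alpha> a)"
proof -
  have "(gauss \<alpha> s has_real_derivative - 2 * \<alpha> * (t - s) * gauss \<alpha> s t) (at t within S)" for s t S
    unfolding gauss_def by (auto intro!: derivative_eq_intros)
  moreover from this have "((\<lambda>t. - 2 * \<alpha> * (t - s) * gauss \<alpha> s t) has_real_derivative
      (4 * \<alpha>\<^sup>2 * (t - s)\<^sup>2 - 2 * \<alpha>) * gauss \<alpha> s t) (at t within S)" for s t S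
    by (auto intro!: derivative_eq_intros simp: algebra_simps power2_eq_square)
  ultimately show ?thesis
    unfolding gaussian_jet_def by (intro holonomic_product_jet)
qed

context height_problem
begin

definition \<kappa> :: real where "\<kappa> = 1 / (2 * M\<^sup>2 / c\<^sup>2 + 1 + 2 / c\<^sup>2)"

lemma \<kappa>_pos: "\<kappa> > 0"
  using c_pos by (simp add: \<kappa>_def add_nonneg_pos)

lemma ellipticity:
  assumes x: "c \<le> x" and y: "\<bar>y\<bar> \<le> M"
  shows "\<kappa> * (a\<^sup>2 + b\<^sup>2) \<le> x\<^sup>2 * a\<^sup>2 - 2 * x * y * a * b + (1 + y\<^sup>2) * b\<^sup>2"
proof -
  define s where "s = x * a - y * b"
  have "(x * a)\<^sup>2 \<le> 2 * s\<^sup>2 + 2 * (y * b)\<^sup>2"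
    using sum_squares_bound[of s "y * b"] by (simp add: s_def algebra_simps power2_eq_square)
  also have "(y * b)\<^sup>2 \<le> M\<^sup>2 * b\<^sup>2"
    using y by (auto simp: power_mult_distrib abs_le_square_iff[symmetric] intro!: mult_right_mono)
  finally have "x\<^sup>2 * a\<^sup>2 \<le> 2 * s\<^sup>2 + 2 * M\<^sup>2 * b\<^sup>2" by (simp add: power_mult_distrib)
  moreover have "c\<^sup>2 * a\<^sup>2 \<le> x\<^sup>2 * a\<^sup>2" using x c_pos by (intro mult_right_mono power_mono) auto
  ultimately have "a\<^sup>2 \<le> (2 * s\<^sup>2 + 2 * M\<^sup>2 * b\<^sup>2) / c\<^sup>2"
    using c_pos by (simp add: pos_le_divide_eq mult.commute)
  then have "a\<^sup>2 + b\<^sup>2 \<le> 2 / c\<^sup>2 * s\<^sup>2 + (2 * M\<^sup>2 / c\<^sup>2 + 1) * b\<^sup>2"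
    by (simp add: add_divide_distrib algebra_simps)
  also have "\<dots> \<le> 1 / \<kappa> * s\<^sup>2 + 1 / \<kappa> * b\<^sup>2"
    using c_pos by (intro add_mono mult_right_mono) (auto simp: \<kappa>_def)
  finally have "\<kappa> * (a\<^sup>2 + b\<^sup>2) \<le> s\<^sup>2 + b\<^sup>2"
    using \<kappa>_pos by (simp add: field_simps)
  also have "\<dots> = x\<^sup>2 * a\<^sup>2 - 2 * x * y * a * b + (1 + y\<^sup>2) * b\<^sup>2"
    by (simp add: s_def algebra_simps power2_eq_square)
  finally show ?thesis .
qed

definition \<tau> :: real where "\<tau> = c\<^sup>2 / (2 * M ^ 4)"

lemma \<tau>_pos: "\<tau> > 0"
  using c_pos M_pos by (simp add: \<tau>_def)

definition barrier_rate :: "real \<Rightarrow> real" where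
  "barrier_rate r = (3 * M\<^sup>2 + 2 * \<Lambda> + 1) / (2 * \<kappa> * r\<^sup>2)"

lemma barrier_rate_pos: "r > 0 \<Longrightarrow> barrier_rate r > 0"
  using \<Lambda>(1) \<kappa>_pos by (simp add: barrier_rate_def add_nonneg_pos)

lemma gaussian_excess_pos:
  assumes r: "0 < r" "r \<le> dist z a" and near: "\<bar>fst z - fst a\<bar> \<le> 1" "\<bar>snd z - snd a\<bar> \<le> 1"
    and xy: "x \<in> {c..M}" "y \<in> {-M..M}"
  shows "excess x y (0, snd (gaussian_jet (barrier_rate r) a z)) > 0"
proof -
  define \<alpha> E where "\<alpha> = barrier_rate r" and "E = exp (- \<alpha> * (dist z a)\<^sup>2)"
  define s t where "s = fst z - fst a" and "t = snd z - snd a"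
  have \<alpha>: "\<alpha> > 0" using barrier_rate_pos[OF r(1)] by (simp add: \<alpha>_def)
  have jet: "(0, snd (gaussian_jet \<alpha> a z)) = (0, (E * (- 2 * \<alpha> * s), E * (- 2 * \<alpha> * t)),
      (E * (4 * \<alpha>\<^sup>2 * s\<^sup>2 - 2 * \<alpha>), E * (4 * \<alpha>\<^sup>2 * s * t), E * (4 * \<alpha>\<^sup>2 * t\<^sup>2 - 2 * \<alpha>)))"
    by (simp add: gaussian_jet_eq E_def s_def t_def)
  have "r\<^sup>2 \<le> s\<^sup>2 + t\<^sup>2"
    using power_mono[OF r(2), of 2] r(1) by (simp add: dist_prod_power2 s_def t_def)
  then have "\<kappa> * r\<^sup>2 \<le> \<kappa> * (s\<^sup>2 + t\<^sup>2)" using \<kappa>_pos by simp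
  also have "\<dots> \<le> x\<^sup>2 * s\<^sup>2 - 2 * x * y * s * t + (1 + y\<^sup>2) * t\<^sup>2"
    using xy by (intro ellipticity) auto
  finally have "2 * \<alpha> * (\<kappa> * r\<^sup>2) \<le> 2 * \<alpha> * (x\<^sup>2 * s\<^sup>2 - 2 * x * y * s * t + (1 + y\<^sup>2) * t\<^sup>2)"
    using \<alpha> by (intro mult_left_mono) auto
  moreover have "2 * \<alpha> * (\<kappa> * r\<^sup>2) = 3 * M\<^sup>2 + 2 * \<Lambda> + 1"
    using r(1) \<kappa>_pos by (simp add: \<alpha>_def barrier_rate_def)
  moreover have "x\<^sup>2 \<le> M\<^sup>2" "y\<^sup>2 \<le> M\<^sup>2"
    using xy c_pos abs_le_square_iff[of x M] abs_le_square_iff[of y M] by auto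
  moreover have "1 \<le> M\<^sup>2" using M_ge_1 by (rule one_le_power)
  moreover have "\<Lambda> * (\<bar>s\<bar> + \<bar>t\<bar>) \<le> \<Lambda> * 2"
    using near \<Lambda>(1) by (intro mult_left_mono) (auto simp: s_def t_def)
  ultimately have "2 * \<alpha> * (x\<^sup>2 * s\<^sup>2 - 2 * x * y * s * t + (1 + y\<^sup>2) * t\<^sup>2) - (x\<^sup>2 + 1 + y\<^sup>2)
      - \<Lambda> * (\<bar>s\<bar> + \<bar>t\<bar>) > 0" by linarith
  then have "E * (2 * \<alpha>) * (2 * \<alpha> * (x\<^sup>2 * s\<^sup>2 - 2 * x * y * s * t + (1 + y\<^sup>2) * t\<^sup>2) - (x\<^sup>2 + 1 + y\<^sup>2)
      - \<Lambda> * (\<bar>s\<bar> + \<bar>t\<bar>)) > 0" using \<alpha> by (simp add: E_def)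
  also have "E * (2 * \<alpha>) * (2 * \<alpha> * (x\<^sup>2 * s\<^sup>2 - 2 * x * y * s * t + (1 + y\<^sup>2) * t\<^sup>2) - (x\<^sup>2 + 1 + y\<^sup>2)
      - \<Lambda> * (\<bar>s\<bar> + \<bar>t\<bar>)) = excess x y (0, snd (gaussian_jet \<alpha> a z))"
    unfolding jet excess_def symbol_def load_def jet_entries
    using \<alpha> by (simp add: abs_mult E_def) (simp add: algebra_simps power2_eq_square)
  finally show ?thesis by (simp add: \<alpha>_def)
qed

lemma gaussian_top_excess_pos:
  assumes "\<alpha> > 0" "snd z = 0" "snd a < 0" "(dist z a)\<^sup>2 \<le> (1 + \<tau>\<^sup>2) * (snd a)\<^sup>2"
  shows "dp (gaussian_jet \<alpha> a z) \<le> 0" "top_excess (0, snd (gaussian_jet \<alpha> a z)) > 0"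
proof -
  define E s t where "E = exp (- \<alpha> * (dist z a)\<^sup>2)" and "s = fst z - fst a" and "t = - snd a"
  have t: "t > 0" "snd z - snd a = t" using assms(2,3) by (simp_all add: t_def)
  have E: "E > 0" by (simp add: E_def)
  have "\<bar>E * (- 2 * \<alpha> * s)\<bar> = 2 * \<alpha> * E * \<bar>s\<bar>" using assms(1) E by (simp add: abs_mult)
  then have jet: "dp (gaussian_jet \<alpha> a z) = - (2 * \<alpha> * E * t)"
    "top_excess (0, snd (gaussian_jet \<alpha> a z)) = 2 * \<alpha> * E * (t / M ^ 3 - \<bar>s\<bar> * (M / c\<^sup>2))"
    unfolding gaussian_jet_eq E_def[symmetric] s_def[symmetric] t(2)
    by (simp_all add: top_excess_def right_diff_distrib mult_ac)
  show "dp (gaussian_jet \<alpha> a z) \<le> 0" unfolding jet using assms(1) t(1) E by simp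
  have "s\<^sup>2 \<le> (\<tau> * t)\<^sup>2"
    using assms(2,4) by (simp add: dist_prod_power2 s_def t_def power_mult_distrib algebra_simps)
  then have "\<bar>s\<bar> \<le> \<tau> * t"
    using t(1) \<tau>_pos by (simp add: abs_le_square_iff[symmetric] abs_mult)
  then have "\<bar>s\<bar> * (M / c\<^sup>2) \<le> \<tau> * t * (M / c\<^sup>2)" using M_pos by (intro mult_right_mono) auto
  also have "\<dots> = t / (2 * M ^ 3)"
    using c_pos M_pos by (simp add: \<tau>_def power4_eq_xxxx power3_eq_cube)
  also have "\<dots> < t / M ^ 3" using t(1) M_pos by (simp add: field_simps)
  finally show "top_excess (0, snd (gaussian_jet \<alpha> a z)) > 0"
    unfolding jet using assms(1) E by simp
qed

lemma gaussian_strict_increment: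
  assumes "0 < r" "r \<le> dist z a" "\<bar>fst z - fst a\<bar> \<le> 1" "\<bar>snd z - snd a\<bar> \<le> 1" "snd z \<le> 0"
    and "snd a < 0" "(dist z a)\<^sup>2 \<le> (1 + \<tau>\<^sup>2) * (snd a)\<^sup>2" and "v \<ge> 0"
  shows "strict_increment (snd z) (v, snd (gaussian_jet (barrier_rate r) a z))"
proof -
  have "dp (0, snd j) = dp j" for j by (simp add: dp_def)
  then have "strict_increment (snd z) (0, snd (gaussian_jet (barrier_rate r) a z))"
    unfolding strict_increment_def
    using assms gaussian_excess_pos gaussian_top_excess_pos[OF barrier_rate_pos] by simp
  then show ?thesis
    using strict_increment_mono_val[OF _ \<open>v \<ge> 0\<close>] by (metis prod.collapse)
qed

lemma gaussian_barrier_no_minimum: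
  fixes U V :: "real \<times> real \<Rightarrow> jet" and a :: "real \<times> real" and r \<eta> :: real
  defines "f \<equiv> \<lambda>z. val (U z) - val (V z) - \<eta> * val (gaussian_jet (barrier_rate r) a z)"
  assumes U: "solution U" and V: "solution V" and "\<eta> > 0" "0 < r"
    and z: "z \<in> strip" "-1 < snd z" "val (V z) \<le> val (U z)"
    and a: "snd a < 0" "r \<le> dist z a" "\<bar>fst z - fst a\<bar> \<le> 1" "\<bar>snd z - snd a\<bar> \<le> 1"
      "(dist z a)\<^sup>2 \<le> (1 + \<tau>\<^sup>2) * (snd a)\<^sup>2"
  shows "\<not> (\<forall>\<^sub>F y in at z within strip. f z \<le> f y)"
proof
  assume min: "\<forall>\<^sub>F y in at z within strip. f z \<le> f y"
  define g where "g = gaussian_jet (barrier_rate r) a"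
  have f: "f y = val (U y) - val (V y) - \<eta> * val (g y)" for y by (simp add: f_def g_def)
  define K where "K y = \<eta> *\<^sub>R g y + (f z, 0, 0)" for y
  have "touches_below (\<lambda>y. V y + K y) U z"
    unfolding touches_below_def
  proof
    show "val (V z + K z) = val (U z)" by (simp add: K_def f val_def)
    show "\<forall>\<^sub>F y in at z within strip. val (V y + K y) \<le> val (U y)"
      using min by eventually_elim (simp add: K_def f val_def)
  qed
  moreover have "holonomic K"
    unfolding K_def g_def by (intro holonomic_add holonomic_scaleR holonomic_gaussian_jet holonomic_const)
  ultimately have "\<not> strict_increment (snd z) (K z)"
    using z(1,2) by (intro no_strict_touching[OF U V])
  moreover have "snd z \<le> 0" using z(1) by (simp add: strip_def)
  then have "strict_increment (snd z) (\<eta> *\<^sub>R ((val (U z) - val (V z)) / \<eta>, snd (g z)))"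
    unfolding g_def using assms(4,5) z(3) a
    by (intro strict_increment_scaleR gaussian_strict_increment) simp_all
  moreover have "\<eta> *\<^sub>R ((val (U z) - val (V z)) / \<eta>, snd (g z)) = K z"
    using \<open>\<eta> > 0\<close> by (simp add: K_def f val_def prod_eq_iff)
  ultimately show False by simp
qed

lemma barrier:
  assumes U: "solution U" and V: "solution V" and "\<eta> > 0"
    and ball: "0 < r" "r < R" "snd a < 0" "-1 < snd a - R" "R\<^sup>2 \<le> (1 + \<tau>\<^sup>2) * (snd a)\<^sup>2"
    and ge: "\<And>z. z \<in> cball a R \<Longrightarrow> snd z \<le> 0 \<Longrightarrow> val (V z) \<le> val (U z)"
    and core: "\<And>z. z \<in> cball a r \<Longrightarrow> snd z \<le> 0 \<Longrightarrow> val (V z) + \<eta> \<le> val (U z)"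
    and z: "z \<in> cball a R" "snd z \<le> 0"
  shows "\<eta> * (exp (- barrier_rate r * (dist z a)\<^sup>2) - exp (- barrier_rate r * R\<^sup>2)) \<le> val (U z) - val (V z)"
proof (rule ccontr)
  define g where "g z = val (gaussian_jet (barrier_rate r) a z)" for z
  define S where "S = cball a R \<inter> {z. snd z \<le> 0}"
  define f where "f z = val (U z) - val (V z) - \<eta> * g z" for z
  have g: "g z = exp (- barrier_rate r * (dist z a)\<^sup>2)" for z by (simp add: g_def gaussian_jet_eq)
  assume "\<not> ?thesis"
  then have "f z < - (\<eta> * exp (- barrier_rate r * R\<^sup>2))" by (simp add: f_def g algebra_simps)
  have S: "-1 < snd z" "z \<in> strip" if "z \<in> S" for z
    using that dist_snd_le[of z a] ball(4) by (auto simp: S_def strip_def dist_real_def dist_commute)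
  have "continuous_on S f"
    unfolding f_def g_def using S(2) solutionD(1)[OF U] solutionD(1)[OF V] holonomic_gaussian_jet
    by (intro continuous_intros continuous_on_subset[OF holonomic_continuous_on_val]) auto
  moreover have "compact S" "z \<in> S"
    unfolding S_def using z by (auto intro!: compact_Int_closed closed_Collect_le continuous_intros)
  ultimately obtain z0 where z0: "z0 \<in> S" "\<And>y. y \<in> S \<Longrightarrow> f z0 \<le> f y"
    using continuous_attains_inf[of S f] by blast
  have fz0: "f z0 < - (\<eta> * exp (- barrier_rate r * R\<^sup>2))"
    using z0(2)[OF \<open>z \<in> S\<close>] \<open>f z < _\<close> by linarith
  have nonneg: "val (V z0) \<le> val (U z0)" using ge z0(1) by (simp add: S_def)
  have "dist z0 a \<noteq> R" using fz0 nonneg by (auto simp: f_def g)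
  then have inside: "dist z0 a < R" using z0(1) by (simp add: S_def dist_commute)
  have outside: "r \<le> dist z0 a"
  proof (rule ccontr)
    assume "\<not> r \<le> dist z0 a"
    then have "val (V z0) + \<eta> \<le> val (U z0)" using core z0(1) by (simp add: S_def dist_commute)
    moreover have "\<eta> * g z0 \<le> \<eta>"
      using barrier_rate_pos[OF ball(1)] \<open>\<eta> > 0\<close> by (simp add: g mult_left_le)
    moreover have "\<eta> * exp (- barrier_rate r * R\<^sup>2) > 0" using \<open>\<eta> > 0\<close> by simp
    ultimately show False using fz0 unfolding f_def by linarith
  qed
  have "\<forall>\<^sub>F y in at z0 within strip. y \<in> ball a R \<inter> strip"
    unfolding eventually_at_topological using inside
    by (intro exI[of _ "ball a R"]) (simp add: dist_commute)
  then have "\<forall>\<^sub>F y in at z0 within strip. f z0 \<le> f y"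
    by eventually_elim (intro z0(2), auto simp: S_def strip_def)
  moreover have "\<bar>fst z0 - fst a\<bar> \<le> 1" "\<bar>snd z0 - snd a\<bar> \<le> 1"
    using inside ball(3,4) dist_fst_le[of z0 a] dist_snd_le[of z0 a] by (auto simp: dist_real_def)
  moreover have "(dist z0 a)\<^sup>2 \<le> R\<^sup>2" using inside by (intro power_mono) auto
  ultimately show False
    using gaussian_barrier_no_minimum[OF U V \<open>\<eta> > 0\<close> ball(1) S(2,1)[OF z0(1)] nonneg ball(3) outside]
      ball(5)
    by (simp add: f_def g_def)
qed

end

text \<open>Abstracts the barrier estimate: positivity on a disc spreads to a larger one, which may reach over
  the top of the strip by a relative amount \<open>t\<close>.\<close>

definition spreads_positivity :: "real \<Rightarrow> real \<Rightarrow> (real \<times> real \<Rightarrow> real) \<Rightarrow> bool" where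
  "spreads_positivity t l f \<longleftrightarrow> (\<forall>a r R \<eta>. 0 < r \<longrightarrow> r < R \<longrightarrow> snd a < 0 \<longrightarrow>
     cball a R \<subseteq> {..<l} \<times> {-1<..} \<longrightarrow> R\<^sup>2 \<le> (1 + t\<^sup>2) * (snd a)\<^sup>2 \<longrightarrow> 0 < \<eta> \<longrightarrow>
     (\<forall>z\<in>cball a r. snd z \<le> 0 \<longrightarrow> \<eta> \<le> f z) \<longrightarrow> (\<forall>z\<in>ball a R. snd z \<le> 0 \<longrightarrow> 0 < f z))"

lemma continuous_on_gt_within:
  fixes f :: "real \<times> real \<Rightarrow> real"
  assumes "continuous_on S f" "a \<in> S" "k < f a"
  shows "\<exists>e>0. \<forall>z\<in>S. dist z a < e \<longrightarrow> k < f z"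
proof -
  have "\<forall>\<^sub>F z in at a within S. k < f z"
    using assms by (intro order_tendstoD(1)) (auto simp: continuous_on_def)
  then show ?thesis using assms(3) unfolding eventually_at by metis
qed

lemma spreads_positivity_from_point:
  assumes spread: "spreads_positivity t l f" and cont: "continuous_on strip f"
    and a: "f a > 0" "a \<in> {..<l} \<times> {-1<..<0}"
    and R: "0 < R" "cball a R \<subseteq> {..<l} \<times> {-1<..}" "R\<^sup>2 \<le> (1 + t\<^sup>2) * (snd a)\<^sup>2"
    and z: "z \<in> ball a R" "snd z \<le> 0"
  shows "f z > 0"
proof -
  have "a \<in> strip" using a(2) by (auto simp: strip_def)
  then obtain e where e: "e > 0" "\<And>z. z \<in> strip \<Longrightarrow> dist z a < e \<Longrightarrow> f a / 2 < f z"
    using continuous_on_gt_within[OF cont, of a "f a / 2"] a(1) by auto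
  define r where "r = min e R / 2"
  have r: "0 < r" "r < R" "r < e" using e(1) R(1) by (auto simp: r_def)
  have core: "f a / 2 \<le> f y" if "y \<in> cball a r" "snd y \<le> 0" for y
  proof -
    have "y \<in> cball a R" using that(1) r(2) by simp
    then have "y \<in> strip" using R(2) that(2) by (auto simp: strip_def)
    moreover have "dist y a < e" using that(1) r(3) by (simp add: dist_commute)
    ultimately show ?thesis using e(2) by (intro less_imp_le)
  qed
  show ?thesis
    using spread[unfolded spreads_positivity_def, rule_format, OF r(1,2) _ R(2,3), of "f a / 2" z] a z core
    by auto
qed

lemma spreads_positivity_nearby:
  assumes spread: "spreads_positivity t l f" and cont: "continuous_on strip f"
    and x: "0 < e" "ball x e \<subseteq> {..<l} \<times> {-1<..<0}" and y: "y \<in> ball x (e / 3)" "f y > 0"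
  shows "f x > 0"
proof -
  have sub: "cball y (e / 2) \<subseteq> {..<l} \<times> {-1<..<0}"
  proof (rule order_trans[OF _ x(2)], rule subsetI)
    fix w assume "w \<in> cball y (e / 2)"
    then have "dist x y < e / 3" "dist y w \<le> e / 2" using y(1) by simp_all
    then have "dist x w < e" using dist_triangle[of x w y] x(1) by linarith
    then show "w \<in> ball x e" by simp
  qed
  have "(fst y, snd y + e / 2) \<in> cball y (e / 2)" using x(1) by (simp add: dist_prod_def dist_real_def)
  then have "e / 2 \<le> - snd y" using sub by force
  then have "(e / 2)\<^sup>2 \<le> (snd y)\<^sup>2" using x(1) by (simp add: abs_le_square_iff[symmetric])
  also have "\<dots> \<le> (1 + t\<^sup>2) * (snd y)\<^sup>2" by (simp add: mult_le_cancel_right1)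
  finally have R: "(e / 2)\<^sup>2 \<le> (1 + t\<^sup>2) * (snd y)\<^sup>2" .
  show ?thesis
  proof (rule spreads_positivity_from_point[OF spread cont y(2) _ _ _ R])
    show "y \<in> {..<l} \<times> {-1<..<0}"
      using sub x(1) centre_in_cball[of y "e / 2"] by (meson less_imp_le half_gt_zero subsetD)
    show "cball y (e / 2) \<subseteq> {..<l} \<times> {-1<..}" using sub by (rule order_trans) auto
    show "x \<in> ball y (e / 2)" using y(1) x(1) by (simp add: dist_commute)
    have "x \<in> ball x e" using x(1) by simp
    from subsetD[OF x(2) this] show "snd x \<le> 0" by (simp add: mem_Times_iff)
  qed (use x(1) in simp)
qed

lemma spreads_positivity_interior:
  assumes spread: "spreads_positivity t l f" and cont: "continuous_on strip f"
    and a: "f a > 0" "a \<in> {..<l} \<times> {-1<..<0}" and z: "z \<in> {..<l} \<times> {-1<..<0}"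
  shows "f z > 0"
proof (rule ccontr)
  assume "\<not> f z > 0"
  let ?D = "{..<l} \<times> {-1<..<0::real}"
  let ?P = "?D \<inter> f -` {0<..}" and ?N = "{z \<in> ?D. \<not> f z > 0}"
  have D: "open ?D" "connected ?D" "?D \<subseteq> strip"
    by (auto simp: open_Times strip_def intro!: convex_connected convex_Times)
  have "open ?P"
    using continuous_on_subset[OF cont D(3)] D(1) by (rule continuous_open_preimage) simp
  moreover have "open ?N"
  proof (rule openI)
    fix x assume x: "x \<in> ?N"
    then have "x \<in> ?D" by simp
    from openE[OF D(1) this] obtain e where e: "e > 0" "ball x e \<subseteq> ?D" .
    then have "ball x (e / 3) \<subseteq> ball x e" by (intro subset_ball) simp
    then have "ball x (e / 3) \<subseteq> ?N" using spreads_positivity_nearby[OF spread cont e] x e(2) by blast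
    then show "\<exists>e>0. ball x e \<subseteq> ?N" using e(1) by (intro exI[of _ "e / 3"]) simp
  qed
  moreover have "?P \<inter> ?N \<inter> ?D = {}" "?D \<subseteq> ?P \<union> ?N" by auto
  ultimately have "?P \<inter> ?D = {} \<or> ?N \<inter> ?D = {}" by (intro connectedD[OF D(2)])
  then show False using a z \<open>\<not> f z > 0\<close> by auto
qed

lemma positive_below_surface:
  assumes cont: "continuous_on strip f" and a: "f a > (0::real)" "a \<in> {..<l} \<times> {-1<..0}"
  shows "\<exists>b\<in>{..<l} \<times> {-1<..<0}. f b > 0"
proof -
  have a': "fst a < l" "-1 < snd a" "snd a \<le> 0" using a(2) by (auto simp: mem_Times_iff)
  then have "a \<in> strip" by (simp add: strip_def)
  then obtain e where e: "e > 0" "\<And>z. z \<in> strip \<Longrightarrow> dist z a < e \<Longrightarrow> 0 < f z"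
    using continuous_on_gt_within[OF cont _ a(1)] by blast
  define s where "s = min e (snd a + 1) / 2"
  have s: "0 < s" "s < e" using e(1) a'(2) by (auto simp: s_def)
  have "2 * s \<le> snd a + 1" by (simp add: s_def)
  then have "-1 < snd a - s" using a'(2) by linarith
  moreover from s have "dist (fst a, snd a - s) a < e" by (simp add: dist_prod_def dist_real_def)
  ultimately show ?thesis
    using a' s by (intro bexI[of _ "(fst a, snd a - s)"] e(2)) simp_all
qed

lemma spreads_positivity_surface:
  assumes "t > 0" and spread: "spreads_positivity t l f" and cont: "continuous_on strip f"
    and interior: "\<And>z. z \<in> {..<l} \<times> {-1<..<0} \<Longrightarrow> f z > 0" and "q < l"
  shows "f (q, 0) > 0"
proof -
  define u where "u = sqrt (1 + t\<^sup>2)"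
  have u: "u > 1" using \<open>t > 0\<close> by (simp add: u_def)
  define s where "s = min 1 (l - q) / (2 * (u + 1))"
  have s: "s > 0" using u \<open>q < l\<close> by (auto simp: s_def)
  have "s * (u + 1) = min 1 (l - q) / 2" using u by (simp add: s_def field_simps)
  moreover have "min 1 (l - q) > 0" using \<open>q < l\<close> by simp
  ultimately have room: "s + u * s < 1" "s + u * s < l - q" by (auto simp: algebra_simps)
  have us: "s < u * s" using u s by simp
  let ?b = "(q, - s)"
  show ?thesis
  proof (rule spreads_positivity_from_point[OF spread cont, of ?b "u * s"])
    have "s < 1" using room us s by linarith
    then show b: "?b \<in> {..<l} \<times> {-1<..<0}" using s \<open>q < l\<close> by auto
    then show "f ?b > 0" by (rule interior)
    show "cball ?b (u * s) \<subseteq> {..<l} \<times> {-1<..}"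
    proof
      fix y assume "y \<in> cball ?b (u * s)"
      then have "\<bar>fst y - q\<bar> \<le> u * s" "\<bar>snd y + s\<bar> \<le> u * s"
        using dist_fst_le[of y ?b] dist_snd_le[of y ?b] by (auto simp: dist_real_def dist_commute)
      then show "y \<in> {..<l} \<times> {-1<..}" using room s by (auto simp: mem_Times_iff)
    qed
    show "(u * s)\<^sup>2 \<le> (1 + t\<^sup>2) * (snd ?b)\<^sup>2" by (simp add: u_def power_mult_distrib)
    show "(q, 0) \<in> ball ?b (u * s)" using us s by (simp add: dist_prod_def dist_real_def)
  qed (use u s in auto)
qed

lemma positivity_propagates:
  assumes "t > 0" and spread: "spreads_positivity t l f" and cont: "continuous_on strip f"
    and a: "f a > 0" "a \<in> {..<l} \<times> {-1<..0}" and z: "z \<in> {..<l} \<times> {-1<..0}"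
  shows "f z > 0"
proof -
  obtain b where "b \<in> {..<l} \<times> {-1<..<0}" "f b > 0" using positive_below_surface[OF cont a] by blast
  then have interior: "f y > 0" if "y \<in> {..<l} \<times> {-1<..<0}" for y
    using spreads_positivity_interior[OF spread cont] that by blast
  show ?thesis
  proof (cases "snd z = 0")
    case False
    then show ?thesis using interior z by (auto simp: less_le)
  next
    case True
    then have "f (fst z, 0) > 0"
      using z by (intro spreads_positivity_surface[OF \<open>t > 0\<close> spread cont interior]) auto
    moreover have "(fst z, 0) = z" using True by (simp add: prod_eq_iff)
    ultimately show ?thesis by simp
  qed
qed

context height_problem
begin

lemma difference_spreads_positivity:
  assumes U: "solution U" and V: "solution V"
    and ge: "\<And>z. z \<in> {..<l} \<times> {-1<..0} \<Longrightarrow> val (V z) \<le> val (U z)"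
  shows "spreads_positivity \<tau> l (\<lambda>z. val (U z) - val (V z))"
  unfolding spreads_positivity_def
proof (intro allI ballI impI)
  fix a z :: "real \<times> real" and r R \<eta> :: real
  assume r: "0 < r" "r < R" and a: "snd a < 0" and sub: "cball a R \<subseteq> {..<l} \<times> {-1<..}"
    and top: "R\<^sup>2 \<le> (1 + \<tau>\<^sup>2) * (snd a)\<^sup>2" and "0 < \<eta>"
    and core: "\<forall>z\<in>cball a r. snd z \<le> 0 \<longrightarrow> \<eta> \<le> val (U z) - val (V z)"
    and z: "z \<in> ball a R" "snd z \<le> 0"
  have "(fst a, snd a - R) \<in> cball a R" using r by (simp add: dist_prod_def dist_real_def)
  then have "-1 < snd a - R" using sub by auto
  then have "\<eta> * (exp (- barrier_rate r * (dist z a)\<^sup>2) - exp (- barrier_rate r * R\<^sup>2)) \<le> val (U z) - val (V z)"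
    using sub core z by (intro barrier[OF U V \<open>0 < \<eta>\<close> r a _ top]) (fastforce intro: ge)+
  moreover have "(dist z a)\<^sup>2 < R\<^sup>2" using z r by (intro power_strict_mono) (auto simp: dist_commute)
  then have "exp (- barrier_rate r * R\<^sup>2) < exp (- barrier_rate r * (dist z a)\<^sup>2)"
    using barrier_rate_pos[OF r(1)] by simp
  ultimately show "0 < val (U z) - val (V z)"
    using \<open>0 < \<eta>\<close> by (smt (verit) mult_pos_pos)
qed

end

section \<open>Shooting for a Sturm--Liouville problem\<close>

lemma sums_integral_Icc:
  fixes f :: "nat \<Rightarrow> real \<Rightarrow> real"
  assumes cont: "\<And>n. continuous_on {a..b} (f n)"
    and bound: "\<And>n x. x \<in> {a..b} \<Longrightarrow> \<bar>f n x\<bar> \<le> C n" and "summable C"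
  shows "(\<lambda>n. integral {a..b} (f n)) sums integral {a..b} (\<lambda>x. \<Sum>n. f n x)"
proof -
  have u: "uniform_limit {a..b} (\<lambda>n x. \<Sum>i<n. f i x) (\<lambda>x. \<Sum>n. f n x) sequentially"
    by (rule Weierstrass_m_test[OF _ \<open>summable C\<close>]) (simp add: bound)
  have c: "continuous_on {a..b} (\<lambda>x. \<Sum>i<n. f i x)" for n
    by (intro continuous_intros cont)
  obtain I J where I: "\<And>n. ((\<lambda>x. \<Sum>i<n. f i x) has_integral I n) {a..b}"
    and J: "((\<lambda>x. \<Sum>n. f n x) has_integral J) {a..b}" and lim: "(I \<longlongrightarrow> J) sequentially"
    using uniform_limit_integral[OF u c] by auto
  have "I n = (\<Sum>i<n. integral {a..b} (f i))" for n
    using integral_unique[OF I[of n]] by (simp add: integral_sum integrable_continuous_real cont)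
  then have "I = (\<lambda>n. \<Sum>i<n. integral {a..b} (f i))" by auto
  with lim integral_unique[OF J] show ?thesis by (simp add: sums_def)
qed

lemma integral_le_power:
  fixes f :: "real \<Rightarrow> real"
  assumes cont: "continuous_on {a..p} f" and "a \<le> p"
    and bound: "\<And>t. t \<in> {a..p} \<Longrightarrow> \<bar>f t\<bar> \<le> K * (t - a) ^ n"
  shows "\<bar>integral {a..p} f\<bar> \<le> K * (p - a) ^ Suc n / Suc n"
proof -
  have "((\<lambda>t. K * (t - a) ^ Suc n / Suc n) has_real_derivative K * (t - a) ^ n) (at t)" for t
    by (rule derivative_eq_intros refl | simp)+
  from has_integral_derivative_Icc[OF \<open>a \<le> p\<close> subset_UNIV this]
  have "((\<lambda>t. K * (t - a) ^ n) has_integral K * (p - a) ^ Suc n / Suc n) {a..p}" by simp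
  then have "integral {a..p} (\<lambda>t. K * (t - a) ^ n) = K * (p - a) ^ Suc n / Suc n"
    by (rule integral_unique)
  moreover have "norm (integral {a..p} f) \<le> integral {a..p} (\<lambda>t. K * (t - a) ^ n)"
    using bound
    by (intro integral_norm_bound_integral integrable_continuous_real cont continuous_intros) auto
  ultimately show ?thesis by (simp only: real_norm_def)
qed

text \<open>The initial value problem \<open>\<phi>' = f \<psi>\<close>, \<open>\<psi>' = - m g \<phi>\<close>, \<open>\<phi>(a) = 0\<close>, \<open>\<psi>(a) = 1\<close> is solved by power
  series in \<open>m\<close>.\<close>

locale shooting =
  fixes f g :: "real \<Rightarrow> real" and a b :: real
  assumes f_cont: "continuous_on {a..b} f" and g_cont: "continuous_on {a..b} g" and a_less_b: "a < b"
begin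

definition weight :: "nat \<Rightarrow> real \<Rightarrow> real" where
  "weight n = (if even n then f else g)"

primrec iterated_integral :: "nat \<Rightarrow> real \<Rightarrow> real" where
  "iterated_integral 0 = (\<lambda>p. 1)"
| "iterated_integral (Suc n) = (\<lambda>p. integral {a..p} (\<lambda>t. weight n t * iterated_integral n t))"

definition series :: "nat \<Rightarrow> real \<Rightarrow> real \<Rightarrow> real" where
  "series j m p = (\<Sum>n. (- m) ^ n * iterated_integral (2 * n + j) p)"

definition \<psi> :: "real \<Rightarrow> real \<Rightarrow> real" where "\<psi> = series 0"

definition \<phi> :: "real \<Rightarrow> real \<Rightarrow> real" where "\<phi> = series 1"

lemma weight_cont: "continuous_on {a..b} (weight n)"
  using f_cont g_cont by (simp add: weight_def)

lemma iterated_integral_cont: "continuous_on {a..b} (iterated_integral n)"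
proof (induction n)
  case (Suc n)
  then show ?case
    by (simp add: indefinite_integral_continuous_1 integrable_continuous_real continuous_on_mult
      weight_cont)
qed simp

lemma iterated_integral_bound:
  obtains K where "K \<ge> 0" "\<And>n p. p \<in> {a..b} \<Longrightarrow> \<bar>iterated_integral n p\<bar> \<le> K ^ n / fact n"
proof -
  obtain A where A: "A > 0" "\<And>t. t \<in> {a..b} \<Longrightarrow> \<bar>f t\<bar> \<le> A"
    using continuous_on_Icc_bounded[OF f_cont] by blast
  obtain B where B: "B > 0" "\<And>t. t \<in> {a..b} \<Longrightarrow> \<bar>g t\<bar> \<le> B"
    using continuous_on_Icc_bounded[OF g_cont] by blast
  define W where "W = max A B"
  have W: "W > 0" "\<And>n t. t \<in> {a..b} \<Longrightarrow> \<bar>weight n t\<bar> \<le> W"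
    using A B by (auto simp: W_def weight_def le_max_iff_disj)
  have bound: "\<bar>iterated_integral n p\<bar> \<le> W ^ n / fact n * (p - a) ^ n" if "p \<in> {a..b}" for n p
    using that
  proof (induction n arbitrary: p)
    case (Suc n)
    then have sub: "{a..p} \<subseteq> {a..b}" by auto
    have "\<bar>integral {a..p} (\<lambda>t. weight n t * iterated_integral n t)\<bar>
        \<le> W * (W ^ n / fact n) * (p - a) ^ Suc n / Suc n"
    proof (rule integral_le_power)
      show "continuous_on {a..p} (\<lambda>t. weight n t * iterated_integral n t)"
        by (intro continuous_intros continuous_on_subset[OF weight_cont sub]
            continuous_on_subset[OF iterated_integral_cont sub])
      show "\<bar>weight n t * iterated_integral n t\<bar> \<le> W * (W ^ n / fact n) * (t - a) ^ n" if "t \<in> {a..p}" for t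
        unfolding abs_mult mult.assoc using Suc.IH[of t] W(1) W(2)[of t n] that sub
        by (intro mult_mono) auto
    qed (use Suc.prems in simp)
    also have "\<dots> = W ^ Suc n / fact (Suc n) * (p - a) ^ Suc n" by (simp add: field_simps)
    finally show ?case by simp
  qed simp
  show thesis
  proof
    show "W * (b - a) \<ge> 0" using A(1) a_less_b by (simp add: W_def)
    fix n p assume p: "p \<in> {a..b}"
    have "W ^ n / fact n * (p - a) ^ n \<le> W ^ n / fact n * (b - a) ^ n"
      using p A(1) by (intro mult_left_mono power_mono) (auto simp: W_def)
    also have "\<dots> = (W * (b - a)) ^ n / fact n" by (simp add: power_mult_distrib)
    finally show "\<bar>iterated_integral n p\<bar> \<le> (W * (b - a)) ^ n / fact n"
      using bound[OF p, of n] by linarith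
  qed
qed

lemma series_majorant:
  obtains C where "summable C"
    "\<And>n m p. \<bar>m\<bar> \<le> r \<Longrightarrow> p \<in> {a..b} \<Longrightarrow> \<bar>(- m) ^ n * iterated_integral (2 * n + j) p\<bar> \<le> C n"
proof -
  obtain K where K: "K \<ge> 0" "\<And>n p. p \<in> {a..b} \<Longrightarrow> \<bar>iterated_integral n p\<bar> \<le> K ^ n / fact n"
    using iterated_integral_bound by blast
  show thesis
  proof
    show "summable (\<lambda>n. K ^ j * ((r * K\<^sup>2) ^ n / fact n))"
      using summable_exp[of "r * K\<^sup>2"]
      by (intro summable_mult) (simp add: divide_inverse mult.commute)
    fix n :: nat and m p assume m: "\<bar>m\<bar> \<le> r" and p: "p \<in> {a..b}"
    have "\<bar>(- m) ^ n * iterated_integral (2 * n + j) p\<bar> \<le> r ^ n * (K ^ (2 * n + j) / fact (2 * n + j))"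
      unfolding abs_mult power_abs using m K(2)[OF p, of "2 * n + j"] by (intro mult_mono power_mono) auto
    also have "\<dots> \<le> r ^ n * (K ^ (2 * n + j) / fact n)"
    proof -
      have "(fact n :: real) \<le> fact (2 * n + j)" by (intro fact_mono) simp
      then show ?thesis using m K(1) by (intro mult_left_mono divide_left_mono) auto
    qed
    also have "\<dots> = K ^ j * ((r * K\<^sup>2) ^ n / fact n)"
      by (simp add: power_add power_mult power_mult_distrib)
    finally show "\<bar>(- m) ^ n * iterated_integral (2 * n + j) p\<bar> \<le> K ^ j * ((r * K\<^sup>2) ^ n / fact n)" .
  qed
qed

lemma series_summable:
  assumes "p \<in> {a..b}"
  shows "summable (\<lambda>n. (- m) ^ n * iterated_integral (2 * n + j) p)"
proof -
  obtain C where C: "summable C" "\<And>n m' p. \<bar>m'\<bar> \<le> \<bar>m\<bar> \<Longrightarrow> p \<in> {a..b} \<Longrightarrow>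
      \<bar>(- m') ^ n * iterated_integral (2 * n + j) p\<bar> \<le> C n"
    using series_majorant[of "\<bar>m\<bar>" j] by blast
  show ?thesis
    by (rule summable_comparison_test'[OF C(1), of 0]) (use C(2)[of m p] assms in simp)
qed

lemma continuous_on_series:
  "continuous_on ({-r..r} \<times> {a..b}) (\<lambda>z. series j (fst z) (snd z))"
proof -
  obtain C where C: "summable C"
    "\<And>n m p. \<bar>m\<bar> \<le> r \<Longrightarrow> p \<in> {a..b} \<Longrightarrow> \<bar>(- m) ^ n * iterated_integral (2 * n + j) p\<bar> \<le> C n"
    using series_majorant[of r j] by blast
  have "uniform_limit ({-r..r} \<times> {a..b}) (\<lambda>N z. \<Sum>n<N. (- fst z) ^ n * iterated_integral (2 * n + j) (snd z))
      (\<lambda>z. \<Sum>n. (- fst z) ^ n * iterated_integral (2 * n + j) (snd z)) sequentially"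
    using C by (intro Weierstrass_m_test[of _ _ C]) (auto simp: abs_le_iff)
  then show ?thesis
    unfolding series_def
    by (rule uniform_limit_theorem[rotated])
      (auto intro!: always_eventually continuous_intros continuous_on_compose2[OF iterated_integral_cont])
qed

lemma series_cont: "continuous_on {a..b} (series j m)"
proof -
  have "continuous_on {a..b} (\<lambda>p. series j (fst (m, p)) (snd (m, p)))"
    by (rule continuous_on_compose2[OF continuous_on_series[of "\<bar>m\<bar>"]]) (auto intro!: continuous_intros)
  then show ?thesis by simp
qed

lemma series_cont_parameter:
  assumes "p \<in> {a..b}"
  shows "continuous_on {0..r} (\<lambda>m. series j m p)"
proof -
  have "continuous_on {0..r} (\<lambda>m. series j (fst (m, p)) (snd (m, p)))"
    by (rule continuous_on_compose2[OF continuous_on_series[of r]])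
      (use assms in \<open>auto intro!: continuous_intros\<close>)
  then show ?thesis by simp
qed

lemma series_Suc:
  assumes p: "p \<in> {a..b}"
  shows "series (Suc j) m p = integral {a..p} (\<lambda>t. weight j t * series j m t)"
proof -
  have sub: "{a..p} \<subseteq> {a..b}" using p by auto
  obtain W where W: "W > 0" "\<And>t. t \<in> {a..b} \<Longrightarrow> \<bar>weight j t\<bar> \<le> W"
    using continuous_on_Icc_bounded[OF weight_cont] by blast
  obtain C where C: "summable C" "\<And>n m' p. \<bar>m'\<bar> \<le> \<bar>m\<bar> \<Longrightarrow> p \<in> {a..b} \<Longrightarrow>
      \<bar>(- m') ^ n * iterated_integral (2 * n + j) p\<bar> \<le> C n"
    using series_majorant[of "\<bar>m\<bar>" j] by blast
  have "(\<lambda>n. integral {a..p} (\<lambda>t. weight j t * ((- m) ^ n * iterated_integral (2 * n + j) t))) sums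
      integral {a..p} (\<lambda>t. \<Sum>n. weight j t * ((- m) ^ n * iterated_integral (2 * n + j) t))"
  proof (rule sums_integral_Icc[of _ _ _ "\<lambda>n. W * C n"])
    show "continuous_on {a..p} (\<lambda>t. weight j t * ((- m) ^ n * iterated_integral (2 * n + j) t))" for n
      by (intro continuous_intros continuous_on_subset[OF weight_cont sub]
          continuous_on_subset[OF iterated_integral_cont sub])
    show "\<bar>weight j t * ((- m) ^ n * iterated_integral (2 * n + j) t)\<bar> \<le> W * C n" if "t \<in> {a..p}" for n t
    proof -
      have "t \<in> {a..b}" using that sub by blast
      then show ?thesis
        unfolding abs_mult[of "weight j t"] using W C(2)[of m t n] by (intro mult_mono) auto
    qed
    show "summable (\<lambda>n. W * C n)" using C(1) by (rule summable_mult)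
  qed
  moreover have "integral {a..p} (\<lambda>t. weight j t * ((- m) ^ n * iterated_integral (2 * n + j) t))
      = (- m) ^ n * iterated_integral (2 * n + Suc j) p" for n
  proof -
    have "weight (2 * n + j) = weight j" by (simp add: weight_def)
    then show ?thesis
      by (simp add: mult.left_commute[of _ "(- m) ^ n"] flip: integral_mult_right)
  qed
  moreover have "integral {a..p} (\<lambda>t. \<Sum>n. weight j t * ((- m) ^ n * iterated_integral (2 * n + j) t))
      = integral {a..p} (\<lambda>t. weight j t * series j m t)"
    using sub series_summable by (intro integral_cong) (auto simp: series_def suminf_mult)
  ultimately show ?thesis by (simp add: series_def sums_iff)
qed

lemma \<psi>_eq_series_2:
  assumes "p \<in> {a..b}"
  shows "\<psi> m p = 1 - m * series 2 m p"
proof -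
  have "\<psi> m p = 1 + (\<Sum>n. (- m) ^ Suc n * iterated_integral (2 * Suc n) p)"
    using suminf_split_head[OF series_summable[OF assms, of m 0]] by (simp add: \<psi>_def series_def)
  also have "(\<lambda>n. (- m) ^ Suc n * iterated_integral (2 * Suc n) p)
      = (\<lambda>n. - m * ((- m) ^ n * iterated_integral (2 * n + 2) p))"
    by (simp add: fun_eq_iff del: iterated_integral.simps)
  also have "suminf \<dots> = - m * series 2 m p"
    unfolding series_def by (rule suminf_mult[OF series_summable[OF assms]])
  finally show ?thesis by simp
qed

lemma \<psi>_\<phi>_cont: "continuous_on {a..b} (\<psi> m)" "continuous_on {a..b} (\<phi> m)"
  by (simp_all add: \<psi>_def \<phi>_def series_cont)

lemma \<psi>_\<phi>_cont_parameter:
  assumes "p \<in> {a..b}"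
  shows "continuous_on {0..r} (\<lambda>m. \<psi> m p)" "continuous_on {0..r} (\<lambda>m. \<phi> m p)"
  unfolding \<psi>_def \<phi>_def by (rule series_cont_parameter[OF assms])+

lemma derivatives:
  assumes p: "p \<in> {a..b}"
  shows "(\<phi> m has_real_derivative f p * \<psi> m p) (at p within {a..b})"
    "(\<psi> m has_real_derivative - m * g p * \<phi> m p) (at p within {a..b})"
proof -
  have deriv: "(series (Suc j) m has_real_derivative weight j p * series j m p) (at p within {a..b})" for j
    by (rule has_real_derivative_transform[OF integral_has_real_derivative[OF _ p] p series_Suc])
      (intro continuous_intros weight_cont series_cont)
  from deriv[of 0] show "(\<phi> m has_real_derivative f p * \<psi> m p) (at p within {a..b})"
    by (simp add: weight_def \<phi>_def \<psi>_def)
  have "((\<lambda>p. 1 - m * series 2 m p) has_real_derivative - m * g p * \<phi> m p) (at p within {a..b})"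
    using deriv[of 1] by (auto intro!: derivative_eq_intros simp: weight_def \<phi>_def numeral_2_eq_2)
  then show "(\<psi> m has_real_derivative - m * g p * \<phi> m p) (at p within {a..b})"
    by (rule has_real_derivative_transform[OF _ p \<psi>_eq_series_2])
qed

lemma \<phi>_eq_integral: "p \<in> {a..b} \<Longrightarrow> \<phi> m p = integral {a..p} (\<lambda>t. f t * \<psi> m t)"
  using series_Suc[of p 0 m] by (simp add: weight_def \<phi>_def \<psi>_def)

text \<open>If \<open>\<psi> \<ge> 0\<close> then \<open>\<phi> \<ge> 0\<close>, so that \<open>\<psi>\<close> is nonincreasing and its sign is decided at \<open>b\<close>.\<close>

lemma \<psi>_pos_of_nonneg:
  assumes f: "\<And>p. p \<in> {a..b} \<Longrightarrow> f p > 0" and g: "\<And>p. p \<in> {a..b} \<Longrightarrow> g p \<ge> 0"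
    and "m \<ge> 0" "k \<ge> 0" and bdry: "m * k * \<phi> m b < \<psi> m b"
    and nonneg: "\<And>p. p \<in> {a..b} \<Longrightarrow> \<psi> m p \<ge> 0" and p: "p \<in> {a..b}"
  shows "\<psi> m p > 0"
proof -
  have \<phi>: "\<phi> m t \<ge> 0" if "t \<in> {a..b}" for t
    unfolding \<phi>_eq_integral[OF that] using that f nonneg
    by (intro integral_nonneg integrable_continuous_real continuous_intros
        continuous_on_subset[OF f_cont] continuous_on_subset[OF \<psi>_\<phi>_cont(1)]) (auto simp: less_imp_le)
  have "\<psi> m b \<le> \<psi> m p"
  proof (rule DERIV_nonpos_imp_decreasing_open[of p b "\<psi> m"])
    show "continuous_on {p..b} (\<psi> m)" using p by (intro continuous_on_subset[OF \<psi>_\<phi>_cont(1)]) auto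
    fix t assume "p < t" "t < b"
    then have t: "t \<in> {a..b}" "at t within {a..b} = at t" using p by (auto simp: at_within_Icc_at)
    then show "\<exists>y. (\<psi> m has_real_derivative y) (at t) \<and> y \<le> 0"
      using derivatives(2)[OF t(1), of m] g[OF t(1)] \<phi>[OF t(1)] \<open>m \<ge> 0\<close>
      by (intro exI[of _ "- m * g t * \<phi> m t"]) auto
  qed (use p in auto)
  moreover have "0 \<le> m * k * \<phi> m b" using \<open>m \<ge> 0\<close> \<open>k \<ge> 0\<close> \<phi>[of b] a_less_b by simp
  ultimately show ?thesis using bdry by linarith
qed

lemma \<psi>_at_0: "p \<in> {a..b} \<Longrightarrow> \<psi> 0 p = 1"
  by (simp add: \<psi>_eq_series_2)

text \<open>Continuation in the parameter: \<open>\<psi>\<close> starts from \<open>1\<close> at \<open>m = 0\<close> and cannot lose positivity before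
  the boundary expression vanishes.\<close>

lemma shooting_positive:
  assumes f: "\<And>p. p \<in> {a..b} \<Longrightarrow> f p > 0" and g: "\<And>p. p \<in> {a..b} \<Longrightarrow> g p \<ge> 0"
    and "k \<ge> 0" "\<mu> \<ge> 0"
    and regular: "\<And>m. 0 < m \<Longrightarrow> m \<le> \<mu> \<Longrightarrow> \<psi> m b \<noteq> m * k * \<phi> m b"
  shows "\<mu> * k * \<phi> \<mu> b < \<psi> \<mu> b" "\<And>p. p \<in> {a..b} \<Longrightarrow> \<psi> \<mu> p > 0"
proof -
  have bdry: "m * k * \<phi> m b < \<psi> m b" if m: "0 \<le> m" "m \<le> \<mu>" for m
  proof (rule ccontr)
    assume "\<not> ?thesis"
    moreover have "continuous_on {0..m} (\<lambda>m. \<psi> m b - m * k * \<phi> m b)"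
      by (intro continuous_intros \<psi>_\<phi>_cont_parameter) (use a_less_b in auto)
    ultimately obtain x where "0 \<le> x" "x \<le> m" "\<psi> x b = x * k * \<phi> x b"
      using IVT2'[of "\<lambda>m. \<psi> m b - m * k * \<phi> m b" m 0 0] \<psi>_at_0[of b] m a_less_b by auto
    then show False using regular[of x] m \<psi>_at_0[of b] a_less_b by (cases "x = 0") auto
  qed
  then show "\<mu> * k * \<phi> \<mu> b < \<psi> \<mu> b" using \<open>\<mu> \<ge> 0\<close> by simp
  let ?Z = "({0..\<mu>} \<times> {a..b}) \<inter> (\<lambda>z. \<psi> (fst z) (snd z)) -` {..0}"
  let ?P = "{m \<in> {0..\<mu>}. \<forall>p\<in>{a..b}. \<psi> m p \<ge> 0}"
  have "?P = (\<Inter>p\<in>{a..b}. {0..\<mu>} \<inter> (\<lambda>m. \<psi> m p) -` {0..})" using a_less_b by auto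
  then have "closed ?P"
    by (simp only:) (intro closed_INT ballI continuous_closed_preimage \<psi>_\<phi>_cont_parameter; simp)
  have "continuous_on ({0..\<mu>} \<times> {a..b}) (\<lambda>z. \<psi> (fst z) (snd z))"
    using continuous_on_subset[OF continuous_on_series[of \<mu> 0]] \<open>\<mu> \<ge> 0\<close>
    by (auto simp: subset_iff \<psi>_def)
  then have "closed ?Z" by (intro continuous_closed_preimage closed_Times) auto
  then have "compact (({0..\<mu>} \<times> {a..b}) \<inter> ?Z)" by (intro compact_Int_closed compact_Times) auto
  then have "compact ?Z" by (simp add: Int_absorb1)
  then have "closed (fst ` ?Z)" by (intro compact_imp_closed compact_continuous_image continuous_intros)
  have cover: "{0..\<mu>} \<subseteq> ?P \<union> fst ` ?Z" by (force simp: image_iff)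
  have disjoint: "?P \<inter> fst ` ?Z \<inter> {0..\<mu>} = {}"
    using \<psi>_pos_of_nonneg[OF f g _ \<open>k \<ge> 0\<close> bdry] by (fastforce simp: not_le[symmetric])
  have "0 \<in> ?P" using \<psi>_at_0 \<open>\<mu> \<ge> 0\<close> by simp
  moreover have "connected {0..\<mu>}" by simp
  ultimately have "fst ` ?Z \<inter> {0..\<mu>} = {}"
    using connected_closedD[of "{0..\<mu>}" ?P "fst ` ?Z"] disjoint cover \<open>closed ?P\<close> \<open>closed (fst ` ?Z)\<close>
    by blast
  then show "\<psi> \<mu> p > 0" if "p \<in> {a..b}" for p
    using that \<open>\<mu> \<ge> 0\<close> by (force simp: image_iff)
qed

end

section \<open>Supersolutions of the linearized problem\<close>

definition C2_profile :: "(real \<Rightarrow> real) \<Rightarrow> (real \<Rightarrow> real) \<Rightarrow> (real \<Rightarrow> real) \<Rightarrow> bool" where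
  "C2_profile \<phi> \<phi>' \<phi>'' \<longleftrightarrow> (\<forall>p\<in>{-1..0}. (\<phi> has_real_derivative \<phi>' p) (at p within {-1..0}) \<and>
     (\<phi>' has_real_derivative \<phi>'' p) (at p within {-1..0})) \<and> continuous_on {-1..0} \<phi>''"

lemma C2_profile_cont:
  assumes "C2_profile \<phi> \<phi>' \<phi>''"
  shows "continuous_on {-1..0} \<phi>" "continuous_on {-1..0} \<phi>'" "continuous_on {-1..0} \<phi>''"
  using assms by (auto simp: C2_profile_def intro: DERIV_continuous_on)

lemma C2_profile_add_cmult:
  assumes "C2_profile \<phi> \<phi>' \<phi>''" "C2_profile \<theta> \<theta>' \<theta>''"
  shows "C2_profile (\<lambda>p. \<phi> p + s * \<theta> p) (\<lambda>p. \<phi>' p + s * \<theta>' p) (\<lambda>p. \<phi>'' p + s * \<theta>'' p)"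
  using assms by (auto simp: C2_profile_def intro!: derivative_eq_intros continuous_intros)

lemma C2_profile_exp:
  "C2_profile (\<lambda>p. exp (s * (p + 1))) (\<lambda>p. s * exp (s * (p + 1))) (\<lambda>p. s\<^sup>2 * exp (s * (p + 1)))"
  by (auto simp: C2_profile_def power2_eq_square intro!: derivative_eq_intros continuous_intros)

context height_problem
begin

definition linearized :: "(real \<Rightarrow> real) \<Rightarrow> (real \<Rightarrow> real) \<Rightarrow> (real \<Rightarrow> real) \<Rightarrow> real \<Rightarrow> real" where
  "linearized \<phi> \<phi>' \<phi>'' p = \<phi>'' p - 3 * (Hpp p / Hp p) * \<phi>' p - \<mu> * \<rho>p p * Hp p ^ 3 * \<phi> p"

definition surface_gap :: "(real \<Rightarrow> real) \<Rightarrow> (real \<Rightarrow> real) \<Rightarrow> real" where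
  "surface_gap \<phi> \<phi>' = \<phi>' 0 / Hp 0 ^ 3 - \<mu> * \<rho>0 * \<phi> 0"

lemma linearized_add_cmult:
  "linearized (\<lambda>p. \<phi> p + s * \<theta> p) (\<lambda>p. \<phi>' p + s * \<theta>' p) (\<lambda>p. \<phi>'' p + s * \<theta>'' p) p
    = linearized \<phi> \<phi>' \<phi>'' p + s * linearized \<theta> \<theta>' \<theta>'' p"
  by (simp add: linearized_def add_divide_distrib algebra_simps)

lemma surface_gap_add_cmult:
  "surface_gap (\<lambda>p. \<phi> p + s * \<theta> p) (\<lambda>p. \<phi>' p + s * \<theta>' p) = surface_gap \<phi> \<phi>' + s * surface_gap \<theta> \<theta>'"
  by (simp add: surface_gap_def add_divide_distrib algebra_simps)

lemma linearized_coefficients_bounded: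
  obtains C where "C > 0" "\<And>p. p \<in> {-1..0} \<Longrightarrow> \<bar>3 * (Hpp p / Hp p)\<bar> \<le> C"
    "\<And>p. p \<in> {-1..0} \<Longrightarrow> 0 \<le> - (\<mu> * \<rho>p p * Hp p ^ 3) \<and> - (\<mu> * \<rho>p p * Hp p ^ 3) \<le> C"
proof -
  define C where "C p = \<bar>3 * (Hpp p / Hp p)\<bar> + \<bar>\<mu> * \<rho>p p * Hp p ^ 3\<bar>" for p
  have "continuous_on {-1..0} C"
    unfolding C_def using Hp_pos
    by (intro continuous_intros Hp_cont Hpp_cont \<rho>p_cont) (auto simp: less_le)
  then obtain B where B: "B > 0" "\<And>p. p \<in> {-1..0} \<Longrightarrow> \<bar>C p\<bar> \<le> B"
    using continuous_on_Icc_bounded by blast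
  have "0 \<le> \<mu> * (- \<rho>p p) * Hp p ^ 3" if "p \<in> {-1..0}" for p
    using \<rho>p_nonpos[OF that] \<mu>_pos Hp_pos[OF that] by (intro mult_nonneg_nonneg) auto
  then have "0 \<le> - (\<mu> * \<rho>p p * Hp p ^ 3)" if "p \<in> {-1..0}" for p using that by simp
  moreover have "\<bar>3 * (Hpp p / Hp p)\<bar> \<le> B" "- (\<mu> * \<rho>p p * Hp p ^ 3) \<le> B" if "p \<in> {-1..0}" for p
    using B(2)[OF that] unfolding C_def by linarith+
  ultimately show thesis using that[of B] B(1) by blast
qed

lemma linearized_exp_pos:
  assumes s: "1 + \<bar>3 * (Hpp p / Hp p)\<bar> \<le> \<bar>s\<bar>" "0 \<le> - (\<mu> * \<rho>p p * Hp p ^ 3)"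
  shows "exp (s * (p + 1)) * \<bar>s\<bar>
    \<le> linearized (\<lambda>p. exp (s * (p + 1))) (\<lambda>p. s * exp (s * (p + 1))) (\<lambda>p. s\<^sup>2 * exp (s * (p + 1))) p"
proof -
  define g h where "g = 3 * (Hpp p / Hp p)" and "h = - (\<mu> * \<rho>p p * Hp p ^ 3)"
  have "\<bar>s\<bar> * 1 \<le> \<bar>s\<bar> * (\<bar>s\<bar> - \<bar>g\<bar>)" using s(1) by (intro mult_left_mono) (auto simp: g_def)
  moreover have "g * s \<le> \<bar>g\<bar> * \<bar>s\<bar>" by (metis abs_ge_self abs_mult)
  ultimately have "\<bar>s\<bar> \<le> s\<^sup>2 - g * s + h"
    using s(2) by (simp add: h_def algebra_simps power2_eq_square)
  then have "exp (s * (p + 1)) * \<bar>s\<bar> \<le> exp (s * (p + 1)) * (s\<^sup>2 - g * s + h)" by simp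
  also have "\<dots> = linearized (\<lambda>p. exp (s * (p + 1))) (\<lambda>p. s * exp (s * (p + 1))) (\<lambda>p. s\<^sup>2 * exp (s * (p + 1))) p"
    by (simp add: linearized_def g_def h_def algebra_simps)
  finally show ?thesis .
qed

sublocale shoot: shooting "\<lambda>p. Hp p ^ 3" "\<lambda>p. - \<rho>p p" "-1" 0
  by unfold_locales (auto intro!: continuous_intros Hp_cont \<rho>p_cont)

lemma has_eigensolution_shooting:
  assumes "\<rho> 0 = \<rho>0" and bdry: "shoot.\<psi> m 0 = m * \<rho>0 * shoot.\<phi> m 0"
  shows "has_eigensolution Hp \<rho> \<rho>p m"
  unfolding has_eigensolution_def
proof (intro exI conjI ballI)
  let ?\<phi> = "shoot.\<phi> m" and ?\<psi> = "shoot.\<psi> m"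
  have Hp0: "Hp x ^ 3 \<noteq> 0" if "x \<in> {-1..0}" for x using Hp_pos[OF that] by simp
  show d\<phi>: "(?\<phi> has_real_derivative Hp x ^ 3 * ?\<psi> x) (at x within {-1..0})" if "x \<in> {-1..0}" for x
    by (rule shoot.derivatives(1)[OF that])
  show "continuous_on {-1..0} (\<lambda>x. Hp x ^ 3 * ?\<psi> x)"
    by (intro continuous_intros Hp_cont shoot.\<psi>_\<phi>_cont)
  show "?\<phi> (-1) = 0" by (simp add: shoot.\<phi>_eq_integral)
  show "- (Hp 0 ^ 3 * ?\<psi> 0) / Hp 0 ^ 3 + m * \<rho> 0 * ?\<phi> 0 = 0"
    using bdry Hp0[of 0] assms(1) by simp
  show "((\<lambda>y. Hp y ^ 3 * ?\<psi> y / Hp y ^ 3) has_real_derivative m * \<rho>p x * ?\<phi> x) (at x)"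
    "m * \<rho>p x * ?\<phi> x - m * \<rho>p x * ?\<phi> x = 0" if x: "x \<in> {-1<..<0}" for x
  proof -
    have "(?\<psi> has_real_derivative m * \<rho>p x * ?\<phi> x) (at x)"
      using shoot.derivatives(2)[of x m] x by (simp add: at_within_Icc_at)
    then show "((\<lambda>y. Hp y ^ 3 * ?\<psi> y / Hp y ^ 3) has_real_derivative m * \<rho>p x * ?\<phi> x) (at x)"
      by (rule has_field_derivative_transform_within_open[OF _ open_greaterThanLessThan x])
        (use Hp0 in auto)
  qed simp
  show "\<exists>x\<in>{-1..0}. ?\<phi> x \<noteq> 0"
  proof (rule ccontr)
    assume "\<not> ?thesis"
    then have zero: "?\<phi> x = 0" if "x \<in> {-1..0}" for x using that by blast
    have "(?\<phi> has_real_derivative 0) (at (-1) within {-1..0})"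
      by (rule has_real_derivative_transform[OF DERIV_const]) (use zero in auto)
    from has_real_derivative_unique_Icc[OF d\<phi> this] have "Hp (-1) ^ 3 * ?\<psi> (-1) = 0" by simp
    moreover have "?\<psi> (-1) = 1"
      using shoot.\<psi>_eq_series_2[of "-1" m] shoot.series_Suc[of "-1" 1 m] by (simp add: numeral_2_eq_2)
    ultimately show False using Hp0[of "-1"] by simp
  qed
qed

lemma shooting_profile:
  defines "\<phi> \<equiv> shoot.\<phi> \<mu>" and "\<phi>' \<equiv> \<lambda>p. Hp p ^ 3 * shoot.\<psi> \<mu> p"
    and "\<phi>'' \<equiv> \<lambda>p. 3 * Hp p ^ 2 * Hpp p * shoot.\<psi> \<mu> p + Hp p ^ 3 * (\<mu> * \<rho>p p * shoot.\<phi> \<mu> p)"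
  shows "C2_profile \<phi> \<phi>' \<phi>''" "\<And>p. p \<in> {-1..0} \<Longrightarrow> linearized \<phi> \<phi>' \<phi>'' p = 0"
proof -
  show "C2_profile \<phi> \<phi>' \<phi>''"
    unfolding C2_profile_def
  proof (intro conjI ballI)
    show "continuous_on {-1..0} \<phi>''"
      unfolding \<phi>''_def by (intro continuous_intros shoot.\<psi>_\<phi>_cont Hp_cont Hpp_cont \<rho>p_cont)
    fix p :: real assume p: "p \<in> {-1..0}"
    show "(\<phi> has_real_derivative \<phi>' p) (at p within {-1..0})"
      using shoot.derivatives(1)[OF p] by (simp add: \<phi>_def \<phi>'_def)
    show "(\<phi>' has_real_derivative \<phi>'' p) (at p within {-1..0})"
      unfolding \<phi>'_def
      by (rule derivative_eq_intros Hp_deriv[OF p] shoot.derivatives(2)[OF p] refl)+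
        (simp add: \<phi>''_def algebra_simps)
  qed
  show "linearized \<phi> \<phi>' \<phi>'' p = 0" if "p \<in> {-1..0}" for p
    using Hp_pos[OF that]
    by (simp add: linearized_def \<phi>_def \<phi>'_def \<phi>''_def field_simps power2_eq_square power3_eq_cube)
qed

lemma positive_profile:
  assumes "\<rho> 0 = \<rho>0"
    and noeig: "\<And>m. 0 < m \<Longrightarrow> m \<le> \<mu> \<Longrightarrow> \<not> has_eigensolution Hp \<rho> \<rho>p m"
  obtains \<phi> \<phi>' \<phi>'' k where "C2_profile \<phi> \<phi>' \<phi>''"
    "\<And>p. p \<in> {-1..0} \<Longrightarrow> linearized \<phi> \<phi>' \<phi>'' p = 0" "surface_gap \<phi> \<phi>' > 0"
    "k > 0" "\<And>p. p \<in> {-1..0} \<Longrightarrow> k * (p + 1) \<le> \<phi> p"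
proof -
  define \<phi>' where "\<phi>' p = Hp p ^ 3 * shoot.\<psi> \<mu> p" for p
  have "shoot.\<psi> m 0 \<noteq> m * \<rho>0 * shoot.\<phi> m 0" if "0 < m" "m \<le> \<mu>" for m
    using has_eigensolution_shooting[where \<rho> = \<rho>, OF assms(1)] noeig that by blast
  moreover have "0 < Hp p ^ 3" "0 \<le> - \<rho>p p" if "p \<in> {-1..0}" for p
    using Hp_pos[OF that] \<rho>p_nonpos[OF that] by simp_all
  ultimately have pos: "\<mu> * \<rho>0 * shoot.\<phi> \<mu> 0 < shoot.\<psi> \<mu> 0" "\<And>p. p \<in> {-1..0} \<Longrightarrow> shoot.\<psi> \<mu> p > 0"
    using shoot.shooting_positive[of \<rho>0 \<mu>] \<rho>0_pos \<mu>_pos by (simp_all add: less_imp_le)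
  have cont: "continuous_on {-1..0} \<phi>'" unfolding \<phi>'_def by (intro continuous_intros Hp_cont shoot.\<psi>_\<phi>_cont)
  obtain x where x: "x \<in> {-1..0}" "\<And>y. y \<in> {-1..0} \<Longrightarrow> \<phi>' x \<le> \<phi>' y"
    using continuous_attains_inf[OF _ _ cont] by auto
  show thesis
  proof (rule that[OF shooting_profile])
    show "surface_gap (shoot.\<phi> \<mu>) (\<lambda>p. Hp p ^ 3 * shoot.\<psi> \<mu> p) > 0"
      using pos(1) Hp_pos[of 0] by (simp add: surface_gap_def)
    show "\<phi>' x > 0" using x(1) Hp_pos pos(2) by (simp add: \<phi>'_def)
    show "\<phi>' x * (p + 1) \<le> shoot.\<phi> \<mu> p" if p: "p \<in> {-1..0}" for p
    proof -
      have "integral {-1..p} (\<lambda>t. \<phi>' x) \<le> integral {-1..p} \<phi>'"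
        using p x(2) by (intro integral_le integrable_continuous_real continuous_on_subset[OF cont]) auto
      also have "\<dots> = shoot.\<phi> \<mu> p" using shoot.\<phi>_eq_integral[OF p, of \<mu>] by (simp add: \<phi>'_def[abs_def])
      finally show ?thesis using p by (simp add: mult.commute)
    qed
  qed
qed

lemma one_minus_exp_lower:
  fixes x s :: real
  assumes "0 \<le> x" "x \<le> s"
  shows "1 - x * exp s \<le> 2 - exp x"
proof -
  have "(1 - x) * exp x \<le> exp (- x) * exp x"
    using exp_ge_add_one_self[of "- x"] by (intro mult_right_mono) auto
  then have "exp x - 1 \<le> x * exp x" by (simp add: exp_minus algebra_simps)
  also have "\<dots> \<le> x * exp s" using assms by (intro mult_left_mono) auto
  finally show ?thesis by simp
qed

lemma linearized_negative_profile:
  obtains \<theta> \<theta>' \<theta>'' k where "C2_profile \<theta> \<theta>' \<theta>''" "\<And>p. p \<in> {-1..0} \<Longrightarrow> linearized \<theta> \<theta>' \<theta>'' p < 0"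
    "k > 0" "\<And>p. p \<in> {-1..0} \<Longrightarrow> 1 - k * (p + 1) \<le> \<theta> p"
proof -
  obtain C where C: "C > 0" "\<And>p. p \<in> {-1..0} \<Longrightarrow> \<bar>3 * (Hpp p / Hp p)\<bar> \<le> C"
    "\<And>p. p \<in> {-1..0} \<Longrightarrow> 0 \<le> - (\<mu> * \<rho>p p * Hp p ^ 3) \<and> - (\<mu> * \<rho>p p * Hp p ^ 3) \<le> C"
    using linearized_coefficients_bounded by blast
  define s where "s = 2 * C + 1"
  have s: "s > 0" "\<bar>s\<bar> = s" using C(1) by (simp_all add: s_def)
  define e where "e p = exp (s * (p + 1))" for p
  show thesis
  proof
    have "C2_profile (\<lambda>p. 2) (\<lambda>p. 0) (\<lambda>p. 0)" by (simp add: C2_profile_def)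
    then show "C2_profile (\<lambda>p. 2 + - 1 * e p) (\<lambda>p. 0 + - 1 * (s * e p)) (\<lambda>p. 0 + - 1 * (s\<^sup>2 * e p))"
      unfolding e_def by (intro C2_profile_add_cmult C2_profile_exp)
    show "s * exp s > 0" using s by simp
    fix p :: real assume p: "p \<in> {-1..0}"
    have "s * (p + 1) \<le> s" using p s by (auto simp: mult_le_cancel_left1)
    then show "1 - s * exp s * (p + 1) \<le> 2 + - 1 * e p"
      using one_minus_exp_lower[of "s * (p + 1)" s] p s by (simp add: e_def mult_ac)
    have "1 \<le> e p" using p s by (simp add: e_def)
    then have "s \<le> e p * s" using s(1) by simp
    also have "\<dots> \<le> linearized e (\<lambda>p. s * e p) (\<lambda>p. s\<^sup>2 * e p) p"
      using linearized_exp_pos[of p s] C(1) C(2,3)[OF p] unfolding e_def[abs_def] s(2) by (simp add: s_def)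
    finally have "s \<le> linearized e (\<lambda>p. s * e p) (\<lambda>p. s\<^sup>2 * e p) p" .
    moreover have "linearized (\<lambda>p. 2) (\<lambda>p. 0) (\<lambda>p. 0) p = 2 * - (\<mu> * \<rho>p p * Hp p ^ 3)"
      by (simp add: linearized_def)
    then have "linearized (\<lambda>p. 2) (\<lambda>p. 0) (\<lambda>p. 0) p < s" using C(3)[OF p] by (simp add: s_def)
    ultimately show "linearized (\<lambda>p. 2 + - 1 * e p) (\<lambda>p. 0 + - 1 * (s * e p)) (\<lambda>p. 0 + - 1 * (s\<^sup>2 * e p)) p < 0"
      unfolding linearized_add_cmult by simp
  qed
qed

lemma strict_supersolution_profile:
  assumes "\<rho> 0 = \<rho>0"
    and "\<And>m. 0 < m \<Longrightarrow> m \<le> \<mu> \<Longrightarrow> \<not> has_eigensolution Hp \<rho> \<rho>p m"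
  obtains \<phi> \<phi>' \<phi>'' \<epsilon> where "C2_profile \<phi> \<phi>' \<phi>''" "surface_gap \<phi> \<phi>' > 0"
    "\<epsilon> > 0" "\<And>p. p \<in> {-1..0} \<Longrightarrow> \<epsilon> \<le> \<phi> p" "\<And>p. p \<in> {-1..0} \<Longrightarrow> linearized \<phi> \<phi>' \<phi>'' p < 0"
proof -
  obtain \<phi> \<phi>' \<phi>'' k where \<phi>: "C2_profile \<phi> \<phi>' \<phi>''"
    "\<And>p. p \<in> {-1..0} \<Longrightarrow> linearized \<phi> \<phi>' \<phi>'' p = 0" "surface_gap \<phi> \<phi>' > 0"
    and k: "k > 0" "\<And>p. p \<in> {-1..0} \<Longrightarrow> k * (p + 1) \<le> \<phi> p"
    using positive_profile[OF assms] by blast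
  obtain \<theta> \<theta>' \<theta>'' l where \<theta>: "C2_profile \<theta> \<theta>' \<theta>''" "\<And>p. p \<in> {-1..0} \<Longrightarrow> linearized \<theta> \<theta>' \<theta>'' p < 0"
    and l: "l > 0" "\<And>p. p \<in> {-1..0} \<Longrightarrow> 1 - l * (p + 1) \<le> \<theta> p"
    using linearized_negative_profile by blast
  define \<epsilon> where "\<epsilon> = min (k / l) (surface_gap \<phi> \<phi>' / (1 + \<bar>surface_gap \<theta> \<theta>'\<bar>))"
  have "\<epsilon> > 0" using k(1) l(1) \<phi>(3) by (simp add: \<epsilon>_def add_pos_nonneg)
  moreover have "\<epsilon> \<le> k / l" "\<epsilon> \<le> surface_gap \<phi> \<phi>' / (1 + \<bar>surface_gap \<theta> \<theta>'\<bar>)" by (simp_all add: \<epsilon>_def)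
  ultimately have \<epsilon>: "\<epsilon> > 0" "\<epsilon> * l \<le> k" "\<epsilon> * (1 + \<bar>surface_gap \<theta> \<theta>'\<bar>) \<le> surface_gap \<phi> \<phi>'"
    using l(1) by (simp_all only: pos_le_divide_eq add_pos_nonneg zero_less_one abs_ge_zero)
  show thesis
  proof
    show "C2_profile (\<lambda>p. \<phi> p + \<epsilon> * \<theta> p) (\<lambda>p. \<phi>' p + \<epsilon> * \<theta>' p) (\<lambda>p. \<phi>'' p + \<epsilon> * \<theta>'' p)"
      by (rule C2_profile_add_cmult[OF \<phi>(1) \<theta>(1)])
    have "- (\<epsilon> * \<bar>surface_gap \<theta> \<theta>'\<bar>) \<le> \<epsilon> * surface_gap \<theta> \<theta>'"
      using mult_left_mono[of "- \<bar>surface_gap \<theta> \<theta>'\<bar>" "surface_gap \<theta> \<theta>'" \<epsilon>] \<epsilon>(1) by simp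
    then show "surface_gap (\<lambda>p. \<phi> p + \<epsilon> * \<theta> p) (\<lambda>p. \<phi>' p + \<epsilon> * \<theta>' p) > 0"
      unfolding surface_gap_add_cmult using \<epsilon>(1,3) by (simp add: distrib_left)
    show "\<epsilon> > 0" by (rule \<epsilon>(1))
    fix p :: real assume p: "p \<in> {-1..0}"
    have "\<epsilon> * (1 - l * (p + 1)) \<le> \<epsilon> * \<theta> p" using \<epsilon>(1) l(2)[OF p] by simp
    moreover have "\<epsilon> * l * (p + 1) \<le> k * (p + 1)" using \<epsilon>(2) p by (intro mult_right_mono) auto
    ultimately show "\<epsilon> \<le> \<phi> p + \<epsilon> * \<theta> p" using k(2)[OF p] by (simp add: algebra_simps)
    show "linearized (\<lambda>p. \<phi> p + \<epsilon> * \<theta> p) (\<lambda>p. \<phi>' p + \<epsilon> * \<theta>' p) (\<lambda>p. \<phi>'' p + \<epsilon> * \<theta>'' p) p < 0"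
      unfolding linearized_add_cmult using \<phi>(2)[OF p] \<theta>(2)[OF p] \<epsilon>(1) by (simp add: mult_pos_neg)
  qed
qed

text \<open>Besides being a strict supersolution, \<open>\<Phi>\<close> is so concave in the bottom layer of width \<open>\<delta>\<close> that
  it remains a supersolution there for any coefficients controlled by \<open>N\<close>.\<close>

definition supersolution :: "real \<Rightarrow> real \<Rightarrow> real \<Rightarrow> real \<Rightarrow>
    (real \<Rightarrow> real) \<Rightarrow> (real \<Rightarrow> real) \<Rightarrow> (real \<Rightarrow> real) \<Rightarrow> bool" where
  "supersolution N b B \<delta> \<Phi> \<Phi>' \<Phi>'' \<longleftrightarrow>
     0 < \<delta> \<and> \<delta> < 1 \<and> C2_profile \<Phi> \<Phi>' \<Phi>'' \<and> \<Phi> 0 \<le> B \<and> surface_gap \<Phi> \<Phi>' > 0 \<and>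
     (\<forall>p\<in>{-1..0}. b \<le> \<Phi> p \<and> linearized \<Phi> \<Phi>' \<Phi>'' p < 0 \<and>
        (p \<le> -1 + \<delta> \<longrightarrow> \<Phi>'' p + N * (1 + \<bar>\<Phi>' p\<bar> + \<Phi> p) < 0))"

lemma concave_layer_inequality:
  fixes u u1 u2 b e s N R :: real
  assumes R: "\<bar>u\<bar> \<le> R" "\<bar>u1\<bar> \<le> R" "\<bar>u2\<bar> \<le> R" and b: "b > 0" "b \<le> u" and e: "0 < e" "e \<le> 1"
    and s: "s > 0" "\<bar>N\<bar> + 1 \<le> s * e" "R + \<bar>N\<bar> * (1 + 2 * R) + 1 \<le> b * s"
  shows "u2 - b * s\<^sup>2 * e + N * (1 + \<bar>u1 + b * s * e\<bar> + (u - b * e)) < 0"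
proof -
  have "0 \<le> b * e" "b * e \<le> b" "0 \<le> b * s * e" "b * s * e \<le> b * s" using b(1) e s(1) by auto
  then have "\<bar>u1 + b * s * e\<bar> \<le> R + b * s" "u - b * e \<le> R" "0 \<le> u - b * e" using R(1,2) b by linarith+
  then have "N * (1 + \<bar>u1 + b * s * e\<bar> + (u - b * e)) \<le> \<bar>N\<bar> * (1 + (R + b * s) + R)"
    by (intro mult_mono) auto
  moreover have "b * s * (\<bar>N\<bar> + 1) \<le> b * s * (s * e)" using b(1) s(1,2) by (intro mult_left_mono) auto
  moreover have "b * s * (s * e) = b * s\<^sup>2 * e" by (simp add: power2_eq_square)
  moreover have "\<bar>N\<bar> * (1 + (R + b * s) + R) = \<bar>N\<bar> * (1 + 2 * R) + b * s * (\<bar>N\<bar> + 1) - b * s"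
    by (simp add: algebra_simps)
  moreover have "u2 \<le> R" using R(3) by simp
  ultimately show ?thesis using s(3) by linarith
qed

lemma surface_gap_minus_exp:
  assumes "surface_gap \<phi> \<phi>' > 0" "b > 0" "s \<ge> 0"
  shows "surface_gap (\<lambda>p. \<phi> p + - b * exp (- s * (p + 1))) (\<lambda>p. \<phi>' p + - b * (- s * exp (- s * (p + 1)))) > 0"
proof -
  have "0 \<le> s * exp (- s) / Hp 0 ^ 3" "0 \<le> \<mu> * \<rho>0 * exp (- s)"
    using assms(3) Hp_pos[of 0] \<mu>_pos \<rho>0_pos by simp_all
  then have "surface_gap (\<lambda>p. exp (- s * (p + 1))) (\<lambda>p. - s * exp (- s * (p + 1))) \<le> 0"
    by (simp add: surface_gap_def)
  then have "0 \<le> - b * surface_gap (\<lambda>p. exp (- s * (p + 1))) (\<lambda>p. - s * exp (- s * (p + 1)))"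
    using assms(2) by (intro mult_nonpos_nonpos) auto
  then show ?thesis unfolding surface_gap_add_cmult using assms(1) by linarith
qed

lemma linearized_minus_exp:
  assumes "linearized \<phi> \<phi>' \<phi>'' p < 0" "b > 0"
    and "1 + \<bar>3 * (Hpp p / Hp p)\<bar> \<le> s" "0 \<le> - (\<mu> * \<rho>p p * Hp p ^ 3)"
  shows "linearized (\<lambda>p. \<phi> p + - b * exp (- s * (p + 1))) (\<lambda>p. \<phi>' p + - b * (- s * exp (- s * (p + 1))))
    (\<lambda>p. \<phi>'' p + - b * ((- s)\<^sup>2 * exp (- s * (p + 1)))) p < 0"
proof -
  have "0 \<le> exp (- s * (p + 1)) * \<bar>- s\<bar>" by simp
  also have "\<dots> \<le> linearized (\<lambda>p. exp (- s * (p + 1))) (\<lambda>p. - s * exp (- s * (p + 1)))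
      (\<lambda>p. (- s)\<^sup>2 * exp (- s * (p + 1))) p"
    by (rule linearized_exp_pos) (use assms(3,4) in auto)
  finally have "- b * linearized (\<lambda>p. exp (- s * (p + 1))) (\<lambda>p. - s * exp (- s * (p + 1)))
      (\<lambda>p. (- s)\<^sup>2 * exp (- s * (p + 1))) p \<le> 0"
    using assms(2) by (intro mult_nonpos_nonneg) auto
  then show ?thesis unfolding linearized_add_cmult using assms(1) by linarith
qed

lemma supersolution_of_profile:
  assumes \<phi>: "C2_profile \<phi> \<phi>' \<phi>''" "surface_gap \<phi> \<phi>' > 0"
    "\<And>p. p \<in> {-1..0} \<Longrightarrow> linearized \<phi> \<phi>' \<phi>'' p < 0"
    and b: "b > 0" "\<And>p. p \<in> {-1..0} \<Longrightarrow> 2 * b \<le> \<phi> p"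
  shows "\<exists>\<delta> \<Phi> \<Phi>' \<Phi>''. supersolution N b (\<phi> 0) \<delta> \<Phi> \<Phi>' \<Phi>''"
proof -
  obtain C where C: "C > 0" "\<And>p. p \<in> {-1..0} \<Longrightarrow> \<bar>3 * (Hpp p / Hp p)\<bar> \<le> C"
    "\<And>p. p \<in> {-1..0} \<Longrightarrow> 0 \<le> - (\<mu> * \<rho>p p * Hp p ^ 3) \<and> - (\<mu> * \<rho>p p * Hp p ^ 3) \<le> C"
    using linearized_coefficients_bounded by blast
  have "continuous_on {-1..0} (\<lambda>p. \<bar>\<phi> p\<bar> + \<bar>\<phi>' p\<bar> + \<bar>\<phi>'' p\<bar>)"
    by (intro continuous_intros C2_profile_cont[OF \<phi>(1)])
  then obtain R where "\<And>p. p \<in> {-1..0} \<Longrightarrow> \<bar>\<bar>\<phi> p\<bar> + \<bar>\<phi>' p\<bar> + \<bar>\<phi>'' p\<bar>\<bar> \<le> R"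
    using continuous_on_Icc_bounded by blast
  then have R: "\<bar>\<phi> p\<bar> \<le> R \<and> \<bar>\<phi>' p\<bar> \<le> R \<and> \<bar>\<phi>'' p\<bar> \<le> R" if "p \<in> {-1..0}" for p using that by fastforce
  define Z where "Z = R + \<bar>N\<bar> * (1 + 2 * R) + 1"
  define s where "s = Max {C + 1, 2, exp 1 * (\<bar>N\<bar> + 1), Z / b}"
  have s: "s \<ge> C + 1" "s \<ge> 2" "s \<ge> exp 1 * (\<bar>N\<bar> + 1)" "s \<ge> Z / b" by (auto simp: s_def)
  define e where "e p = exp (- s * (p + 1))" for p
  have e: "e p > 0" "p \<in> {-1..0} \<Longrightarrow> e p \<le> 1" for p using s(2) by (auto simp: e_def mult_nonneg_nonneg)
  define \<Phi> \<Phi>' \<Phi>'' where "\<Phi> p = \<phi> p + - b * e p" and "\<Phi>' p = \<phi>' p + - b * (- s * e p)"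
    and "\<Phi>'' p = \<phi>'' p + - b * ((- s)\<^sup>2 * e p)" for p
  have layer: "\<Phi>'' p + N * (1 + \<bar>\<Phi>' p\<bar> + \<Phi> p) < 0" if p: "p \<in> {-1..0}" "p \<le> -1 + 1 / s" for p
  proof -
    have "s * (p + 1) \<le> 1" using p(2) s(2) by (simp add: field_simps)
    then have "exp (- 1) \<le> e p" by (simp add: e_def)
    moreover have "\<bar>N\<bar> + 1 \<le> s * exp (- 1)" using s(3) by (simp add: exp_minus field_simps)
    ultimately have "\<bar>N\<bar> + 1 \<le> s * e p" using s(2) mult_left_mono[of "exp (-1)" "e p" s] by linarith
    moreover have "R + \<bar>N\<bar> * (1 + 2 * R) + 1 \<le> b * s"
      using s(4) b(1) by (simp add: pos_divide_le_eq mult.commute Z_def)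
    moreover have "b \<le> \<phi> p" using b(1) b(2)[OF p(1)] by simp
    ultimately show ?thesis
      using concave_layer_inequality[of "\<phi> p" R "\<phi>' p" "\<phi>'' p" b "e p" s N] R[OF p(1)] b(1) e(1)
        e(2)[OF p(1)] s(2)
      by (simp add: \<Phi>_def \<Phi>'_def \<Phi>''_def mult.assoc)
  qed
  have "supersolution N b (\<phi> 0) (1 / s) \<Phi> \<Phi>' \<Phi>''"
    unfolding supersolution_def
  proof (intro conjI ballI impI layer)
    show "C2_profile \<Phi> \<Phi>' \<Phi>''"
      unfolding \<Phi>_def \<Phi>'_def \<Phi>''_def e_def by (rule C2_profile_add_cmult[OF \<phi>(1) C2_profile_exp])
    show "surface_gap \<Phi> \<Phi>' > 0"
      unfolding \<Phi>_def \<Phi>'_def e_def using s(2) by (intro surface_gap_minus_exp \<phi>(2) b(1)) simp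
    fix p :: real assume p: "p \<in> {-1..0}"
    show "b \<le> \<Phi> p"
      using b(2)[OF p] mult_left_mono[OF e(2)[OF p], of b] b(1) unfolding \<Phi>_def by linarith
    show "linearized \<Phi> \<Phi>' \<Phi>'' p < 0"
      unfolding \<Phi>_def \<Phi>'_def \<Phi>''_def e_def
      using \<phi>(3)[OF p] b(1) C(2,3)[OF p] s(1,2) by (intro linearized_minus_exp) auto
  qed (use s(2) b(1) e(1)[of 0] in \<open>auto simp: \<Phi>_def\<close>)
  then show ?thesis by blast
qed

lemma supersolution_exists:
  assumes "\<rho> 0 = \<rho>0"
    and "\<And>m. 0 < m \<Longrightarrow> m \<le> \<mu> \<Longrightarrow> \<not> has_eigensolution Hp \<rho> \<rho>p m"
  obtains b B where "b > 0" "\<And>N. \<exists>\<delta> \<Phi> \<Phi>' \<Phi>''. supersolution N b B \<delta> \<Phi> \<Phi>' \<Phi>''"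
proof -
  obtain \<phi> \<phi>' \<phi>'' \<epsilon> where \<phi>: "C2_profile \<phi> \<phi>' \<phi>''" "surface_gap \<phi> \<phi>' > 0"
    "\<epsilon> > 0" "\<And>p. p \<in> {-1..0} \<Longrightarrow> \<epsilon> \<le> \<phi> p" "\<And>p. p \<in> {-1..0} \<Longrightarrow> linearized \<phi> \<phi>' \<phi>'' p < 0"
    using strict_supersolution_profile[OF assms] by blast
  show thesis
    by (rule that[of "\<epsilon> / 2" "\<phi> 0"]) (use \<phi> supersolution_of_profile[OF \<phi>(1,2,5), of "\<epsilon> / 2"] in auto)
qed

end

section \<open>Comparison of two solutions\<close>

definition vanishes_left :: "(real \<times> real \<Rightarrow> 'a::real_normed_vector) \<Rightarrow> bool" where
  "vanishes_left f \<longleftrightarrow> (\<forall>e>0. \<exists>Q. \<forall>z\<in>strip. fst z \<le> Q \<longrightarrow> norm (f z) < e)"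

lemma vanishes_leftD:
  assumes "vanishes_left f" "e > 0"
  obtains Q where "\<And>z. z \<in> strip \<Longrightarrow> fst z \<le> Q \<Longrightarrow> norm (f z) < e"
  using assms unfolding vanishes_left_def by blast

lemma vanishes_left_val: "vanishes_left J \<Longrightarrow> vanishes_left (\<lambda>z. val (J z))"
  unfolding vanishes_left_def real_norm_def by (meson jet_entry_le_norm(1) le_less_trans)

lemma negative_near_compact:
  fixes f :: "'a::heine_borel \<Rightarrow> real"
  assumes "compact K" "closed S" "K \<subseteq> S" "continuous_on S f" "\<And>x. x \<in> K \<Longrightarrow> f x < 0"
  shows "\<exists>d>0. \<forall>x\<in>K. \<forall>z\<in>S. dist x z < d \<longrightarrow> f z < 0"
proof -
  have "closed (S \<inter> f -` {0..})"
    using assms(4,2) by (rule continuous_closed_preimage) simp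
  moreover have "K \<inter> (S \<inter> f -` {0..}) = {}" using assms(5) by (auto dest: leD)
  ultimately obtain d where d: "d > 0" "\<forall>x\<in>K. \<forall>z\<in>S \<inter> f -` {0..}. d \<le> dist x z"
    using separate_compact_closed[OF assms(1), of "S \<inter> f -` {0..}"] by metis
  have "f z < 0" if "x \<in> K" "z \<in> S" "dist x z < d" for x z
  proof (rule ccontr)
    assume "\<not> f z < 0"
    then have "z \<in> S \<inter> f -` {0..}" using that(2) by simp
    from d(2)[rule_format, OF that(1) this] show False using that(3) by simp
  qed
  then show ?thesis using d(1) by blast
qed

lemma dist_Pair_le:
  fixes a c :: "'a::real_normed_vector" and b d :: "'b::real_normed_vector"
  shows "dist (a, b) (c, d) \<le> dist a c + dist b d"
  by (simp add: dist_norm norm_Pair_le)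

text \<open>The point \<open>z\<close> minimizes \<open>(u - v) / P\<close>.\<close>

lemma negative_ratio_minimum:
  assumes cont: "continuous_on strip u" "continuous_on strip v" "continuous_on strip P"
    and u: "\<And>z. z \<in> strip \<Longrightarrow> u z \<ge> (0::real)" and v: "vanishes_left v"
    and lateral: "\<And>p. p \<in> {-1..0} \<Longrightarrow> u (l, p) = v (l, p)" and bed: "\<And>q. u (q, -1) = v (q, -1)"
    and P: "b > 0" "\<And>z. z \<in> strip \<Longrightarrow> fst z \<le> l \<Longrightarrow> b \<le> P z"
    and neg: "y \<in> strip" "fst y \<le> l" "u y < v y"
  obtains m z where "m > 0" "z \<in> {..<l} \<times> {-1<..0}" "u z - v z = - m * P z"
    "\<And>x. x \<in> strip \<Longrightarrow> fst x \<le> l \<Longrightarrow> - m * P x \<le> u x - v x"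
proof -
  define f where "f z = (u z - v z) / P z" for z
  have P_pos: "P z > 0" if "z \<in> strip" "fst z \<le> l" for z using P(1) P(2)[OF that] by linarith
  define r where "r = - f y"
  have r: "r > 0" using neg P_pos[of y] by (simp add: r_def f_def field_simps)
  obtain Q where Q: "\<And>z. z \<in> strip \<Longrightarrow> fst z \<le> Q \<Longrightarrow> norm (v z) < r * b"
    using vanishes_leftD[OF v, of "r * b"] r P(1) by auto
  have far: "- r < f z" if z: "z \<in> strip" "fst z \<le> Q" "fst z \<le> l" for z
  proof -
    have "- (r * b) < u z - v z" using u[OF z(1)] Q[OF z(1,2)] by auto
    moreover have "r * b \<le> r * P z" using r P(2)[OF z(1,3)] by simp
    ultimately show ?thesis using P_pos[OF z(1,3)] by (simp add: f_def pos_less_divide_eq)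
  qed
  let ?S = "{Q..l} \<times> {-1..0::real}"
  have S: "?S \<subseteq> strip" "\<And>z. z \<in> ?S \<Longrightarrow> fst z \<le> l" by auto
  have y: "y \<in> ?S" using neg far[of y] by (cases y) (force simp: r_def)
  have "continuous_on ?S f"
    unfolding f_def using P_pos S
    by (intro continuous_intros continuous_on_subset[OF _ S(1)] cont) (metis less_irrefl subsetD)
  then obtain z where z: "z \<in> ?S" "\<And>x. x \<in> ?S \<Longrightarrow> f z \<le> f x"
    using continuous_attains_inf[of ?S f] y compact_Times[OF compact_Icc compact_Icc] by blast
  have fz: "f z \<le> - r" using z(2)[OF y] by (simp add: r_def)
  have zl: "z \<in> strip" "fst z \<le> l" using z(1) S by auto
  have eq: "u z - v z = - (- f z) * P z" using P_pos[OF zl] by (simp add: f_def)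
  then have "u z - v z < 0" using fz r P_pos[OF zl] by (simp add: mult_neg_pos)
  show thesis
  proof (rule that[OF _ _ eq])
    show "- f z > 0" using fz r by simp
    have "z \<noteq> (l, snd z)" "z \<noteq> (fst z, -1)"
      using lateral[of "snd z"] bed[of "fst z"] \<open>u z - v z < 0\<close> z(1)
      by (metis diff_self less_irrefl mem_Times_iff)+
    then show "z \<in> {..<l} \<times> {-1<..0}" using z(1) by (cases z) auto
    fix x assume x: "x \<in> strip" "fst x \<le> l"
    have "f z \<le> f x"
    proof (cases "fst x \<le> Q")
      case True then show ?thesis using far[OF x(1) True x(2)] fz by simp
    next
      case False then show ?thesis using x by (intro z(2)) (auto simp: strip_def mem_Times_iff)
    qed
    then show "- (- f z) * P x \<le> u x - v x" using P_pos[OF x] by (simp add: f_def pos_le_divide_eq)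
  qed
qed

definition profile_jet :: "(real \<Rightarrow> real) \<Rightarrow> (real \<Rightarrow> real) \<Rightarrow> (real \<Rightarrow> real) \<Rightarrow> real \<Rightarrow> jet" where
  "profile_jet \<phi> \<phi>' \<phi>'' p = (\<phi> p, (0, \<phi>' p), (0, 0, \<phi>'' p))"

lemma holonomic_profile_jet:
  assumes "C2_profile \<phi> \<phi>' \<phi>''"
  shows "holonomic (\<lambda>z. profile_jet \<phi> \<phi>' \<phi>'' (snd z))"
proof -
  have "holonomic (product_jet (\<lambda>q. 1) (\<lambda>q. 0) (\<lambda>q. 0) \<phi> \<phi>' \<phi>'')"
    using assms by (intro holonomic_product_jet) (auto simp: C2_profile_def)
  then show ?thesis by (simp add: product_jet_def[abs_def] profile_jet_def)
qed

lemma continuous_on_profile_jet: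
  "C2_profile \<phi> \<phi>' \<phi>'' \<Longrightarrow> continuous_on {-1..0} (profile_jet \<phi> \<phi>' \<phi>'')"
  unfolding profile_jet_def[abs_def] by (intro continuous_intros C2_profile_cont)

lemma norm_profile_jet_bounded:
  assumes "C2_profile \<phi> \<phi>' \<phi>''"
  obtains R where "R > 0" "\<And>p. p \<in> {-1..0} \<Longrightarrow> norm (profile_jet \<phi> \<phi>' \<phi>'' p) \<le> R"
  using compact_imp_bounded[OF compact_continuous_image[OF continuous_on_profile_jet[OF assms] compact_Icc]]
  by (auto simp: bounded_pos)

context height_problem
begin

text \<open>The far field: near the trivial flow, a jet close to a strict supersolution of the linearized
  problem yields strict subsolutions by subtraction.\<close>

definition far_field :: "real \<Rightarrow> (real \<Rightarrow> real) \<Rightarrow> (real \<Rightarrow> real) \<Rightarrow> (real \<Rightarrow> real) \<Rightarrow> bool" where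
  "far_field \<epsilon> \<Phi> \<Phi>' \<Phi>'' \<longleftrightarrow> (\<forall>p\<in>{-1..0}. \<forall>j k m. norm j \<le> \<epsilon> \<longrightarrow> norm (k - profile_jet \<Phi> \<Phi>' \<Phi>'' p) \<le> \<epsilon> \<longrightarrow>
     0 < m \<longrightarrow> m * val k \<le> \<epsilon> \<longrightarrow> interior_op p j < interior_op p (j - m *\<^sub>R k) \<and>
       (p = 0 \<longrightarrow> top_op j < top_op (j - m *\<^sub>R k)))"

lemma interior_op'_near_profile:
  assumes \<phi>: "C2_profile \<phi> \<phi>' \<phi>''" "\<And>p. p \<in> {-1..0} \<Longrightarrow> linearized \<phi> \<phi>' \<phi>'' p < 0"
  obtains d where "d > 0" "\<And>p j k. p \<in> {-1..0} \<Longrightarrow> norm j + norm (k - profile_jet \<phi> \<phi>' \<phi>'' p) < d \<Longrightarrow>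
    interior_op' p j k < 0"
proof -
  let ?S = "{-1..0 :: real} \<times> (UNIV :: jet set) \<times> (UNIV :: jet set)"
  let ?K = "(\<lambda>p. (p, 0 :: jet, profile_jet \<phi> \<phi>' \<phi>'' p)) ` {-1..0}"
  have cont: "continuous_on ?S (\<lambda>z. interior_op' (fst z) (fst (snd z)) (snd (snd z)))"
    by (intro continuous_on_interior_op' continuous_intros) auto
  have "compact ?K"
    by (intro compact_continuous_image continuous_intros continuous_on_profile_jet[OF \<phi>(1)] compact_Icc)
  have "interior_op' p 0 (profile_jet \<phi> \<phi>' \<phi>'' p) = linearized \<phi> \<phi>' \<phi>'' p" if "p \<in> {-1..0}" for p
    using Hp_pos[OF that]
    by (simp add: interior_op'_def profile_jet_def linearized_def field_simps power2_eq_square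
      power3_eq_cube)
  then have neg: "interior_op' (fst z) (fst (snd z)) (snd (snd z)) < 0" if "z \<in> ?K" for z
    using \<phi>(2) that by auto
  have "closed ?S" by (intro closed_Times closed_real_atLeastAtMost closed_UNIV)
  moreover have "?K \<subseteq> ?S" by auto
  ultimately have "\<exists>d>0. \<forall>x\<in>?K. \<forall>z\<in>?S. dist x z < d \<longrightarrow>
      interior_op' (fst z) (fst (snd z)) (snd (snd z)) < 0"
    by (rule negative_near_compact[OF \<open>compact ?K\<close> _ _ cont neg])
  then obtain d where d: "d > 0" "\<forall>x\<in>?K. \<forall>z\<in>?S. dist x z < d \<longrightarrow>
      interior_op' (fst z) (fst (snd z)) (snd (snd z)) < 0" by auto
  show thesis
  proof (rule that[OF d(1)])
    fix p and j k :: jet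
    assume p: "p \<in> {-1..0}" and small: "norm j + norm (k - profile_jet \<phi> \<phi>' \<phi>'' p) < d"
    let ?x = "(p, 0, profile_jet \<phi> \<phi>' \<phi>'' p)" and ?z = "(p, j, k)"
    have "dist ?x ?z \<le> dist p p + (dist 0 j + dist (profile_jet \<phi> \<phi>' \<phi>'' p) k)"
      by (intro order_trans[OF dist_Pair_le] add_left_mono dist_Pair_le)
    also have "\<dots> = norm j + norm (k - profile_jet \<phi> \<phi>' \<phi>'' p)" by (simp add: dist_norm norm_minus_commute)
    finally have "dist ?x ?z < d" using small by simp
    moreover have "?x \<in> ?K" "?z \<in> ?S" using p by auto
    ultimately show "interior_op' p j k < 0" using d(2) by fastforce
  qed
qed

lemma top_op'_near_profile:
  assumes "surface_gap \<phi> \<phi>' > 0"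
  obtains d where "d > 0" "\<And>j k. norm j + norm (k - profile_jet \<phi> \<phi>' \<phi>'' 0) < d \<Longrightarrow>
    Hp 0 + dp j > 0 \<and> top_op' j k < 0"
proof -
  let ?S = "{j. Hp 0 / 2 \<le> Hp 0 + dp j} \<times> (UNIV :: jet set)"
  have Hp0: "Hp 0 > 0" using Hp_pos by simp
  have "closed {j. Hp 0 / 2 \<le> Hp 0 + dp j}" by (intro closed_Collect_le continuous_intros)
  then have "closed ?S" by (intro closed_Times) auto
  have cont: "continuous_on ?S (\<lambda>z. top_op' (fst z) (snd z))"
    using Hp0 by (intro continuous_on_top_op' continuous_intros) auto
  have "top_op' 0 (profile_jet \<phi> \<phi>' \<phi>'' 0) = - surface_gap \<phi> \<phi>'"
    by (simp add: top_op'_def profile_jet_def surface_gap_def)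
  then have neg: "top_op' (fst z) (snd z) < 0" if "z \<in> {(0, profile_jet \<phi> \<phi>' \<phi>'' 0)}" for z
    using assms that by simp
  have "{(0, profile_jet \<phi> \<phi>' \<phi>'' 0)} \<subseteq> ?S" using Hp0 by simp
  then obtain d where d: "d > 0" "\<forall>z\<in>?S. dist (0, profile_jet \<phi> \<phi>' \<phi>'' 0) z < d \<longrightarrow>
      top_op' (fst z) (snd z) < 0"
    using negative_near_compact[OF compact_sing \<open>closed ?S\<close> _ cont neg] by auto
  show thesis
  proof (rule that[of "min d (Hp 0 / 2)"])
    fix j k :: jet assume small: "norm j + norm (k - profile_jet \<phi> \<phi>' \<phi>'' 0) < min d (Hp 0 / 2)"
    have "\<bar>dp j\<bar> \<le> Hp 0 / 2"
      using jet_entry_le_norm(3)[of j] small norm_ge_zero[of "k - profile_jet \<phi> \<phi>' \<phi>'' 0"] by linarith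
    then have "(j, k) \<in> ?S" "Hp 0 + dp j > 0" using Hp0 by (auto simp: abs_le_iff)
    moreover have "dist (0, profile_jet \<phi> \<phi>' \<phi>'' 0) (j, k) \<le> norm j + norm (k - profile_jet \<phi> \<phi>' \<phi>'' 0)"
      using dist_Pair_le[of 0 "profile_jet \<phi> \<phi>' \<phi>'' 0" j k] by (simp add: dist_norm norm_minus_commute)
    ultimately show "Hp 0 + dp j > 0 \<and> top_op' j k < 0" using d(2)[rule_format, of "(j, k)"] small by simp
  qed (use d(1) Hp0 in simp)
qed

lemma far_fieldI:
  assumes interior: "\<And>p j k. p \<in> {-1..0} \<Longrightarrow> norm j + norm (k - profile_jet \<Phi> \<Phi>' \<Phi>'' p) < d \<Longrightarrow>
      interior_op' p j k < 0"
    and top: "\<And>j k. norm j + norm (k - profile_jet \<Phi> \<Phi>' \<Phi>'' 0) < d \<Longrightarrow>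
      Hp 0 + dp j > 0 \<and> top_op' j k < 0"
    and bounds: "\<And>p. p \<in> {-1..0} \<Longrightarrow> b \<le> \<Phi> p" "\<And>p. p \<in> {-1..0} \<Longrightarrow> norm (profile_jet \<Phi> \<Phi>' \<Phi>'' p) \<le> R" "b > 0"
    and \<epsilon>: "0 < \<epsilon>" "\<epsilon> \<le> 1" "\<epsilon> \<le> b / 2" "\<epsilon> * (3 + 2 * (R + 1) / b) \<le> d"
  shows "far_field \<epsilon> \<Phi> \<Phi>' \<Phi>''"
  unfolding far_field_def
proof (intro ballI allI impI)
  fix p m and j k :: jet
  assume p: "p \<in> {-1..0}" and j: "norm j \<le> \<epsilon>" and k: "norm (k - profile_jet \<Phi> \<Phi>' \<Phi>'' p) \<le> \<epsilon>"
    and m: "0 < m" "m * val k \<le> \<epsilon>"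
  let ?k = "- m *\<^sub>R k"
  have "\<bar>val k - \<Phi> p\<bar> \<le> \<epsilon>"
    using jet_entry_le_norm(1)[of "k - profile_jet \<Phi> \<Phi>' \<Phi>'' p"] k by (simp add: profile_jet_def)
  then have "b / 2 \<le> val k" using bounds(1)[OF p] \<epsilon>(3) by linarith
  then have "m * (b / 2) \<le> \<epsilon>" using m mult_left_mono[of "b / 2" "val k" m] by linarith
  then have "m \<le> 2 * \<epsilon> / b" using bounds(3) by (simp add: field_simps)
  moreover have "norm k \<le> R + 1"
    using norm_triangle_ineq[of "k - profile_jet \<Phi> \<Phi>' \<Phi>'' p" "profile_jet \<Phi> \<Phi>' \<Phi>'' p"] k bounds(2)[OF p]
      \<epsilon>(2) by simp
  ultimately have "m * norm k \<le> 2 * \<epsilon> / b * (R + 1)"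
    using m(1) \<epsilon>(1) bounds(3) by (intro mult_mono) auto
  then have k_small: "norm ?k \<le> 2 * \<epsilon> / b * (R + 1)" using m(1) by simp
  have near: "norm (j + t *\<^sub>R ?k) + norm (k - profile_jet \<Phi> \<Phi>' \<Phi>'' p) < d" if "0 \<le> t" "t \<le> 1" for t
  proof -
    have "norm (t *\<^sub>R ?k) \<le> norm ?k" using that m(1) by (simp add: mult_left_le_one_le)
    then have "norm (j + t *\<^sub>R ?k) + norm (k - profile_jet \<Phi> \<Phi>' \<Phi>'' p) \<le> \<epsilon> + 2 * \<epsilon> / b * (R + 1) + \<epsilon>"
      using norm_triangle_ineq[of j "t *\<^sub>R ?k"] j k k_small by linarith
    also have "\<dots> < \<epsilon> * (3 + 2 * (R + 1) / b)" using \<epsilon>(1) by (simp add: algebra_simps)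
    finally show ?thesis using \<epsilon>(4) by linarith
  qed
  show "interior_op p j < interior_op p (j - m *\<^sub>R k) \<and> (p = 0 \<longrightarrow> top_op j < top_op (j - m *\<^sub>R k))"
  proof (intro conjI impI)
    obtain t where "0 < t" "t < 1" "interior_op p (j + ?k) = interior_op p j + interior_op' p (j + t *\<^sub>R ?k) ?k"
      by (rule interior_op_mvt)
    then show "interior_op p j < interior_op p (j - m *\<^sub>R k)"
      unfolding interior_op'_scaleR using interior[OF p near[of t]] m(1)
      by (simp add: mult_neg_neg mult_pos_neg)
    assume "p = 0"
    then have top: "Hp 0 + dp (j + t *\<^sub>R ?k) > 0" "top_op' (j + t *\<^sub>R ?k) k < 0" if "t \<in> {0..1}" for t
      using top[of "j + t *\<^sub>R ?k" k] near[of t] that by auto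
    obtain t where "0 < t" "t < 1" "top_op (j + ?k) = top_op j + top_op' (j + t *\<^sub>R ?k) ?k"
      using top_op_mvt[of j ?k] top(1) by blast
    then show "top_op j < top_op (j - m *\<^sub>R k)"
      unfolding top_op'_scaleR using top(2)[of t] m(1) by (simp add: mult_neg_neg mult_pos_neg)
  qed
qed

lemma far_field_exists:
  assumes super: "supersolution N b B \<delta> \<Phi> \<Phi>' \<Phi>''" and b: "b > 0"
  obtains \<epsilon> where "\<epsilon> > 0" "far_field \<epsilon> \<Phi> \<Phi>' \<Phi>''"
proof -
  have \<Phi>: "C2_profile \<Phi> \<Phi>' \<Phi>''" "\<And>p. p \<in> {-1..0} \<Longrightarrow> linearized \<Phi> \<Phi>' \<Phi>'' p < 0"
    "surface_gap \<Phi> \<Phi>' > 0" "\<And>p. p \<in> {-1..0} \<Longrightarrow> b \<le> \<Phi> p"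
    using super by (auto simp: supersolution_def)
  obtain d1 where d1: "d1 > 0" "\<And>p j k. p \<in> {-1..0} \<Longrightarrow>
      norm j + norm (k - profile_jet \<Phi> \<Phi>' \<Phi>'' p) < d1 \<Longrightarrow> interior_op' p j k < 0"
    using interior_op'_near_profile[OF \<Phi>(1,2)] by blast
  obtain d2 where d2: "d2 > 0" "\<And>j k. norm j + norm (k - profile_jet \<Phi> \<Phi>' \<Phi>'' 0) < d2 \<Longrightarrow>
      Hp 0 + dp j > 0 \<and> top_op' j k < 0"
    using top_op'_near_profile[OF \<Phi>(3)] by blast
  obtain R where R: "R > 0" "\<And>p. p \<in> {-1..0} \<Longrightarrow> norm (profile_jet \<Phi> \<Phi>' \<Phi>'' p) \<le> R"
    using norm_profile_jet_bounded[OF \<Phi>(1)] by blast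
  define C where "C = 3 + 2 * (R + 1) / b"
  have C: "C > 0" using R(1) b by (simp add: C_def add_pos_nonneg)
  define \<epsilon> where "\<epsilon> = min (min 1 (b / 2)) (min d1 d2 / C)"
  have "\<epsilon> \<le> min 1 (b / 2)" "\<epsilon> \<le> min d1 d2 / C" unfolding \<epsilon>_def by (rule min.cobounded1 min.cobounded2)+
  moreover have "0 < \<epsilon>" using b d1(1) d2(1) C by (simp add: \<epsilon>_def)
  ultimately have \<epsilon>: "0 < \<epsilon>" "\<epsilon> \<le> 1" "\<epsilon> \<le> b / 2" "\<epsilon> * C \<le> min d1 d2"
    by (simp_all only: pos_le_divide_eq[OF C] min.bounded_iff)
  show thesis
    using \<epsilon> d1(2) d2(2) \<Phi>(4) R(2) b unfolding C_def
    by (intro that[OF \<epsilon>(1)] far_fieldI[of \<Phi> \<Phi>' \<Phi>'' "min d1 d2" b R]) auto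
qed

lemma far_field_no_touching:
  assumes far: "far_field \<epsilon> \<Phi> \<Phi>' \<Phi>''" and U: "solution U" and V: "solution V" and P: "holonomic P"
    and near: "norm (V z) \<le> \<epsilon>" "norm (P z - profile_jet \<Phi> \<Phi>' \<Phi>'' (snd z)) \<le> \<epsilon>"
    and m: "0 < m" "m * val (P z) \<le> \<epsilon>" and z: "z \<in> strip" "-1 < snd z"
  shows "\<not> touches_below (\<lambda>z. V z + (- m) *\<^sub>R P z) U z"
proof
  assume touch: "touches_below (\<lambda>z. V z + (- m) *\<^sub>R P z) U z"
  note W = holonomic_add[OF solutionD(1)[OF V] holonomic_scaleR[OF P, of "- m"]]
  have p: "snd z \<in> {-1..0}" using z(1) by (simp add: strip_def)
  have strict: "interior_op (snd z) (V z) < interior_op (snd z) (V z + (- m) *\<^sub>R P z)"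
    "snd z = 0 \<Longrightarrow> top_op (V z) < top_op (V z + (- m) *\<^sub>R P z)"
    using far[unfolded far_field_def, rule_format, OF p near m] by simp_all
  show False
  proof (cases "snd z = 0")
    case False
    then have "snd z < 0" using p by simp
    then show False
      using touching_interior[OF U W touch z(2)] solutionD(8)[OF V z(2)] strict(1) by linarith
  next
    case True
    then have "z = (fst z, 0)" by (simp add: prod_eq_iff)
    then show False
      using touching_top[OF U W, of "fst z"] touch solutionD(3)[OF V, of "fst z"] strict(2)[OF True] by simp
  qed
qed

lemma touches_below_of_minimum:
  assumes eq: "val (U z) - val (V z) = - m * val (P z)" and "fst z < l"
    and min: "\<And>x. x \<in> strip \<Longrightarrow> fst x \<le> l \<Longrightarrow> - m * val (P x) \<le> val (U x) - val (V x)"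
  shows "touches_below (\<lambda>z. V z + (- m) *\<^sub>R P z) U z"
  unfolding touches_below_def
proof
  show "val (V z + (- m) *\<^sub>R P z) = val (U z)" using eq by simp
  have "\<forall>\<^sub>F x in at z within strip. x \<in> strip \<and> fst x < l"
    unfolding eventually_at_topological using \<open>fst z < l\<close>
    by (intro exI[of _ "{x. fst x < l}"]) (auto intro!: open_Collect_less continuous_intros)
  then show "\<forall>\<^sub>F x in at z within strip. val (V x + (- m) *\<^sub>R P x) \<le> val (U x)"
  proof eventually_elim
    case (elim x)
    then show ?case using min[of x] by simp
  qed
qed

lemma comparison:
  assumes U: "solution U" "\<And>z. z \<in> strip \<Longrightarrow> val (U z) \<ge> 0"
    and V: "solution V" "vanishes_left V"
    and lateral: "\<And>p. p \<in> {-1..0} \<Longrightarrow> val (U (l, p)) = val (V (l, p))"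
    and P: "holonomic P" "b > 0" "\<And>z. z \<in> strip \<Longrightarrow> fst z \<le> l \<Longrightarrow> b \<le> val (P z)"
    and far: "far_field \<epsilon> \<Phi> \<Phi>' \<Phi>''"
    and cover: "\<And>z. z \<in> {..<l} \<times> {-1<..0} \<Longrightarrow> val (U z) < val (V z) \<Longrightarrow>
       norm (V z) \<le> \<epsilon> \<and> norm (P z - profile_jet \<Phi> \<Phi>' \<Phi>'' (snd z)) \<le> \<epsilon> \<or> strict_increment (snd z) (- P z)"
    and y: "y \<in> strip" "fst y \<le> l"
  shows "val (V y) \<le> val (U y)"
proof (rule ccontr)
  assume "\<not> ?thesis"
  then have neg: "val (U y) < val (V y)" by simp
  obtain m z where m: "m > 0" and z: "z \<in> {..<l} \<times> {-1<..0}"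
    and eq: "val (U z) - val (V z) = - m * val (P z)"
    and min: "\<And>x. x \<in> strip \<Longrightarrow> fst x \<le> l \<Longrightarrow> - m * val (P x) \<le> val (U x) - val (V x)"
    using negative_ratio_minimum[of "\<lambda>z. val (U z)" "\<lambda>z. val (V z)" "\<lambda>z. val (P z)" l b y]
      holonomic_continuous_on_val[OF solutionD(1)[OF U(1)]]
      holonomic_continuous_on_val[OF solutionD(1)[OF V(1)]]
      holonomic_continuous_on_val[OF P(1)] U(2) vanishes_left_val[OF V(2)] lateral P(2,3) y neg
      solutionD(4)[OF U(1)] solutionD(4)[OF V(1)]
    by metis
  have zs: "z \<in> strip" "fst z < l" "-1 < snd z" using z by (auto simp: strip_def mem_Times_iff)
  have "val (P z) > 0" using P(2) P(3)[OF zs(1)] zs(2) by simp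
  then have lt: "val (U z) < val (V z)" using eq m by (smt (verit) mult_pos_pos mult_minus_left)
  note touch = touches_below_of_minimum[where U = U and V = V and P = P, OF eq zs(2) min]
  have "\<not> strict_increment (snd z) (- P z)"
    using no_strict_touching[OF U(1) V(1) holonomic_scaleR[OF P(1)] touch zs(1,3)]
      strict_increment_scaleR[of "snd z" "- P z" m] m by auto
  then have near: "norm (V z) \<le> \<epsilon>" "norm (P z - profile_jet \<Phi> \<Phi>' \<Phi>'' (snd z)) \<le> \<epsilon>"
    using cover[OF z lt] by auto
  have "m * val (P z) \<le> \<epsilon>"
    using eq U(2)[OF zs(1)] jet_entry_le_norm(1)[of "V z"] near(1) by simp
  then show False using far_field_no_touching[OF far U(1) V(1) P(1) near m _ zs(1,3)] touch by blast
qed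

end

section \<open>A comparison function for reflections\<close>

text \<open>The surface corrector repairs the unfavourable zeroth-order term of the surface condition; it is steep
  at the surface and small away from the reflection line \<open>fst z = 0\<close>.\<close>

definition surface_corrector :: "real \<Rightarrow> real \<Rightarrow> real \<times> real \<Rightarrow> jet" where
  "surface_corrector a s = product_jet (\<lambda>q. a * exp q) (\<lambda>q. a * exp q) (\<lambda>q. a * exp q)
     (\<lambda>p. (exp (s * p) - 1) / s) (\<lambda>p. exp (s * p)) (\<lambda>p. s * exp (s * p))"

text \<open>The edge corrector is of size \<open>1/n\<^sup>3\<close>, with second derivative of order \<open>n\<close> in a layer of width \<open>1/n\<^sup>2\<close>
  along the reflection line.\<close>

definition edge_corrector :: "real \<Rightarrow> real \<times> real \<Rightarrow> jet" where
  "edge_corrector n = product_jet (\<lambda>q. exp (n\<^sup>2 * q) / n ^ 3) (\<lambda>q. exp (n\<^sup>2 * q) / n) (\<lambda>q. n * exp (n\<^sup>2 * q))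
     (\<lambda>p. 1) (\<lambda>p. 0) (\<lambda>p. 0)"

lemma holonomic_surface_corrector: "s \<noteq> 0 \<Longrightarrow> holonomic (surface_corrector a s)"
  unfolding surface_corrector_def
  by (rule holonomic_product_jet) (auto intro!: derivative_eq_intros)

lemma holonomic_edge_corrector: "n \<noteq> 0 \<Longrightarrow> holonomic (edge_corrector n)"
  unfolding edge_corrector_def
  by (rule holonomic_product_jet)
    (auto intro!: derivative_eq_intros simp: field_simps power2_eq_square power3_eq_cube)

lemma surface_corrector_bounds:
  assumes "a > 0" "s > 0" "snd z \<le> 0" "fst z \<le> 0"
  shows "norm (surface_corrector a s z) \<le> a * (3 / s + 2 + s) * exp (fst z)"
    "- a / s \<le> val (surface_corrector a s z)"
proof -
  define e \<omega> where "e = exp (s * snd z)" and "\<omega> = (exp (s * snd z) - 1) / s"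
  have e: "0 < e" "e \<le> 1" using assms by (auto simp: e_def mult_nonneg_nonpos)
  then have \<omega>: "\<omega> \<le> 0" "- \<omega> \<le> 1 / s"
    using \<open>s > 0\<close> by (auto simp: \<omega>_def e_def[symmetric] divide_le_0_iff minus_divide_left divide_right_mono)
  have eq: "surface_corrector a s z = (a * exp (fst z)) *\<^sub>R (\<omega>, (\<omega>, e), (\<omega>, e, s * e))"
    by (simp add: surface_corrector_def product_jet_def e_def \<omega>_def)
  have "norm ((\<omega>, (\<omega>, e), (\<omega>, e, s * e)) :: jet) \<le> \<bar>\<omega>\<bar> + (\<bar>\<omega>\<bar> + \<bar>e\<bar>) + (\<bar>\<omega>\<bar> + (\<bar>e\<bar> + \<bar>s * e\<bar>))"
    by (rule norm_jet_le)
  also have "\<dots> \<le> 3 / s + 2 + s"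
  proof -
    have "s * e \<le> s" using e \<open>s > 0\<close> by simp
    moreover have "\<bar>s * e\<bar> = s * e" "\<bar>\<omega>\<bar> = - \<omega>" "\<bar>e\<bar> = e" using e \<omega> \<open>s > 0\<close> by auto
    moreover have "3 / s = 1 / s + (1 / s + 1 / s)" by simp
    ultimately show ?thesis using e \<omega>(2) by linarith
  qed
  finally have "a * exp (fst z) * norm ((\<omega>, (\<omega>, e), (\<omega>, e, s * e)) :: jet) \<le> a * exp (fst z) * (3 / s + 2 + s)"
    using \<open>a > 0\<close> by (intro mult_left_mono) auto
  then show "norm (surface_corrector a s z) \<le> a * (3 / s + 2 + s) * exp (fst z)"
    unfolding eq norm_scaleR using \<open>a > 0\<close> by (simp add: mult_ac)
  have "a * exp (fst z) * (- \<omega>) \<le> a * 1 * (1 / s)"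
    using assms \<omega> by (intro mult_mono) auto
  then show "- a / s \<le> val (surface_corrector a s z)" by (simp add: eq)
qed

lemma edge_corrector_bounds:
  assumes "n \<ge> 1" "fst z \<le> 0"
  shows "norm (edge_corrector n z) \<le> 3 * n * exp (fst z)" "val (edge_corrector n z) \<le> 1 / n"
proof -
  have nn: "1 / n ^ 3 \<le> 1 / n" "1 / n \<le> n" "1 \<le> n\<^sup>2" "n > 0"
    using assms(1) self_le_power[of n 3] mult_mono[of 1 n 1 n]
    by (auto simp: divide_le_eq power2_eq_square intro!: divide_left_mono)
  have e: "exp (n\<^sup>2 * fst z) \<le> exp (fst z)" "exp (n\<^sup>2 * fst z) \<le> 1"
    using assms(2) nn(3) mult_right_mono_neg[of 1 "n\<^sup>2" "fst z"] by (auto simp: mult_nonneg_nonpos)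
  have eq: "edge_corrector n z = exp (n\<^sup>2 * fst z) *\<^sub>R (1 / n ^ 3, (1 / n, 0), (n, 0, 0))"
    by (simp add: edge_corrector_def product_jet_def mult.commute)
  have "norm ((1 / n ^ 3, (1 / n, 0), (n, 0, 0)) :: jet) \<le> \<bar>1 / n ^ 3\<bar> + (\<bar>1 / n\<bar> + \<bar>0\<bar>) + (\<bar>n\<bar> + (\<bar>0\<bar> + \<bar>0\<bar>))"
    by (rule norm_jet_le)
  also have "\<dots> \<le> 3 * n" using nn by simp
  finally have "exp (n\<^sup>2 * fst z) * norm ((1 / n ^ 3, (1 / n, 0), (n, 0, 0)) :: jet) \<le> exp (fst z) * (3 * n)"
    using e(1) by (intro mult_mono) auto
  then show "norm (edge_corrector n z) \<le> 3 * n * exp (fst z)"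
    unfolding eq norm_scaleR by (simp add: mult_ac)
  have "exp (n\<^sup>2 * fst z) * (1 / n ^ 3) \<le> 1 * (1 / n)" using e(2) nn by (intro mult_mono) auto
  then show "val (edge_corrector n z) \<le> 1 / n" by (simp add: eq)
qed

context height_problem
begin

lemma excess_edge_corrector:
  assumes "n \<ge> 1" "c \<le> x"
  shows "exp (n\<^sup>2 * fst z) * (c\<^sup>2 * n - \<Lambda>) \<le> excess x y (edge_corrector n z)"
proof -
  define E where "E = exp (n\<^sup>2 * fst z)"
  have E: "E > 0" by (simp add: E_def)
  have "edge_corrector n z = (E / n ^ 3, (E / n, 0), (n * E, 0, 0))"
    by (simp add: edge_corrector_def product_jet_def E_def)
  then have "excess x y (edge_corrector n z) = x\<^sup>2 * (n * E) - \<Lambda> * (E / n)"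
    using assms(1) E by (simp add: excess_def symbol_def load_def)
  also have "\<dots> = E * (x\<^sup>2 * n - \<Lambda> / n)" by (simp add: right_diff_distrib)
  finally have "excess x y (edge_corrector n z) = E * (x\<^sup>2 * n - \<Lambda> / n)" .
  moreover have "c\<^sup>2 * n \<le> x\<^sup>2 * n" using assms c_pos by (intro mult_right_mono power_mono) auto
  moreover have "\<Lambda> / n \<le> \<Lambda>" using assms(1) \<Lambda>(1) by (simp add: divide_le_eq)
  ultimately show ?thesis
    unfolding E_def[symmetric] using E by simp
qed

lemma excess_profile_jet_layer:
  assumes "supersolution (\<Lambda> + Z) b B \<delta> \<Phi> \<Phi>' \<Phi>''" "b > 0" "Z \<ge> 0" "p \<in> {-1..0}" "p \<le> -1 + \<delta>"
  shows "Z < excess x y (- profile_jet \<Phi> \<Phi>' \<Phi>'' p)"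
proof -
  have \<Phi>: "\<Phi>'' p + (\<Lambda> + Z) * (1 + \<bar>\<Phi>' p\<bar> + \<Phi> p) < 0" "b \<le> \<Phi> p"
    using assms by (auto simp: supersolution_def)
  have "Z * 1 \<le> Z * (1 + \<bar>\<Phi>' p\<bar> + \<Phi> p)" using \<Phi>(2) assms by (intro mult_left_mono) auto
  then have *: "Z + \<Lambda> * (\<bar>\<Phi>' p\<bar> + \<Phi> p) < - \<Phi>'' p"
    using \<Phi>(1) \<Lambda>(1) by (simp add: algebra_simps)
  moreover have "0 \<le> \<Lambda> * (\<bar>\<Phi>' p\<bar> + \<Phi> p)" using \<Phi>(2) \<Lambda>(1) assms(2) by simp
  ultimately have "0 \<le> y\<^sup>2 * - \<Phi>'' p" using assms(3) by (intro mult_nonneg_nonneg) auto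
  then have "Z + \<Lambda> * (\<bar>\<Phi>' p\<bar> + \<Phi> p) < (1 + y\<^sup>2) * - \<Phi>'' p" using * by (simp add: algebra_simps)
  then show ?thesis
    using \<Phi>(2) assms(2) by (simp add: excess_def symbol_def load_def profile_jet_def)
qed

definition reflection_comparison :: "(real \<Rightarrow> real) \<Rightarrow> (real \<Rightarrow> real) \<Rightarrow> (real \<Rightarrow> real) \<Rightarrow>
    real \<Rightarrow> real \<Rightarrow> real \<Rightarrow> real \<times> real \<Rightarrow> jet" where
  "reflection_comparison \<Phi> \<Phi>' \<Phi>'' a s n z =
     profile_jet \<Phi> \<Phi>' \<Phi>'' (snd z) + surface_corrector a s z - edge_corrector n z"

definition corrector_load :: "real \<Rightarrow> real \<Rightarrow> real" where
  "corrector_load a s = (5 * M\<^sup>2 + 3 * \<Lambda>) * (a * (3 / s + 2 + s))"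

lemma corrector_load_nonneg: "a > 0 \<Longrightarrow> s > 0 \<Longrightarrow> corrector_load a s \<ge> 0"
  using \<Lambda>(1) by (simp add: corrector_load_def)

lemma excess_reflection_comparison:
  assumes "excess x y (- profile_jet \<Phi> \<Phi>' \<Phi>'' (snd z)) \<ge> W"
    and "a > 0" "s > 0" "n \<ge> 1" "z \<in> strip" "fst z \<le> 0" "x \<in> {c..M}" "y \<in> {-M..M}"
  shows "W - corrector_load a s + exp (n\<^sup>2 * fst z) * (c\<^sup>2 * n - \<Lambda>)
    \<le> excess x y (- reflection_comparison \<Phi> \<Phi>' \<Phi>'' a s n z)"
proof -
  let ?p = "profile_jet \<Phi> \<Phi>' \<Phi>'' (snd z)" and ?s = "surface_corrector a s z"
  have "norm ?s \<le> a * (3 / s + 2 + s) * exp (fst z)"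
    using assms by (intro surface_corrector_bounds) (auto simp: strip_def)
  also have "\<dots> \<le> a * (3 / s + 2 + s) * 1" using assms by (intro mult_left_mono) auto
  finally have "(5 * M\<^sup>2 + 3 * \<Lambda>) * norm (- ?s) \<le> corrector_load a s"
    unfolding corrector_load_def using \<Lambda>(1) by (intro mult_left_mono) auto
  moreover have "- ((5 * M\<^sup>2 + 3 * \<Lambda>) * norm (- ?s)) \<le> excess x y (- ?s)"
    using assms(7,8) c_pos by (intro excess_ge_norm) auto
  moreover have "exp (n\<^sup>2 * fst z) * (c\<^sup>2 * n - \<Lambda>) \<le> excess x y (edge_corrector n z)"
    using assms by (intro excess_edge_corrector) auto
  moreover have "- reflection_comparison \<Phi> \<Phi>' \<Phi>'' a s n z = - ?p + (- ?s + edge_corrector n z)"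
    by (simp add: reflection_comparison_def)
  ultimately show ?thesis
    using assms(1) excess_add[of x y "- ?p" "- ?s + edge_corrector n z"]
      excess_add[of x y "- ?s" "edge_corrector n z"]
    by simp
qed

lemma supersolution_at_surface:
  assumes "supersolution N b B \<delta> \<Phi> \<Phi>' \<Phi>''" "b > 0"
  shows "0 < \<Phi> 0" "\<Phi> 0 \<le> B" "0 < \<Phi>' 0"
proof -
  have "b \<le> \<Phi> 0" "\<Phi> 0 \<le> B" "surface_gap \<Phi> \<Phi>' > 0" using assms(1) by (simp_all add: supersolution_def)
  then show "0 < \<Phi> 0" "\<Phi> 0 \<le> B" using assms(2) by simp_all
  then have "\<mu> * \<rho>0 * \<Phi> 0 > 0" using \<mu>_pos \<rho>0_pos by simp
  then have "\<Phi>' 0 / Hp 0 ^ 3 > 0" using \<open>surface_gap \<Phi> \<Phi>' > 0\<close> by (simp add: surface_gap_def)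
  then show "0 < \<Phi>' 0" using Hp_pos[of 0] by (simp add: zero_less_divide_iff)
qed

lemma strict_increment_reflection_comparison_top:
  assumes \<Phi>: "supersolution N b B \<delta> \<Phi> \<Phi>' \<Phi>''" "b > 0"
    and a: "a \<ge> 2 * M ^ 3 * (\<mu> * \<rho>0 * B + 1)" "s > 0" and n: "n \<ge> 1" "n > M / c\<^sup>2"
    and q: "- (1 / 2) \<le> q" "q \<le> 0"
  shows "strict_increment 0 (- reflection_comparison \<Phi> \<Phi>' \<Phi>'' a s n (q, 0))"
proof -
  define E where "E = exp (n\<^sup>2 * q)"
  have E: "0 < E" "E \<le> 1" using q(2) by (auto simp: E_def mult_nonneg_nonpos)
  note \<Phi>0 = supersolution_at_surface[OF \<Phi>]
  have \<mu>\<rho>: "\<mu> * \<rho>0 > 0" using \<mu>_pos \<rho>0_pos by simp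
  let ?P = "reflection_comparison \<Phi> \<Phi>' \<Phi>'' a s n (q, 0)"
  have P: "val ?P = \<Phi> 0 - E / n ^ 3" "dq ?P = - (E / n)" "dp ?P = \<Phi>' 0 + a * exp q"
    by (simp_all add: reflection_comparison_def profile_jet_def surface_corrector_def edge_corrector_def
        product_jet_def E_def)
  have "1 / 2 \<le> exp q" using exp_ge_add_one_self[of q] q(1) by linarith
  have B: "\<mu> * \<rho>0 * B > 0" using \<mu>\<rho> \<Phi>0 by simp
  then have "0 \<le> 2 * M ^ 3 * (\<mu> * \<rho>0 * B + 1)" using M_pos by simp
  then have "2 * M ^ 3 * (\<mu> * \<rho>0 * B + 1) * (1 / 2) \<le> a * exp q"
    using a(1) \<open>1 / 2 \<le> exp q\<close> by (intro mult_mono) auto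
  then have "M ^ 3 * (\<mu> * \<rho>0 * B + 1) \<le> dp ?P" using \<Phi>0(3) by (simp add: P)
  then have dp: "\<mu> * \<rho>0 * B + 1 \<le> dp ?P / M ^ 3" using M_pos by (simp add: pos_le_divide_eq mult.commute)
  then have "dp ?P / M ^ 3 > 0" using B by linarith
  then have "dp ?P \<ge> 0" using M_pos by (simp add: zero_less_divide_iff)
  have "\<bar>dq ?P\<bar> * (M / c\<^sup>2) \<le> 1 / n * (M / c\<^sup>2)"
    unfolding P using E n(1) M_pos by (intro mult_right_mono) (auto simp: divide_right_mono)
  also have "\<dots> = M / c\<^sup>2 / n" by simp
  also have "\<dots> < 1" using n by (subst pos_divide_less_eq) auto
  finally have dq: "\<bar>dq ?P\<bar> * (M / c\<^sup>2) < 1" .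
  have "0 \<le> E / n ^ 3" using E n(1) by simp
  then have "val ?P \<le> B" using \<Phi>0(2) by (simp add: P)
  then have "\<mu> * \<rho>0 * val ?P \<le> \<mu> * \<rho>0 * B" using \<mu>\<rho> by (intro mult_left_mono) auto
  with dp dq have "top_excess (- ?P) > 0" by (simp add: top_excess_def)
  then show ?thesis using \<open>dp ?P \<ge> 0\<close> by (simp add: strict_increment_def)
qed

lemma strict_increment_reflection_comparison_interior:
  assumes \<Phi>: "supersolution (\<Lambda> + corrector_load a s) b B \<delta> \<Phi> \<Phi>' \<Phi>''" "b > 0"
    and R: "norm (profile_jet \<Phi> \<Phi>' \<Phi>'' (snd z)) \<le> R"
    and a: "a > 0" "s > 0" and n: "n \<ge> 1" "3 * ((5 * M\<^sup>2 + 3 * \<Lambda>) * R + corrector_load a s) < c\<^sup>2 * n - \<Lambda>"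
    and z: "z \<in> strip" "fst z \<le> 0" "snd z < 0" "snd z \<le> -1 + \<delta> \<or> - (1 / n\<^sup>2) \<le> fst z"
  shows "strict_increment (snd z) (- reflection_comparison \<Phi> \<Phi>' \<Phi>'' a s n z)"
proof -
  define W where "W = (5 * M\<^sup>2 + 3 * \<Lambda>) * R"
  note Z = corrector_load_nonneg[OF a]
  have "0 \<le> R" using R norm_ge_zero order_trans by blast
  then have W: "W \<ge> 0" using \<Lambda>(1) by (simp add: W_def)
  have "excess x y (- reflection_comparison \<Phi> \<Phi>' \<Phi>'' a s n z) > 0" if xy: "x \<in> {c..M}" "y \<in> {-M..M}" for x y
  proof (cases "snd z \<le> -1 + \<delta>")
    case True
    have "corrector_load a s < excess x y (- profile_jet \<Phi> \<Phi>' \<Phi>'' (snd z))"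
      using z(1) True by (intro excess_profile_jet_layer[OF \<Phi> Z]) (auto simp: strip_def)
    moreover have "0 \<le> exp (n\<^sup>2 * fst z) * (c\<^sup>2 * n - \<Lambda>)"
      using n(2) W Z by (intro mult_nonneg_nonneg) (auto simp: W_def)
    ultimately show ?thesis
      using excess_reflection_comparison[OF order_refl a n(1) z(1,2) xy, of \<Phi> \<Phi>' \<Phi>''] by simp
  next
    case False
    have "(5 * M\<^sup>2 + 3 * \<Lambda>) * norm (- profile_jet \<Phi> \<Phi>' \<Phi>'' (snd z)) \<le> W"
      unfolding W_def using R \<Lambda>(1) by (intro mult_left_mono) auto
    then have "- W \<le> excess x y (- profile_jet \<Phi> \<Phi>' \<Phi>'' (snd z))"
      using excess_ge_norm[of x y "- profile_jet \<Phi> \<Phi>' \<Phi>'' (snd z)"] xy c_pos by fastforce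
    note lower = excess_reflection_comparison[OF this a n(1) z(1,2) xy]
    have "- 1 \<le> n\<^sup>2 * fst z" using False z(4) n(1) by (simp add: field_simps)
    then have "exp (- 1) \<le> exp (n\<^sup>2 * fst z)" by simp
    moreover have "1 / 3 \<le> exp (- 1 :: real)" using exp_le by (simp add: exp_minus field_simps)
    ultimately have "1 / 3 \<le> exp (n\<^sup>2 * fst z)" by linarith
    then have "1 / 3 * (c\<^sup>2 * n - \<Lambda>) \<le> exp (n\<^sup>2 * fst z) * (c\<^sup>2 * n - \<Lambda>)"
      using n(2) W Z by (intro mult_right_mono) (auto simp: W_def)
    then show ?thesis using lower n(2)[folded W_def] by argo
  qed
  then show ?thesis using z(3) by (simp add: strict_increment_def)
qed

lemma strict_increment_reflection_comparison:
  assumes \<Phi>: "supersolution (\<Lambda> + corrector_load a s) b B \<delta> \<Phi> \<Phi>' \<Phi>''" "b > 0"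
    and R: "\<And>p. p \<in> {-1..0} \<Longrightarrow> norm (profile_jet \<Phi> \<Phi>' \<Phi>'' p) \<le> R"
    and a: "a > 0" "a \<ge> 2 * M ^ 3 * (\<mu> * \<rho>0 * B + 1)" "s > 0"
    and n: "n \<ge> 2" "n > M / c\<^sup>2" "3 * ((5 * M\<^sup>2 + 3 * \<Lambda>) * R + corrector_load a s) < c\<^sup>2 * n - \<Lambda>"
    and z: "z \<in> strip" "fst z \<le> 0" "snd z \<le> -1 + \<delta> \<or> - (1 / n\<^sup>2) \<le> fst z"
  shows "strict_increment (snd z) (- reflection_comparison \<Phi> \<Phi>' \<Phi>'' a s n z)"
proof (cases "snd z = 0")
  case False
  then have "snd z < 0" "snd z \<in> {-1..0}" using z(1) by (auto simp: strip_def)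
  then show ?thesis
    using n z by (intro strict_increment_reflection_comparison_interior[OF \<Phi> R a(1,3)]) auto
next
  case True
  have "\<delta> < 1" using \<Phi>(1) by (simp add: supersolution_def)
  moreover have "1 / n\<^sup>2 \<le> 1 / 2" using n(1) power_mono[of 2 n 2] by (intro divide_left_mono) auto
  ultimately have "- (1 / 2) \<le> fst z" using z(3) True by linarith
  then have "strict_increment 0 (- reflection_comparison \<Phi> \<Phi>' \<Phi>'' a s n (fst z, 0))"
    using strict_increment_reflection_comparison_top[OF \<Phi> a(2,3)] z(2) n(1,2) by simp
  moreover have "(fst z, 0) = z" using True by (simp add: prod_eq_iff)
  ultimately show ?thesis using True by simp
qed

lemma reflection_comparison_bounds:
  assumes \<Phi>: "\<And>p. p \<in> {-1..0} \<Longrightarrow> b \<le> \<Phi> p" and a: "a > 0" "s > 0" "a / s = b / 4"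
    and n: "n \<ge> 1" "4 / b \<le> n" and "b > 0" and z: "z \<in> strip" "fst z \<le> 0"
  shows "b / 2 \<le> val (reflection_comparison \<Phi> \<Phi>' \<Phi>'' a s n z)"
    "norm (reflection_comparison \<Phi> \<Phi>' \<Phi>'' a s n z - profile_jet \<Phi> \<Phi>' \<Phi>'' (snd z))
      \<le> (a * (3 / s + 2 + s) + 3 * n) * exp (fst z)"
proof -
  have p: "snd z \<in> {-1..0}" using z(1) by (simp add: strip_def)
  have S: "norm (surface_corrector a s z) \<le> a * (3 / s + 2 + s) * exp (fst z)"
    "- a / s \<le> val (surface_corrector a s z)"
    using surface_corrector_bounds[OF a(1,2) _ z(2)] p by auto
  note E = edge_corrector_bounds[OF n(1) z(2)]
  have "1 / n \<le> b / 4" using n \<open>b > 0\<close> by (simp add: field_simps)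
  then show "b / 2 \<le> val (reflection_comparison \<Phi> \<Phi>' \<Phi>'' a s n z)"
    using \<Phi>[OF p] S(2) E(2) a(3) by (simp add: reflection_comparison_def profile_jet_def)
  show "norm (reflection_comparison \<Phi> \<Phi>' \<Phi>'' a s n z - profile_jet \<Phi> \<Phi>' \<Phi>'' (snd z))
      \<le> (a * (3 / s + 2 + s) + 3 * n) * exp (fst z)"
    using norm_triangle_ineq4[of "surface_corrector a s z" "edge_corrector n z"] S(1) E(1)
    by (simp add: reflection_comparison_def distrib_right)
qed

lemma reflection_comparison_exists:
  assumes b: "b > 0" and super: "\<And>N. \<exists>\<delta> \<Phi> \<Phi>' \<Phi>''. supersolution N b B \<delta> \<Phi> \<Phi>' \<Phi>''"
  obtains N \<delta> \<Phi> \<Phi>' \<Phi>'' P A r where "supersolution N b B \<delta> \<Phi> \<Phi>' \<Phi>''" "holonomic P" "r > 0"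
    "\<And>z. z \<in> strip \<Longrightarrow> fst z \<le> 0 \<Longrightarrow> b / 2 \<le> val (P z)"
    "\<And>z. z \<in> strip \<Longrightarrow> fst z \<le> 0 \<Longrightarrow> norm (P z - profile_jet \<Phi> \<Phi>' \<Phi>'' (snd z)) \<le> A * exp (fst z)"
    "\<And>z. z \<in> strip \<Longrightarrow> fst z \<le> 0 \<Longrightarrow> snd z \<le> -1 + \<delta> \<or> - r \<le> fst z \<Longrightarrow> strict_increment (snd z) (- P z)"
proof -
  have B: "B > 0" using super[of 0] supersolution_at_surface[OF _ b] by fastforce
  define a where "a = 2 * M ^ 3 * (\<mu> * \<rho>0 * B + 1)"
  define s where "s = 4 * a / b"
  have a: "a > 0" using B M_pos \<mu>_pos \<rho>0_pos by (simp add: a_def add_pos_pos)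
  then have s: "s > 0" "a / s = b / 4" using b by (simp_all add: s_def)
  obtain \<delta> \<Phi> \<Phi>' \<Phi>'' where \<Phi>: "supersolution (\<Lambda> + corrector_load a s) b B \<delta> \<Phi> \<Phi>' \<Phi>''" using super by blast
  then have profile: "C2_profile \<Phi> \<Phi>' \<Phi>''" "\<And>p. p \<in> {-1..0} \<Longrightarrow> b \<le> \<Phi> p"
    by (simp_all add: supersolution_def)
  obtain R where R: "R > 0" "\<And>p. p \<in> {-1..0} \<Longrightarrow> norm (profile_jet \<Phi> \<Phi>' \<Phi>'' p) \<le> R"
    using norm_profile_jet_bounded[OF profile(1)] by blast
  define W where "W = (5 * M\<^sup>2 + 3 * \<Lambda>) * R + corrector_load a s"
  define n where "n = Max {2, M / c\<^sup>2 + 1, 4 / b, (3 * W + \<Lambda> + 1) / c\<^sup>2}"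
  have n: "n \<ge> 2" "n \<ge> M / c\<^sup>2 + 1" "4 / b \<le> n" "n \<ge> (3 * W + \<Lambda> + 1) / c\<^sup>2" by (auto simp: n_def)
  have gap: "3 * W < c\<^sup>2 * n - \<Lambda>" using n(4) c_pos by (simp add: field_simps)
  have n1: "n \<ge> 1" using n(1) by simp
  show thesis
  proof (rule that[OF \<Phi>])
    show "holonomic (reflection_comparison \<Phi> \<Phi>' \<Phi>'' a s n)"
      unfolding reflection_comparison_def[abs_def] using s(1) n(1) profile(1)
      by (intro holonomic_diff holonomic_add holonomic_profile_jet holonomic_surface_corrector
        holonomic_edge_corrector) auto
    show "1 / n\<^sup>2 > 0" using n(1) by simp
    fix z assume z: "z \<in> strip" "fst z \<le> 0"
    note reflection_comparison_bounds[where \<Phi> = \<Phi>, OF profile(2) a s n1 n(3) b z]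
    then show "b / 2 \<le> val (reflection_comparison \<Phi> \<Phi>' \<Phi>'' a s n z)"
      "norm (reflection_comparison \<Phi> \<Phi>' \<Phi>'' a s n z - profile_jet \<Phi> \<Phi>' \<Phi>'' (snd z))
        \<le> (a * (3 / s + 2 + s) + 3 * n) * exp (fst z)" by blast+
    show "strict_increment (snd z) (- reflection_comparison \<Phi> \<Phi>' \<Phi>'' a s n z)"
      if "snd z \<le> -1 + \<delta> \<or> - (1 / n\<^sup>2) \<le> fst z"
      using strict_increment_reflection_comparison[OF \<Phi> b R(2) a _ s(1) n(1) _ _ z that] n(2) gap
      by (simp add: a_def W_def)
  qed
qed

end

section \<open>Moving planes\<close>

lemma derivative_ge_of_increments:
  fixes g :: "real \<Rightarrow> real"
  assumes "(g has_real_derivative D) (at x)" "h0 > 0"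
    and "\<And>h. 0 < h \<Longrightarrow> h \<le> h0 \<Longrightarrow> K * h \<le> g (x + h) - g x"
  shows "K \<le> D"
proof (rule ccontr)
  assume "\<not> K \<le> D"
  moreover have "((\<lambda>t. g t - K * t) has_real_derivative D - K) (at x)"
    using assms(1) by (auto intro!: derivative_eq_intros)
  ultimately obtain d where d: "d > 0" "\<And>h. h > 0 \<Longrightarrow> h < d \<Longrightarrow> g (x + h) - K * (x + h) < g x - K * x"
    using DERIV_neg_dec_right[of "\<lambda>t. g t - K * t" "D - K" x] by auto
  define h where "h = min (d / 2) h0"
  have "0 < h" "h < d" "h \<le> h0" using d(1) assms(2) by (auto simp: h_def)
  then show False using d(2)[of h] assms(3)[of h] by (simp add: algebra_simps)
qed

locale elevation_wave = height_problem +
  fixes J :: "real \<times> real \<Rightarrow> jet" and b B :: real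
  assumes solution: "solution J"
    and elevation: "z \<in> strip \<Longrightarrow> -1 < snd z \<Longrightarrow> val (J z) > 0"
    and vanishing: "vanishes_left J"
    and b_pos: "b > 0"
    and supersolution: "\<exists>\<delta> \<Phi> \<Phi>' \<Phi>''. supersolution N b B \<delta> \<Phi> \<Phi>' \<Phi>''"
begin

lemmas holonomic = solutionD(1)[OF solution]

lemma val_nonneg: "z \<in> strip \<Longrightarrow> val (J z) \<ge> 0"
  using elevation[of z] solutionD(4)[OF solution, of "fst z"]
  by (cases "snd z = -1") (auto simp: strip_def less_le, metis prod.collapse order_refl)

lemma val_lipschitz:
  assumes "p \<in> {-1..0}"
  shows "\<bar>val (J (q, p)) - val (J (q', p))\<bar> \<le> M * \<bar>q - q'\<bar>"
  using field_differentiable_bound[of UNIV "\<lambda>t. val (J (t, p))" "\<lambda>t. dq (J (t, p))" M q q']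
    holonomic_partials(1)[OF holonomic assms] solution_entry_bounds(2)[OF solution] assms by auto

definition reflection_ordered :: "real \<Rightarrow> bool" where
  "reflection_ordered l \<longleftrightarrow> (\<forall>z\<in>strip. fst z \<le> l \<longrightarrow> val (J z) \<le> val (J (2 * l - fst z, snd z)))"

lemma reflection_orderedI:
  assumes P: "holonomic P" "k > 0" "\<And>z. z \<in> strip \<Longrightarrow> fst z \<le> l \<Longrightarrow> k \<le> val (P z)"
    and far: "far_field \<epsilon> \<Phi> \<Phi>' \<Phi>''"
    and cover: "\<And>z. z \<in> {..<l} \<times> {-1<..0} \<Longrightarrow> val (J (2 * l - fst z, snd z)) < val (J z) \<Longrightarrow>
       norm (J z) \<le> \<epsilon> \<and> norm (P z - profile_jet \<Phi> \<Phi>' \<Phi>'' (snd z)) \<le> \<epsilon> \<or> strict_increment (snd z) (- P z)"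
  shows "reflection_ordered l"
  unfolding reflection_ordered_def
proof (intro ballI impI)
  fix y :: "real \<times> real" assume y: "y \<in> strip" "fst y \<le> l"
  have nonneg: "val (reflect (J (2 * l - fst z, snd z))) \<ge> 0" if "z \<in> strip" for z
    using that val_nonneg by (simp add: strip_def)
  have "val (J y) \<le> val (reflect (J (2 * l - fst y, snd y)))"
    using cover
    by (intro comparison[OF solution_reflect[OF solution] nonneg solution vanishing _ P far _ y]) simp_all
  then show "val (J y) \<le> val (J (2 * l - fst y, snd y))" by simp
qed

lemma planes_start: "\<exists>Q. \<forall>l\<le>Q. reflection_ordered l"
proof -
  obtain \<delta> \<Phi> \<Phi>' \<Phi>'' where \<Phi>: "supersolution 0 b B \<delta> \<Phi> \<Phi>' \<Phi>''" using supersolution by blast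
  then have profile: "C2_profile \<Phi> \<Phi>' \<Phi>''" "\<And>p. p \<in> {-1..0} \<Longrightarrow> b \<le> \<Phi> p"
    by (simp_all add: supersolution_def)
  obtain \<epsilon> where \<epsilon>: "\<epsilon> > 0" "far_field \<epsilon> \<Phi> \<Phi>' \<Phi>''" using far_field_exists[OF \<Phi> b_pos] by blast
  obtain Q where Q: "\<And>z. z \<in> strip \<Longrightarrow> fst z \<le> Q \<Longrightarrow> norm (J z) < \<epsilon>"
    using vanishes_leftD[OF vanishing \<epsilon>(1)] by blast
  have "reflection_ordered l" if "l \<le> Q" for l
  proof (rule reflection_orderedI[OF holonomic_profile_jet[OF profile(1)] b_pos _ \<epsilon>(2)])
    fix z :: "real \<times> real" assume "z \<in> {..<l} \<times> {-1<..0}"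
    then have "z \<in> strip" "fst z \<le> Q" using \<open>l \<le> Q\<close> by (auto simp: strip_def)
    from Q[OF this] show "norm (J z) \<le> \<epsilon> \<and>
        norm (profile_jet \<Phi> \<Phi>' \<Phi>'' (snd z) - profile_jet \<Phi> \<Phi>' \<Phi>'' (snd z)) \<le> \<epsilon> \<or>
      strict_increment (snd z) (- profile_jet \<Phi> \<Phi>' \<Phi>'' (snd z))" using \<epsilon>(1) by simp
  qed (use profile(2) in \<open>auto simp: strip_def profile_jet_def\<close>)
  then show ?thesis by blast
qed

lemma ordered_on_compact:
  assumes strict: "\<And>z. z \<in> K \<Longrightarrow> val (J z) < val (J (2 * l0 - fst z, snd z))"
    and K: "compact K" "K \<subseteq> strip"
  shows "\<exists>d>0. \<forall>l\<in>{l0..l0 + d}. \<forall>z\<in>K. val (J z) \<le> val (J (2 * l - fst z, snd z))"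
proof (cases "K = {}")
  case True then show ?thesis by (intro exI[of _ 1]) auto
next
  case False
  define f where "f z = val (J (2 * l0 - fst z, snd z)) - val (J z)" for z
  note cont = continuous_on_compose2[OF holonomic_continuous_on_val[OF holonomic]]
  have "continuous_on K f"
    unfolding f_def
    by (intro continuous_on_diff cont continuous_intros) (use K(2) in \<open>auto simp: strip_def\<close>)
  then obtain y where y: "y \<in> K" "\<And>z. z \<in> K \<Longrightarrow> f y \<le> f z"
    using continuous_attains_inf[OF K(1) False] by blast
  have "val (J z) \<le> val (J (2 * l - fst z, snd z))" if l: "l \<in> {l0..l0 + f y / (2 * M)}" and z: "z \<in> K"
    for l z
  proof -
    have "snd z \<in> {-1..0}" using K(2) z by (auto simp: strip_def)
    then have "\<bar>val (J (2 * l0 - fst z, snd z)) - val (J (2 * l - fst z, snd z))\<bar> \<le> M * (2 * (l - l0))"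
      using val_lipschitz[of "snd z" "2 * l0 - fst z" "2 * l - fst z"] l by simp
    moreover have "M * (2 * (l - l0)) \<le> f y" using l M_pos by (simp add: field_simps)
    ultimately show ?thesis using y(2)[OF z] by (simp add: f_def)
  qed
  moreover have "f y > 0" using strict[OF y(1)] by (simp add: f_def)
  ultimately show ?thesis using M_pos by (intro exI[of _ "f y / (2 * M)"]) auto
qed

lemma mult_exp_le_below:
  fixes A \<epsilon> :: real
  assumes "\<epsilon> > 0"
  obtains E where "\<And>q. q \<le> E \<Longrightarrow> A * exp q \<le> \<epsilon>"
proof -
  have "((\<lambda>q. A * exp q) \<longlongrightarrow> A * 0) at_bot" by (intro tendsto_intros exp_at_bot)
  then have "\<forall>\<^sub>F q in at_bot. A * exp q < \<epsilon>" using assms by (intro order_tendstoD(2)) auto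
  then show thesis using that unfolding eventually_at_bot_linorder by (meson less_imp_le)
qed

lemma planes_step:
  assumes strict: "\<And>z. z \<in> {..<l0} \<times> {-1<..0} \<Longrightarrow> val (J z) < val (J (2 * l0 - fst z, snd z))"
  shows "\<exists>d>0. \<forall>l\<in>{l0..l0 + d}. reflection_ordered l"
proof -
  obtain N \<delta> \<Phi> \<Phi>' \<Phi>'' P A r where \<Phi>: "supersolution N b B \<delta> \<Phi> \<Phi>' \<Phi>''" and P: "holonomic P"
      "\<And>z. z \<in> strip \<Longrightarrow> fst z \<le> 0 \<Longrightarrow> b / 2 \<le> val (P z)"
    and r: "r > 0" and
      decay: "\<And>z. z \<in> strip \<Longrightarrow> fst z \<le> 0 \<Longrightarrow> norm (P z - profile_jet \<Phi> \<Phi>' \<Phi>'' (snd z)) \<le> A * exp (fst z)" and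
      near: "\<And>z. z \<in> strip \<Longrightarrow> fst z \<le> 0 \<Longrightarrow> snd z \<le> -1 + \<delta> \<or> - r \<le> fst z \<Longrightarrow> strict_increment (snd z) (- P z)"
    using reflection_comparison_exists[OF b_pos supersolution] by metis
  obtain \<epsilon> where \<epsilon>: "\<epsilon> > 0" "far_field \<epsilon> \<Phi> \<Phi>' \<Phi>''" using far_field_exists[OF \<Phi> b_pos] by blast
  obtain Q where Q: "\<And>z. z \<in> strip \<Longrightarrow> fst z \<le> Q \<Longrightarrow> norm (J z) < \<epsilon>"
    using vanishes_leftD[OF vanishing \<epsilon>(1)] by blast
  have "\<delta> > 0" using \<Phi> by (simp add: supersolution_def)
  obtain E where E: "\<And>q. q \<le> E \<Longrightarrow> A * exp q \<le> \<epsilon>" using mult_exp_le_below[OF \<epsilon>(1)] by blast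
  define Q0 where "Q0 = min Q (l0 + E)"
  define K where "K = {Q0..l0 - r / 2} \<times> {-1 + \<delta>..0}"
  have K: "compact K" "K \<subseteq> {..<l0} \<times> {-1<..0}" using r \<open>\<delta> > 0\<close> by (auto simp: K_def compact_Times)
  then have "K \<subseteq> strip" by (force simp: strip_def)
  then obtain d where d: "d > 0" "\<forall>l\<in>{l0..l0 + d}. \<forall>z\<in>K. val (J z) \<le> val (J (2 * l - fst z, snd z))"
    using ordered_on_compact[of K l0] strict K by blast
  have "reflection_ordered l" if l: "l \<in> {l0..l0 + min d (r / 2)}" for l
  proof (rule reflection_orderedI[OF holonomic_translate[OF P(1), of "- l"] _ _ \<epsilon>(2)])
    show "b / 2 > 0" using b_pos by simp
    show "b / 2 \<le> val (P (fst z + - l, snd z))" if "z \<in> strip" "fst z \<le> l" for z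
      using P(2)[of "(fst z + - l, snd z)"] that by (simp add: strip_def)
    fix z assume z: "z \<in> {..<l} \<times> {-1<..0}" and neg: "val (J (2 * l - fst z, snd z)) < val (J z)"
    have zl: "z \<in> strip" "(fst z + - l, snd z) \<in> strip" "fst z < l" using z by (auto simp: strip_def)
    consider "fst z \<le> Q0" | "snd z \<le> -1 + \<delta> \<or> - r \<le> fst z + - l" | "z \<in> K"
      using l z by (fastforce simp: K_def)
    then show "norm (J z) \<le> \<epsilon> \<and> norm (P (fst z + - l, snd z) - profile_jet \<Phi> \<Phi>' \<Phi>'' (snd z)) \<le> \<epsilon> \<or>
      strict_increment (snd z) (- P (fst z + - l, snd z))"
    proof cases
      case 1
      then have "norm (J z) < \<epsilon>" "A * exp (fst z - l) \<le> \<epsilon>"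
        using l zl(1) by (auto simp: Q0_def intro!: Q E)
      moreover have "norm (P (fst z + - l, snd z) - profile_jet \<Phi> \<Phi>' \<Phi>'' (snd z)) \<le> A * exp (fst z - l)"
        using decay[OF zl(2)] zl(3) by simp
      ultimately show ?thesis by linarith
    next
      case 2
      then show ?thesis using near[OF zl(2)] zl(3) by simp
    next
      case 3
      have "l \<in> {l0..l0 + d}" using l by (auto simp: min_def split: if_splits)
      then show ?thesis using d(2) 3 neg by fastforce
    qed
  qed
  then show ?thesis using d(1) r by (intro exI[of _ "min d (r / 2)"]) auto
qed

lemma reflection_strict:
  assumes ord: "reflection_ordered l"
    and y: "y \<in> strip" "fst y \<le> l" "val (J y) \<noteq> val (J (2 * l - fst y, snd y))"
    and z: "z \<in> {..<l} \<times> {-1<..0}"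
  shows "val (J z) < val (J (2 * l - fst z, snd z))"
proof -
  note reflected = solution_reflect[OF solution, of "2 * l"]
  define f where "f z = val (reflect (J (2 * l - fst z, snd z))) - val (J z)" for z
  have "f z > 0"
  proof (rule positivity_propagates[OF \<tau>_pos _ _ _ _ z, of f y])
    show "spreads_positivity \<tau> l f"
      unfolding f_def
      by (rule difference_spreads_positivity[OF reflected solution])
        (use ord in \<open>force simp: reflection_ordered_def strip_def\<close>)
    show "continuous_on strip f"
      unfolding f_def
      by (intro continuous_intros holonomic_continuous_on_val solutionD(1) reflected solution)
    show "f y > 0" using ord y by (auto simp: f_def reflection_ordered_def less_le)
    have "fst y \<noteq> l" "snd y \<noteq> -1"
      using y(3) solutionD(4)[OF solution] by (auto simp: prod_eq_iff) (metis prod.collapse)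
    then show "y \<in> {..<l} \<times> {-1<..0}" using y(1,2) by (auto simp: strip_def mem_Times_iff)
  qed
  then show ?thesis by (simp add: f_def)
qed

lemma increment_ge_of_dq_ge:
  assumes core: "\<And>z. z \<in> cball a r \<Longrightarrow> snd z \<le> 0 \<Longrightarrow> \<eta> \<le> dq (J z)"
    and y: "y \<in> cball a (r / 2)" "snd y \<in> {-1..0}" and h: "0 < h" "h \<le> r / 2"
  shows "val (J y) + \<eta> * h \<le> val (J (fst y + h, snd y))"
proof -
  obtain x where x: "fst y < x" "x < fst y + h" "val (J (fst y + h, snd y)) - val (J y) = h * dq (J (x, snd y))"
    using MVT2[of "fst y" "fst y + h" "\<lambda>t. val (J (t, snd y))" "\<lambda>t. dq (J (t, snd y))"]
      holonomic_partials(1)[OF holonomic y(2)] h(1) by auto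
  have "dist y (x, snd y) \<le> r / 2" using x(1,2) h by (cases y) (simp add: dist_prod_def dist_real_def)
  then have "dist a (x, snd y) \<le> r" using y(1) dist_triangle[of a "(x, snd y)" y] by simp
  then have "h * \<eta> \<le> h * dq (J (x, snd y))" using core y(2) h(1) by simp
  then show ?thesis using x(3) by (subst mult.commute) linarith
qed

text \<open>As \<open>J\<close> has only two derivatives, \<open>dq\<close> satisfies no classical equation; the barrier is applied to the
  increments \<open>val (J (q + h, p)) - val (J (q, p))\<close>, with constants independent of \<open>h\<close>.\<close>

lemma dq_spreads_positivity:
  assumes mono: "\<And>q q' p. q \<le> q' \<Longrightarrow> q' \<le> l \<Longrightarrow> p \<in> {-1..0} \<Longrightarrow> val (J (q, p)) \<le> val (J (q', p))"
  shows "spreads_positivity \<tau> l (\<lambda>z. dq (J z))"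
  unfolding spreads_positivity_def
proof (intro allI ballI impI)
  fix a z :: "real \<times> real" and r R \<eta> :: real
  assume r: "0 < r" "r < R" and a: "snd a < 0" and sub: "cball a R \<subseteq> {..<l} \<times> {-1<..}"
    and top: "R\<^sup>2 \<le> (1 + \<tau>\<^sup>2) * (snd a)\<^sup>2" and \<eta>: "0 < \<eta>"
    and core: "\<forall>z\<in>cball a r. snd z \<le> 0 \<longrightarrow> \<eta> \<le> dq (J z)"
    and z: "z \<in> ball a R" "snd z \<le> 0"
  have "(fst a, snd a - R) \<in> cball a R" "(fst a + R, snd a) \<in> cball a R"
    using r by (simp_all add: dist_prod_def dist_real_def)
  then have aR: "-1 < snd a - R" "fst a + R < l" using sub by auto
  have in_strip: "snd y \<in> {-1..0}" if "y \<in> cball a R" "snd y \<le> 0" for y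
    using sub that by auto
  define h0 where "h0 = min (r / 2) (l - (fst a + R))"
  define K where "K = \<eta> * (exp (- barrier_rate (r / 2) * (dist z a)\<^sup>2) - exp (- barrier_rate (r / 2) * R\<^sup>2))"
  have "K * h \<le> val (J (fst z + h, snd z)) - val (J (fst z, snd z))" if h: "0 < h" "h \<le> h0" for h
  proof -
    have "\<eta> * h * (exp (- barrier_rate (r / 2) * (dist z a)\<^sup>2) - exp (- barrier_rate (r / 2) * R\<^sup>2))
        \<le> val (J (fst z + h, snd z)) - val (J z)"
    proof (rule barrier[OF solution_translate[OF solution] solution _ _ _ a aR(1) top])
      fix y assume y: "y \<in> cball a R" "snd y \<le> 0"
      have "fst y \<le> fst a + R" using y(1) dist_fst_le[of a y] by (auto simp: dist_real_def)
      then show "val (J y) \<le> val (J (fst y + h, snd y))"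
        using mono[of "fst y" "fst y + h" "snd y"] in_strip[OF y] h by (simp add: h0_def)
    next
      fix y assume y: "y \<in> cball a (r / 2)" "snd y \<le> 0"
      then show "val (J y) + \<eta> * h \<le> val (J (fst y + h, snd y))"
        using core in_strip[of y] r h by (intro increment_ge_of_dq_ge) (auto simp: h0_def)
    qed (use z r \<eta> h in \<open>auto simp: dist_commute\<close>)
    then show ?thesis by (simp add: K_def mult_ac)
  qed
  moreover have "h0 > 0" using r aR(2) by (simp add: h0_def)
  moreover have "snd z \<in> {-1..0}" using in_strip[of z] z by simp
  ultimately have "K \<le> dq (J (fst z, snd z))"
    by (intro derivative_ge_of_increments[OF holonomic_partials(1)[OF holonomic]])
  moreover have "(dist z a)\<^sup>2 < R\<^sup>2" using z r by (intro power_strict_mono) (auto simp: dist_commute)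
  then have "K > 0" using \<eta> r barrier_rate_pos[of "r / 2"] by (simp add: K_def)
  ultimately show "0 < dq (J z)" by simp
qed

lemma dq_positive_somewhere: "\<exists>q<l. dq (J (q, 0)) > 0"
proof -
  have "val (J (l - 1, 0)) > 0" using elevation[of "(l - 1, 0)"] by simp
  then obtain Q where Q: "\<And>z. z \<in> strip \<Longrightarrow> fst z \<le> Q \<Longrightarrow> norm (val (J z)) < val (J (l - 1, 0))"
    using vanishes_leftD[OF vanishes_left_val[OF vanishing]] by blast
  define q where "q = min Q (l - 2)"
  have "val (J (q, 0)) < val (J (l - 1, 0))" using Q[of "(q, 0)"] by (simp add: q_def)
  moreover have ql: "q < l - 1" by (simp add: q_def)
  then obtain x where "q < x" "x < l - 1" "val (J (l - 1, 0)) - val (J (q, 0)) = (l - 1 - q) * dq (J (x, 0))"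
    using MVT2[of q "l - 1" "\<lambda>t. val (J (t, 0))" "\<lambda>t. dq (J (t, 0))"]
      holonomic_partials(1)[OF holonomic, of 0]
    by auto
  ultimately have "0 < (l - 1 - q) * dq (J (x, 0))" "x < l" by linarith+
  then show ?thesis using ql by (auto simp: zero_less_mult_iff)
qed

lemma dq_positive:
  assumes "\<And>q q' p. q \<le> q' \<Longrightarrow> q' \<le> l \<Longrightarrow> p \<in> {-1..0} \<Longrightarrow> val (J (q, p)) \<le> val (J (q', p))"
    and z: "z \<in> {..<l} \<times> {-1<..0}"
  shows "dq (J z) > 0"
proof -
  obtain q where "q < l" "dq (J (q, 0)) > 0" using dq_positive_somewhere by blast
  then show ?thesis
    using positivity_propagates[OF \<tau>_pos dq_spreads_positivity _ _ _ z, of "(q, 0)"] assms(1)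
      solutionD(2)[OF solution]
    by (auto intro!: continuous_intros)
qed

lemma monotone_of_reflection_ordered:
  assumes ord: "\<And>l'. l' \<le> l \<Longrightarrow> reflection_ordered l'" and "q \<le> q'" "q' \<le> l" "p \<in> {-1..0}"
  shows "val (J (q, p)) \<le> val (J (q', p))"
proof -
  have "(q, p) \<in> strip" "fst (q, p) \<le> (q + q') / 2" using assms by auto
  then have "val (J (q, p)) \<le> val (J (2 * ((q + q') / 2) - fst (q, p), snd (q, p)))"
    using ord[of "(q + q') / 2"] assms(2,3) unfolding reflection_ordered_def by fastforce
  moreover have "2 * ((q + q') / 2) - fst (q, p) = q'" by (simp add: field_simps)
  ultimately show ?thesis by (simp only: snd_conv)
qed

lemma reflection_ordered_limit:
  assumes "\<And>l'. l' < l \<Longrightarrow> reflection_ordered l'"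
  shows "reflection_ordered l"
  unfolding reflection_ordered_def
proof (intro ballI impI)
  fix z :: "real \<times> real" assume z: "z \<in> strip" "fst z \<le> l"
  show "val (J z) \<le> val (J (2 * l - fst z, snd z))"
  proof (cases "fst z = l")
    case True
    then show ?thesis by (cases z) simp
  next
    case False
    have "isCont (\<lambda>q. val (J (q, snd z))) (2 * l - fst z)"
      using holonomic_partials(1)[OF holonomic] z by (auto simp: strip_def intro: DERIV_isCont)
    then have "((\<lambda>l'. val (J (2 * l' - fst z, snd z))) \<longlongrightarrow> val (J (2 * l - fst z, snd z))) (at_left l)"
      by (rule isCont_tendsto_compose) (intro tendsto_intros)
    moreover have "\<forall>\<^sub>F l' in at_left l. l' \<in> {fst z<..<l}"
      using False z(2) by (intro eventually_at_left_real) simp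
    then have "\<forall>\<^sub>F l' in at_left l. val (J z) \<le> val (J (2 * l' - fst z, snd z))"
    proof eventually_elim
      case (elim l')
      then show ?case using assms[of l'] z(1) by (simp add: reflection_ordered_def)
    qed
    ultimately show ?thesis by (rule tendsto_lowerbound) simp
  qed
qed

lemma symmetric_of_maximal:
  assumes ord: "reflection_ordered l" and max: "\<And>d. d > 0 \<Longrightarrow> \<exists>l'\<in>{l..l + d}. \<not> reflection_ordered l'"
    and z: "z \<in> strip"
  shows "val (J (2 * l - fst z, snd z)) = val (J z)"
proof -
  have left: "val (J y) = val (J (2 * l - fst y, snd y))" if "y \<in> strip" "fst y \<le> l" for y
  proof (rule ccontr)
    assume "val (J y) \<noteq> val (J (2 * l - fst y, snd y))"
    from reflection_strict[OF ord that this] show False using planes_step[of l] max by metis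
  qed
  show ?thesis
  proof (cases "fst z \<le> l")
    case True
    then show ?thesis using left[OF z] by simp
  next
    case False
    then show ?thesis using left[of "(2 * l - fst z, snd z)"] z by (simp add: strip_def)
  qed
qed

lemma moving_planes:
  "(\<forall>p\<in>{-1..0}. mono (\<lambda>q. val (J (q, p)))) \<or>
   (\<exists>l. (\<forall>z\<in>strip. val (J (2 * l - fst z, snd z)) = val (J z)) \<and>
     (\<forall>z\<in>{..<l} \<times> {-1<..0}. dq (J z) > 0))"
proof -
  define L where "L = {l. \<forall>l'\<le>l. reflection_ordered l'}"
  have L: "L \<noteq> {}" using planes_start by (auto simp: L_def)
  have mono: "val (J (q, p)) \<le> val (J (q', p))" if "l \<in> L" "q \<le> q'" "q' \<le> l" "p \<in> {-1..0}" for l q q' p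
    using that monotone_of_reflection_ordered[of l q q' p] by (simp add: L_def)
  show ?thesis
  proof (cases "bdd_above L")
    case False
    have "\<exists>l\<in>L. q < l" for q using False by (auto simp: bdd_above_def not_le)
    then show ?thesis using mono by (auto intro!: monoI) (meson less_imp_le)
  next
    case True
    define l where "l = Sup L"
    have "reflection_ordered l'" if "l' < l" for l'
      using less_cSupD[OF L] that by (force simp: l_def L_def)
    then have ord: "reflection_ordered l'" if "l' \<le> l" for l'
      using reflection_ordered_limit that by (cases "l' = l") auto
    have "\<exists>l'\<in>{l..l + d}. \<not> reflection_ordered l'" if "d > 0" for d
    proof (rule ccontr)
      assume "\<not> ?thesis"
      then have "reflection_ordered l'" if "l' \<le> l + d" for l'
        using ord[of l'] that by (cases "l' \<le> l") auto
      then have "l + d \<in> L" by (simp add: L_def)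
      then show False using cSup_upper[OF _ True] \<open>d > 0\<close> by (fastforce simp: l_def)
    qed
    then have "\<forall>z\<in>strip. val (J (2 * l - fst z, snd z)) = val (J z)"
      using symmetric_of_maximal[OF ord[OF order_refl]] by blast
    moreover have "\<forall>z\<in>{..<l} \<times> {-1<..0}. dq (J z) > 0"
      using dq_positive monotone_of_reflection_ordered[OF ord] by blast
    ultimately show ?thesis by blast
  qed
qed

end

section \<open>Limits of functions and of their derivatives\<close>

lemma derivative_interpolation:
  fixes g g' g'' :: "real \<Rightarrow> real"
  assumes ab: "a < b" "p \<in> {a..b}"
    and g: "\<And>x. x \<in> {a..b} \<Longrightarrow> (g has_real_derivative g' x) (at x within {a..b})"
    and g': "\<And>x. x \<in> {a..b} \<Longrightarrow> (g' has_real_derivative g'' x) (at x within {a..b})"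
    and K: "\<And>x. x \<in> {a..b} \<Longrightarrow> \<bar>g'' x\<bar> \<le> K"
  shows "\<bar>g' p\<bar> \<le> \<bar>g b - g a\<bar> / (b - a) + K * (b - a)"
proof -
  have "(g has_real_derivative g' x) (at x)" if "x \<in> {a<..<b}" for x
    using g[of x] that at_within_Icc_at[of a x b] by simp
  moreover have "continuous_on {a..b} g" using g by (rule DERIV_continuous_on)
  ultimately obtain \<xi> where \<xi>: "\<xi> \<in> {a<..<b}" "g b - g a = (b - a) * g' \<xi>"
    using MVT[of a b g] ab
    by (metis (no_types, lifting) DERIV_unique greaterThanLessThan_iff real_differentiable_def)
  have "\<bar>g' p - g' \<xi>\<bar> \<le> K * \<bar>p - \<xi>\<bar>"
    using field_differentiable_bound[of "{a..b}" g' g'' K p \<xi>] g' K ab \<xi> by auto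
  also have "\<dots> \<le> K * (b - a)"
    using ab \<xi> K[of p] by (intro mult_left_mono) auto
  finally have "\<bar>g' p\<bar> \<le> \<bar>g' \<xi>\<bar> + K * (b - a)" by linarith
  also have "\<bar>g' \<xi>\<bar> = \<bar>g b - g a\<bar> / (b - a)" using \<xi>(2) ab by (simp add: abs_mult)
  finally show ?thesis .
qed

lemma derivative_convergent:
  fixes f f' f'' :: "'i \<Rightarrow> real \<Rightarrow> real"
  assumes ab: "a < b" "p \<in> {a..b}"
    and f: "\<And>i x. x \<in> {a..b} \<Longrightarrow> (f i has_real_derivative f' i x) (at x within {a..b})"
    and f': "\<And>i x. x \<in> {a..b} \<Longrightarrow> (f' i has_real_derivative f'' i x) (at x within {a..b})"
    and K: "\<And>i x. x \<in> {a..b} \<Longrightarrow> \<bar>f'' i x\<bar> \<le> K"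
    and lim: "\<And>x. x \<in> {a..b} \<Longrightarrow> \<exists>l. ((\<lambda>i. f i x) \<longlongrightarrow> l) F"
  shows "\<exists>l. ((\<lambda>i. f' i p) \<longlongrightarrow> l) F"
proof -
  have "cauchy_filter (filtermap (\<lambda>i. f' i p) F)"
    unfolding cauchy_filter_metric_filtermap
  proof (intro allI impI)
    fix e :: real assume e: "e > 0"
    have "K \<ge> 0" using K[of p undefined] ab(2) by auto
    define t where "t = min (b - a) (e / (4 * (2 * K + 1)))"
    have "t \<le> e / (4 * (2 * K + 1))" by (simp add: t_def)
    then have "t * (4 * (2 * K + 1)) \<le> e" using \<open>K \<ge> 0\<close> by (subst (asm) pos_le_divide_eq) auto
    moreover have "t > 0" "t \<le> b - a" using ab e \<open>K \<ge> 0\<close> by (auto simp: t_def)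
    ultimately have t: "t > 0" "t \<le> b - a" "2 * K * t \<le> e / 4" by (auto simp: algebra_simps)
    define s where "s = min p (b - t)"
    have s: "{s..s + t} \<subseteq> {a..b}" "p \<in> {s..s + t}" "s \<in> {a..b}" "s + t \<in> {a..b}"
      using ab t by (auto simp: s_def)
    obtain k l where kl: "((\<lambda>i. f i s) \<longlongrightarrow> k) F" "((\<lambda>i. f i (s + t)) \<longlongrightarrow> l) F" using lim s by blast
    let ?P = "\<lambda>i. dist (f i s) k < e * t / 8 \<and> dist (f i (s + t)) l < e * t / 8"
    have "eventually ?P F" using e t(1) by (intro eventually_conj tendstoD kl) simp_all
    moreover have "dist (f' i p) (f' j p) < e" if "?P i" "?P j" for i j
    proof -
      have "\<bar>f' i p - f' j p\<bar>
          \<le> \<bar>(f i (s + t) - f j (s + t)) - (f i s - f j s)\<bar> / (s + t - s) + 2 * K * (s + t - s)"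
      proof (rule derivative_interpolation[where g = "\<lambda>x. f i x - f j x" and g' = "\<lambda>x. f' i x - f' j x"
            and g'' = "\<lambda>x. f'' i x - f'' j x"])
        fix x assume "x \<in> {s..s + t}"
        then have x: "x \<in> {a..b}" using s(1) by blast
        show "((\<lambda>x. f i x - f j x) has_real_derivative f' i x - f' j x) (at x within {s..s + t})"
          "((\<lambda>x. f' i x - f' j x) has_real_derivative f'' i x - f'' j x) (at x within {s..s + t})"
          by (intro DERIV_diff DERIV_subset[OF f[OF x] s(1)] DERIV_subset[OF f'[OF x] s(1)])+
        show "\<bar>f'' i x - f'' j x\<bar> \<le> 2 * K" using K[OF x, of i] K[OF x, of j] by linarith
      qed (use t s in auto)
      moreover have "\<bar>(f i (s + t) - f j (s + t)) - (f i s - f j s)\<bar> < e / 2 * t"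
        using that unfolding dist_real_def by linarith
      then have "\<bar>(f i (s + t) - f j (s + t)) - (f i s - f j s)\<bar> / (s + t - s) < e / 2"
        using t(1) by (simp add: pos_divide_less_eq)
      ultimately show ?thesis using t(3) e by (simp add: dist_real_def)
    qed
    ultimately show "\<exists>P. eventually P F \<and> (\<forall>i j. P i \<and> P j \<longrightarrow> dist (f' i p) (f' j p) < e)"
      by (intro exI[of _ ?P]) simp
  qed
  then have "convergent_filter (filtermap (\<lambda>i. f' i p) F)" by (rule cauchy_filter_convergent)
  then show ?thesis by (simp add: convergent_filter_iff filterlim_def)
qed

lemma tendsto_derivative_zero:
  fixes f f' :: "real \<Rightarrow> real"
  assumes d: "\<And>q. (f has_real_derivative f' q) (at q)" and "(f \<longlongrightarrow> k) at_top" "(f' \<longlongrightarrow> l) at_top"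
  shows "l = 0"
proof -
  have shift: "filterlim g at_top at_top" if "\<And>q. q \<le> g q" for g :: "real \<Rightarrow> real"
    by (rule filterlim_at_top_mono[OF filterlim_ident]) (simp add: that)
  have "\<exists>\<xi>. q < \<xi> \<and> f (q + 1) - f q = f' \<xi>" for q
    using MVT2[of q "q + 1" f f'] d by auto
  then obtain \<xi> where \<xi>: "\<And>q. q < \<xi> q" "\<And>q. f (q + 1) - f q = f' (\<xi> q)" by metis
  have "((\<lambda>q. f (q + 1) - f q) \<longlongrightarrow> l) at_top"
    unfolding \<xi>(2) using filterlim_compose[OF assms(3) shift, of \<xi>] \<xi>(1) less_imp_le by blast
  moreover have "((\<lambda>q. f (q + 1) - f q) \<longlongrightarrow> k - k) at_top"
    using filterlim_compose[OF assms(2) shift, of "\<lambda>q. q + 1"] by (intro tendsto_diff assms(2)) simp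
  ultimately show ?thesis using tendsto_unique[OF trivial_limit_at_top_linorder] by fastforce
qed

lemma mono_bounded_tendsto_Sup:
  fixes f :: "real \<Rightarrow> real"
  assumes "mono f" "\<And>q. f q \<le> C"
  shows "(f \<longlongrightarrow> Sup (range f)) at_top"
proof (rule increasing_tendsto)
  have "bdd_above (range f)" using assms(2) by (intro bdd_aboveI[of _ C]) auto
  then show "\<forall>\<^sub>F q in at_top. f q \<le> Sup (range f)" by (simp add: cSUP_upper)
  fix x assume "x < Sup (range f)"
  then obtain Q where "x < f Q" using less_cSupD[of "range f" x] by auto
  then have "x < f q" if "Q \<le> q" for q using monoD[OF assms(1) that] by linarith
  then show "\<forall>\<^sub>F q in at_top. x < f q" unfolding eventually_at_top_linorder by blast
qed

section \<open>Divergence form and flow force\<close>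

context height_problem
begin

definition flux :: "real \<Rightarrow> jet \<Rightarrow> real" where
  "flux p j = 1 / (2 * (Hp p)\<^sup>2) - (1 + (dq j)\<^sup>2) / (2 * (Hp p + dp j)\<^sup>2)"

definition slope :: "real \<Rightarrow> jet \<Rightarrow> real" where
  "slope p j = dq j / (Hp p + dp j)"

definition flux_p :: "real \<Rightarrow> jet \<Rightarrow> real" where
  "flux_p p j = - (Hpp p / Hp p ^ 3)
     - (dq j * dqp j / (Hp p + dp j)\<^sup>2 - (1 + (dq j)\<^sup>2) * (Hpp p + dpp j) / (Hp p + dp j) ^ 3)"

definition slope_q :: "real \<Rightarrow> jet \<Rightarrow> real" where
  "slope_q p j = dqq j / (Hp p + dp j) - dq j * dqp j / (Hp p + dp j)\<^sup>2"

definition work_density :: "real \<Rightarrow> jet \<Rightarrow> real" where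
  "work_density p j = dq j * slope p j + dp j * flux p j + \<mu> * \<rho>p p * (val j)\<^sup>2"

definition force_density :: "real \<Rightarrow> jet \<Rightarrow> real" where
  "force_density p j = (1 - (dq j)\<^sup>2) / (2 * (Hp p + dp j)) + dp j / (2 * (Hp p)\<^sup>2) + \<mu> * \<rho>p p * (val j)\<^sup>2 / 2"

definition flow_force :: "(real \<times> real \<Rightarrow> jet) \<Rightarrow> real \<Rightarrow> real" where
  "flow_force U q = integral {-1..0} (\<lambda>p. force_density p (U (q, p))) - \<mu> * \<rho>0 * (val (U (q, 0)))\<^sup>2 / 2"

lemma interior_op_divergence:
  assumes "Hp p + dp j \<noteq> 0"
  shows "interior_op p j = (Hp p + dp j) ^ 3 * (flux_p p j + slope_q p j - \<mu> * \<rho>p p * val j)"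
proof -
  define x r where "x = Hp p + dp j" and "r = Hpp p / Hp p ^ 3"
  have "x \<noteq> 0" using assms by (simp add: x_def)
  then show ?thesis
    unfolding interior_op_def flux_p_def slope_q_def x_def[symmetric] r_def[symmetric]
    by (simp add: field_simps power2_eq_square power3_eq_cube)
qed

lemma flux_derivative:
  assumes "holonomic U" and p: "p \<in> {-1..0}" and x: "Hp p + dp (U (q, p)) \<noteq> 0"
  shows "((\<lambda>p. flux p (U (q, p))) has_real_derivative flux_p p (U (q, p))) (at p within {-1..0})"
proof -
  note d = holonomic_partials(5,6)[OF assms(1) p]
  have "((\<lambda>p. 1 / (2 * (Hp p)\<^sup>2)) has_real_derivative - (Hpp p / Hp p ^ 3)) (at p within {-1..0})"
    using has_real_derivative_flux[OF DERIV_const Hp_deriv[OF p], of 0] Hp_pos[OF p] by simp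
  from DERIV_diff[OF this has_real_derivative_flux[OF d(1) DERIV_add[OF Hp_deriv[OF p] d(2)] x]]
  show ?thesis unfolding flux_def flux_p_def .
qed

lemma slope_derivative:
  assumes "holonomic U" and p: "p \<in> {-1..0}" and x: "Hp p + dp (U (q, p)) \<noteq> 0"
  shows "((\<lambda>q. slope p (U (q, p))) has_real_derivative slope_q p (U (q, p))) (at q)"
  using DERIV_divide[OF holonomic_partials(2)[OF assms(1) p]
      DERIV_add[OF DERIV_const holonomic_partials(3)[OF assms(1) p]] x] x
  unfolding slope_def slope_q_def by (simp add: diff_divide_distrib power2_eq_square)

context
  fixes U :: "real \<times> real \<Rightarrow> jet"
  assumes U: "solution U"
begin

lemma height_pos: "z \<in> strip \<Longrightarrow> Hp (snd z) + dp (U z) > 0"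
  using solutionD(6)[OF U] c_pos less_le_trans by blast

lemma solution_divergence_form:
  assumes p: "p \<in> {-1..0}"
  shows "slope_q p (U (q, p)) = \<mu> * \<rho>p p * val (U (q, p)) - flux_p p (U (q, p))"
  using interior_op_divergence[of p "U (q, p)"] solution_interior_op[OF U p, of q] height_pos[of "(q, p)"] p
  by simp

lemma solution_flux_top: "flux 0 (U (q, 0)) = \<mu> * \<rho>0 * val (U (q, 0))"
  using solutionD(3)[OF U, of q] by (simp add: top_op_def flux_def)

lemma solution_bottom: "val (U (q, -1)) = 0" "dq (U (q, -1)) = 0"
proof -
  show "val (U (q, -1)) = 0" for q by (rule solutionD(4)[OF U])
  then have "((\<lambda>t. val (U (t, -1))) has_real_derivative 0) (at q)" by simp
  then show "dq (U (q, -1)) = 0"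
    using holonomic_partials(1)[OF solutionD(1)[OF U], of "-1" q] DERIV_unique by fastforce
qed

lemma solution_derivatives:
  assumes p: "p \<in> {-1..0}"
  shows "((\<lambda>p. flux p (U (q, p))) has_real_derivative flux_p p (U (q, p))) (at p within {-1..0})"
    "((\<lambda>q. slope p (U (q, p))) has_real_derivative slope_q p (U (q, p))) (at q)"
proof -
  have "Hp p + dp (U (q, p)) \<noteq> 0" using height_pos[of "(q, p)"] p by simp
  from flux_derivative[OF solutionD(1)[OF U] p this] slope_derivative[OF solutionD(1)[OF U] p this]
  show "((\<lambda>p. flux p (U (q, p))) has_real_derivative flux_p p (U (q, p))) (at p within {-1..0})"
    "((\<lambda>q. slope p (U (q, p))) has_real_derivative slope_q p (U (q, p))) (at q)" .
qed

lemma continuous_on_strip_coefficients: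
  "continuous_on strip (\<lambda>z. Hp (snd z))" "continuous_on strip (\<lambda>z. Hpp (snd z))"
  "continuous_on strip (\<lambda>z. \<rho>p (snd z))"
  by (intro continuous_on_coefficient continuous_intros; simp add: strip_def)+

lemma continuous_on_strip_fluxes:
  "continuous_on strip (\<lambda>z. flux (snd z) (U z))" "continuous_on strip (\<lambda>z. slope (snd z) (U z))"
  "continuous_on strip (\<lambda>z. flux_p (snd z) (U z))" "continuous_on strip (\<lambda>z. slope_q (snd z) (U z))"
proof -
  have "Hp (snd z) + dp (U z) \<noteq> 0" "Hp (snd z) \<noteq> 0" if "z \<in> strip" for z
    using height_pos[OF that] Hp_pos[of "snd z"] that by (auto simp: strip_def)
  then show "continuous_on strip (\<lambda>z. flux (snd z) (U z))" "continuous_on strip (\<lambda>z. slope (snd z) (U z))"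
    "continuous_on strip (\<lambda>z. flux_p (snd z) (U z))" "continuous_on strip (\<lambda>z. slope_q (snd z) (U z))"
    unfolding flux_def slope_def flux_p_def slope_q_def
    by (auto intro!: continuous_intros continuous_on_strip_coefficients solutionD(2)[OF U])
qed

lemma slope_integral_derivative:
  assumes p: "p \<in> {-1..0}"
  shows "((\<lambda>q. integral {p..0} (\<lambda>t. slope t (U (q, t)))) has_real_derivative
    flux p (U (q, p)) - \<mu> * \<rho>0 * val (U (q, 0)) + integral {p..0} (\<lambda>t. \<mu> * \<rho>p t * val (U (q, t)))) (at q)"
proof -
  have sub: "{p..0} \<subseteq> {-1..0}" using p by auto
  note slice = continuous_on_strip_slice[OF _ sub, of _ q]
  have "((\<lambda>q. integral {p..0} (\<lambda>t. slope t (U (q, t)))) has_real_derivative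
      integral {p..0} (\<lambda>t. slope_q t (U (q, t)))) (at q)"
    using strip_leibniz[OF _ continuous_on_strip_fluxes(2,4) sub, of q] solution_derivatives(2) sub by auto
  moreover have "integral {p..0} (\<lambda>t. slope_q t (U (q, t)))
      = integral {p..0} (\<lambda>t. \<mu> * \<rho>p t * val (U (q, t)) - flux_p t (U (q, t)))"
    using sub by (intro integral_cong solution_divergence_form) auto
  moreover have "\<dots> = integral {p..0} (\<lambda>t. \<mu> * \<rho>p t * val (U (q, t))) - integral {p..0} (\<lambda>t. flux_p t (U (q, t)))"
    using slice[OF continuous_on_strip_fluxes(3)]
      slice[OF holonomic_continuous_on_val[OF solutionD(1)[OF U]]]
    by (intro integral_diff integrable_continuous_real)
      (auto intro!: continuous_intros continuous_on_subset[OF \<rho>p_cont sub])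
  moreover have "integral {p..0} (\<lambda>t. flux_p t (U (q, t))) = flux 0 (U (q, 0)) - flux p (U (q, p))"
    using p sub
    by (intro integral_unique has_integral_derivative_Icc[OF _ sub] solution_derivatives(1)) auto
  ultimately have "((\<lambda>q. integral {p..0} (\<lambda>t. slope t (U (q, t)))) has_real_derivative
      integral {p..0} (\<lambda>t. slope_q t (U (q, t)))) (at q)"
    "integral {p..0} (\<lambda>t. slope_q t (U (q, t)))
      = flux p (U (q, p)) - \<mu> * \<rho>0 * val (U (q, 0)) + integral {p..0} (\<lambda>t. \<mu> * \<rho>p t * val (U (q, t)))"
    using solution_flux_top[of q] by linarith+
  then show ?thesis by (simp only:)
qed

lemma continuous_on_work_density: "continuous_on strip (\<lambda>z. work_density (snd z) (U z))"
  unfolding work_density_def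
  by (intro continuous_intros continuous_on_strip_fluxes solutionD(2)[OF U]
    continuous_on_strip_coefficients)

lemma work_integral_derivative:
  "((\<lambda>q. integral {-1..0} (\<lambda>p. val (U (q, p)) * slope p (U (q, p)))) has_real_derivative
    integral {-1..0} (\<lambda>p. work_density p (U (q, p))) - \<mu> * \<rho>0 * (val (U (q, 0)))\<^sup>2) (at q)"
proof -
  note partials = holonomic_partials[OF solutionD(1)[OF U]]
  let ?f = "\<lambda>z. val (U z) * slope (snd z) (U z)"
  let ?fq = "\<lambda>z. dq (U z) * slope (snd z) (U z) + val (U z) * slope_q (snd z) (U z)"
  let ?g = "\<lambda>z. dp (U z) * flux (snd z) (U z) + val (U z) * flux_p (snd z) (U z)"
  have cont: "continuous_on strip ?f" "continuous_on strip ?fq" "continuous_on strip ?g"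
    by (intro continuous_intros continuous_on_strip_fluxes solutionD(2)[OF U])+
  have "((\<lambda>t. ?f (t, p)) has_real_derivative ?fq (q, p)) (at q)" if "p \<in> {-1..0}" for q p
    using DERIV_mult[OF partials(1)[OF that] solution_derivatives(2)[OF that]] by (simp add: mult.commute)
  then have "((\<lambda>q. integral {-1..0} (\<lambda>p. ?f (q, p))) has_real_derivative
      integral {-1..0} (\<lambda>p. ?fq (q, p))) (at q)"
    by (rule strip_leibniz[OF _ cont(1,2) order_refl])
  moreover have "integral {-1..0} (\<lambda>p. ?fq (q, p)) = integral {-1..0} (\<lambda>p. work_density p (U (q, p)) - ?g (q, p))"
    by (intro integral_cong)
      (simp add: solution_divergence_form work_density_def algebra_simps power2_eq_square)
  moreover have "\<dots> = integral {-1..0} (\<lambda>p. work_density p (U (q, p))) - integral {-1..0} (\<lambda>p. ?g (q, p))"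
    using continuous_on_strip_slice[OF continuous_on_work_density] continuous_on_strip_slice[OF cont(3)]
    by (intro integral_diff integrable_continuous_real) simp_all
  moreover have "((\<lambda>t. val (U (q, t)) * flux t (U (q, t))) has_real_derivative ?g (q, p)) (at p within {-1..0})"
    if "p \<in> {-1..0}" for p
    using DERIV_mult[OF partials(4)[OF that] solution_derivatives(1)[OF that]] by (simp add: mult.commute)
  then have "integral {-1..0} (\<lambda>p. ?g (q, p))
      = val (U (q, 0)) * flux 0 (U (q, 0)) - val (U (q, -1)) * flux (-1) (U (q, -1))"
    by (intro integral_unique has_integral_derivative_Icc) auto
  ultimately show ?thesis by (simp add: solution_flux_top solution_bottom power2_eq_square mult_ac)
qed

lemma force_density_derivative:
  assumes p: "p \<in> {-1..0}"
  shows "((\<lambda>q. force_density p (U (q, p))) has_real_derivative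
    dqp (U (q, p)) * flux p (U (q, p)) + dq (U (q, p)) * flux_p p (U (q, p))) (at q)"
proof -
  note partials = holonomic_partials[OF solutionD(1)[OF U] p]
  define x y m s where "x = Hp p + dp (U (q, p))" and "y = dq (U (q, p))" and "m = dqp (U (q, p))"
    and "s = \<mu> * \<rho>p p * val (U (q, p))"
  have x: "x \<noteq> 0" using height_pos[of "(q, p)"] p by (simp add: x_def)
  have quotient: "((\<lambda>t. (1 - (g t)\<^sup>2) / (2 * f t)) has_real_derivative
      - (g q * g') / f q - (1 - (g q)\<^sup>2) * f' / (2 * (f q)\<^sup>2)) (at q)"
    if "(g has_real_derivative g') (at q)" "(f has_real_derivative f') (at q)" "f q \<noteq> 0" for f g f' g'
    by (rule derivative_eq_intros that(1,2) refl | simp add: that(3))+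
      (use that(3) in \<open>simp add: field_simps power2_eq_square\<close>)
  have "((\<lambda>q. (1 - (dq (U (q, p)))\<^sup>2) / (2 * (Hp p + dp (U (q, p))))) has_real_derivative
      - (y * dqq (U (q, p))) / x - (1 - y\<^sup>2) * m / (2 * x\<^sup>2)) (at q)"
    using quotient[OF partials(2) DERIV_add[OF DERIV_const partials(3)] x[unfolded x_def]]
    by (simp add: x_def y_def m_def)
  moreover have "((\<lambda>q. dp (U (q, p)) / (2 * (Hp p)\<^sup>2)) has_real_derivative m / (2 * (Hp p)\<^sup>2)) (at q)"
    unfolding m_def by (rule DERIV_cdivide[OF partials(3)])
  moreover have "((\<lambda>q. \<mu> * \<rho>p p * (val (U (q, p)))\<^sup>2 / 2) has_real_derivative s * y) (at q)"
    unfolding s_def y_def by (rule derivative_eq_intros partials(1) refl | simp)+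
  ultimately have "((\<lambda>q. force_density p (U (q, p))) has_real_derivative
      - (y * dqq (U (q, p))) / x - (1 - y\<^sup>2) * m / (2 * x\<^sup>2) + m / (2 * (Hp p)\<^sup>2) + s * y) (at q)"
    unfolding force_density_def by (intro DERIV_add)
  moreover have "- (y * a) / x - (1 - y\<^sup>2) * m / (2 * x\<^sup>2) + m / k + s * y
      = m * (1 / k - (1 + y\<^sup>2) / (2 * x\<^sup>2)) + y * (s - (a / x - y * m / x\<^sup>2))" for a k
    using x by (simp add: field_simps power2_eq_square)
  moreover have "flux_p p (U (q, p)) = s - slope_q p (U (q, p))"
    using solution_divergence_form[OF p, of q] by (simp add: s_def)
  ultimately show ?thesis by (simp add: flux_def slope_q_def x_def y_def m_def)
qed

lemma flow_force_constant: "flow_force U q = flow_force U q'"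
proof -
  note partials = holonomic_partials[OF solutionD(1)[OF U]]
  let ?g = "\<lambda>z. dqp (U z) * flux (snd z) (U z) + dq (U z) * flux_p (snd z) (U z)"
  have "2 * (Hp (snd z) + dp (U z)) \<noteq> 0" "Hp (snd z) \<noteq> 0" if "z \<in> strip" for z
    using height_pos[OF that] Hp_pos[of "snd z"] that by (auto simp: strip_def)
  then have cont: "continuous_on strip (\<lambda>z. force_density (snd z) (U z))" "continuous_on strip ?g"
    unfolding force_density_def
    by (auto intro!: continuous_intros continuous_on_strip_coefficients continuous_on_strip_fluxes
      solutionD(2)[OF U])
  have "(flow_force U has_real_derivative 0) (at q)" for q
  proof -
    have "((\<lambda>q. integral {-1..0} (\<lambda>p. force_density p (U (q, p)))) has_real_derivative
        integral {-1..0} (\<lambda>p. ?g (q, p))) (at q)"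
      using strip_leibniz[OF _ cont order_refl, of q] force_density_derivative by auto
    moreover have "((\<lambda>t. dq (U (q, t)) * flux t (U (q, t))) has_real_derivative ?g (q, p)) (at p within {-1..0})"
      if "p \<in> {-1..0}" for p
      using DERIV_mult[OF partials(5)[OF that] solution_derivatives(1)[OF that]] by (simp add: mult.commute)
    then have "integral {-1..0} (\<lambda>p. ?g (q, p))
        = dq (U (q, 0)) * flux 0 (U (q, 0)) - dq (U (q, -1)) * flux (-1) (U (q, -1))"
      by (intro integral_unique has_integral_derivative_Icc) auto
    moreover have "((\<lambda>q. \<mu> * \<rho>0 * (val (U (q, 0)))\<^sup>2 / 2) has_real_derivative
        dq (U (q, 0)) * (\<mu> * \<rho>0 * val (U (q, 0)))) (at q)"
      by (rule derivative_eq_intros partials(1) refl | simp)+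
    ultimately show ?thesis
      unfolding flow_force_def[abs_def] using DERIV_diff
      by (fastforce simp: solution_flux_top solution_bottom)
  qed
  then show ?thesis using DERIV_isconst_all by blast
qed

end

end

section \<open>Conjugate flows\<close>

definition first_order :: "jet \<Rightarrow> jet" where
  "first_order j = (val j, (dq j, dp j), (0, 0, 0))"

lemma first_order_entries [simp]:
  "val (first_order j) = val j" "dq (first_order j) = dq j" "dp (first_order j) = dp j"
  by (simp_all add: first_order_def)

lemma norm_first_order_le: "norm (first_order j) \<le> norm j"
proof -
  have "j = (val j, (dq j, dp j), (dqq j, dqp j, dpp j))" by (simp add: jet_entry_defs)
  then have "norm j = norm (val j, (dq j, dp j), (dqq j, dqp j, dpp j))" by (rule arg_cong)
  then show ?thesis by (simp add: first_order_def norm_prod_def)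
qed

context height_problem
begin

definition admissible :: "(real \<times> jet) set" where
  "admissible = {x \<in> {-1..0} \<times> cball 0 M. c \<le> Hp (fst x) + dp (snd x)}"

lemma compact_admissible: "compact admissible"
proof -
  let ?S = "{-1..0 :: real} \<times> cball (0 :: jet) M"
  have S: "compact ?S" by (intro compact_Times compact_Icc compact_cball)
  have "continuous_on ?S (\<lambda>x. Hp (fst x) + dp (snd x))"
    by (intro continuous_intros continuous_on_coefficient) auto
  then have "closed (?S \<inter> (\<lambda>x. Hp (fst x) + dp (snd x)) -` {c..})"
    using compact_imp_closed[OF S] by (rule continuous_closed_preimage) simp
  then have "compact (?S \<inter> (?S \<inter> (\<lambda>x. Hp (fst x) + dp (snd x)) -` {c..}))"
    by (rule compact_Int_closed[OF S])
  moreover have "?S \<inter> (?S \<inter> (\<lambda>x. Hp (fst x) + dp (snd x)) -` {c..}) = admissible"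
    by (auto simp: admissible_def)
  ultimately show ?thesis by simp
qed

lemma admissibleD:
  assumes "(p, j) \<in> admissible"
  shows "Hp p > 0" "Hp p + dp j > 0"
  using assms Hp_pos c_pos by (auto simp: admissible_def)

lemma solution_admissible: "solution U \<Longrightarrow> p \<in> {-1..0} \<Longrightarrow> (p, first_order (U (q, p))) \<in> admissible"
  using solutionD(5,6)[of U "(q, p)"] norm_first_order_le[of "U (q, p)"] by (simp add: admissible_def)

lemma continuous_on_admissible_coefficients:
  "continuous_on admissible (\<lambda>x. Hp (fst x))" "continuous_on admissible (\<lambda>x. \<rho>p (fst x))"
  by (intro continuous_on_coefficient continuous_intros; simp add: admissible_def mem_Times_iff)+

lemma continuous_on_admissible:
  "continuous_on admissible (\<lambda>x. flux (fst x) (snd x))" "continuous_on admissible (\<lambda>x. slope (fst x) (snd x))"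
  "continuous_on admissible (\<lambda>x. work_density (fst x) (snd x))"
  "continuous_on admissible (\<lambda>x. force_density (fst x) (snd x))"
proof -
  have "Hp (fst x) \<noteq> 0" "Hp (fst x) + dp (snd x) \<noteq> 0" "2 * (Hp (fst x) + dp (snd x)) \<noteq> 0"
    if "x \<in> admissible" for x
    using admissibleD[of "fst x" "snd x"] that by auto
  then show "continuous_on admissible (\<lambda>x. flux (fst x) (snd x))"
    "continuous_on admissible (\<lambda>x. slope (fst x) (snd x))"
    "continuous_on admissible (\<lambda>x. work_density (fst x) (snd x))"
    "continuous_on admissible (\<lambda>x. force_density (fst x) (snd x))"
    unfolding work_density_def force_density_def flux_def slope_def
    by (auto intro!: continuous_intros continuous_on_admissible_coefficients)
qed

lemma first_order_densities [simp]:
  "flux p (first_order j) = flux p j" "slope p (first_order j) = slope p j"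
  "work_density p (first_order j) = work_density p j" "force_density p (first_order j) = force_density p j"
  by (simp_all add: flux_def slope_def work_density_def force_density_def)

lemma integral_along_solution_LIMSEQ:
  fixes X :: "nat \<Rightarrow> real" and \<Psi> :: "real \<Rightarrow> jet \<Rightarrow> real"
  assumes U: "solution U" and \<Psi>: "continuous_on admissible (\<lambda>x. \<Psi> (fst x) (snd x))"
    and lim: "\<And>p. p \<in> {-1..0} \<Longrightarrow> (\<lambda>n. first_order (U (X n, p))) \<longlonglongrightarrow> K p" and sub: "{a..b} \<subseteq> {-1..0}"
  shows "\<And>p. p \<in> {-1..0} \<Longrightarrow> (\<lambda>n. \<Psi> p (first_order (U (X n, p)))) \<longlonglongrightarrow> \<Psi> p (K p)"
    "(\<lambda>p. \<Psi> p (K p)) integrable_on {a..b}"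
    "(\<lambda>n. integral {a..b} (\<lambda>p. \<Psi> p (first_order (U (X n, p))))) \<longlonglongrightarrow> integral {a..b} (\<lambda>p. \<Psi> p (K p))"
proof -
  obtain B where B: "\<And>x. x \<in> admissible \<Longrightarrow> \<bar>\<Psi> (fst x) (snd x)\<bar> \<le> B"
    using compact_imp_bounded[OF compact_continuous_image[OF \<Psi> compact_admissible]]
    by (auto simp: bounded_iff)
  show point: "(\<lambda>n. \<Psi> p (first_order (U (X n, p)))) \<longlonglongrightarrow> \<Psi> p (K p)" if p: "p \<in> {-1..0}" for p
  proof -
    have pair: "(\<lambda>n. (p, first_order (U (X n, p)))) \<longlonglongrightarrow> (p, K p)"
      using p by (intro tendsto_intros lim)
    have "(p, K p) \<in> admissible"
      using closed_sequentially[OF compact_imp_closed[OF compact_admissible] _ pair]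
        solution_admissible[OF U p] by blast
    from continuous_on_tendsto_compose[OF \<Psi> pair this] show ?thesis
      using solution_admissible[OF U p] by simp
  qed
  have cont: "continuous_on {a..b} (\<lambda>p. \<Psi> p (first_order (U (X n, p))))" for n
  proof -
    have "continuous_on {a..b} (\<lambda>p. (p, first_order (U (X n, p))))"
      unfolding first_order_def
      by (intro continuous_intros continuous_on_strip_slice[OF solutionD(2)[OF U] sub])
    moreover have "(\<lambda>p. (p, first_order (U (X n, p)))) ` {a..b} \<subseteq> admissible"
      using solution_admissible[OF U] sub by blast
    ultimately show ?thesis using continuous_on_compose2[OF \<Psi>] by fastforce
  qed
  have bound: "norm (\<Psi> p (first_order (U (X n, p)))) \<le> B" if "p \<in> {a..b}" for n p
    using B[OF solution_admissible[OF U, of p "X n"]] that sub by auto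
  have limit: "(\<lambda>n. \<Psi> p (first_order (U (X n, p)))) \<longlonglongrightarrow> \<Psi> p (K p)" if "p \<in> {a..b}" for p
    using point that sub by blast
  note dominated =
    dominated_convergence[OF integrable_continuous_real[OF cont] integrable_const_ivl bound limit]
  show "(\<lambda>p. \<Psi> p (K p)) integrable_on {a..b}"
    "(\<lambda>n. integral {a..b} (\<lambda>p. \<Psi> p (first_order (U (X n, p))))) \<longlonglongrightarrow> integral {a..b} (\<lambda>p. \<Psi> p (K p))"
    by (rule dominated(1); assumption) (rule dominated(2); assumption)
qed

lemma monotone_solution_converges:
  assumes U: "solution U" and mono: "\<And>p. p \<in> {-1..0} \<Longrightarrow> mono (\<lambda>q. val (U (q, p)))"
  obtains W V where "\<And>p. p \<in> {-1..0} \<Longrightarrow> ((\<lambda>q. first_order (U (q, p))) \<longlongrightarrow> profile_jet W V (\<lambda>_. 0) p) at_top"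
proof -
  note partials = holonomic_partials[OF solutionD(1)[OF U]]
  note bounds = solution_entry_bounds[OF U]
  have "val (U (q, p)) \<le> M" if "p \<in> {-1..0}" for q p
    using bounds(1)[of "(q, p)"] that by (simp add: abs_le_iff)
  then have "\<exists>l. ((\<lambda>q. val (U (q, p))) \<longlongrightarrow> l) at_top" if "p \<in> {-1..0}" for p
    using mono_bounded_tendsto_Sup[OF mono[OF that]] that by blast
  then obtain W where W: "\<And>p. p \<in> {-1..0} \<Longrightarrow> ((\<lambda>q. val (U (q, p))) \<longlongrightarrow> W p) at_top" by metis
  have "\<exists>l. ((\<lambda>q. dp (U (q, p))) \<longlongrightarrow> l) at_top" if p: "p \<in> {-1..0}" for p
  proof (rule derivative_convergent[OF _ p, of "\<lambda>q p. val (U (q, p))" "\<lambda>q p. dp (U (q, p))"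
        "\<lambda>q p. dpp (U (q, p))" M])
    show "\<exists>l. ((\<lambda>q. val (U (q, p))) \<longlongrightarrow> l) at_top" if "p \<in> {-1..0}" for p using W[OF that] by blast
  qed (use partials bounds in auto)
  then obtain V where V: "\<And>p. p \<in> {-1..0} \<Longrightarrow> ((\<lambda>q. dp (U (q, p))) \<longlongrightarrow> V p) at_top" by metis
  have "((\<lambda>q. dq (U (q, p))) \<longlongrightarrow> 0) at_top" if p: "p \<in> {-1..0}" for p
  proof -
    have shift: "filterlim (\<lambda>q. q + x) at_top at_top" if "0 \<le> x" for x :: real
      by (rule filterlim_at_top_mono[OF filterlim_ident]) (simp add: that)
    have partial: "((\<lambda>x. f (U (q + x, p))) has_real_derivative f' (U (q + x, p))) (at x within S)"
      if "\<And>q. ((\<lambda>q. f (U (q, p))) has_real_derivative f' (U (q, p))) (at q)" for f f' q x S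
      using DERIV_shift[of "\<lambda>t. f (U (t, p))" "f' (U (q + x, p))" x q] that[of "x + q"]
      by (simp add: add.commute has_field_derivative_at_within)
    have "\<exists>l. ((\<lambda>q. dq (U (q + 0, p))) \<longlongrightarrow> l) at_top"
    proof (rule derivative_convergent[of 0 1 0 "\<lambda>q x. val (U (q + x, p))" "\<lambda>q x. dq (U (q + x, p))"
          "\<lambda>q x. dqq (U (q + x, p))" M])
      show "\<exists>l. ((\<lambda>q. val (U (q + x, p))) \<longlongrightarrow> l) at_top" if "x \<in> {0..1}" for x
        using filterlim_compose[OF W[OF p] shift[of x]] that by auto
    qed (use p bounds partial partials(1,2)[OF p] in auto)
    then obtain l where l: "((\<lambda>q. dq (U (q, p))) \<longlongrightarrow> l) at_top" by auto
    then show ?thesis using tendsto_derivative_zero[OF partials(1)[OF p] W[OF p] l] by simp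
  qed
  then show thesis
    by (intro that[of W V]) (unfold first_order_def profile_jet_def zero_prod_def, intro tendsto_intros W V)
qed

end

locale conjugate_flow = height_problem +
  fixes U :: "real \<times> real \<Rightarrow> jet" and W V :: "real \<Rightarrow> real"
  assumes solution: "solution U"
    and limit: "p \<in> {-1..0} \<Longrightarrow> ((\<lambda>q. first_order (U (q, p))) \<longlongrightarrow> profile_jet W V (\<lambda>_. 0) p) at_top"
begin

abbreviation K :: "real \<Rightarrow> jet" where "K \<equiv> profile_jet W V (\<lambda>_. 0)"

lemma K_entries [simp]: "val (K p) = W p" "dq (K p) = 0" "dp (K p) = V p"
  by (simp_all add: profile_jet_def)

lemma val_tendsto: "p \<in> {-1..0} \<Longrightarrow> ((\<lambda>q. val (U (q, p))) \<longlongrightarrow> W p) at_top"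
  using jet_entry_tendsto(1)[OF limit] by simp

lemma height_limit_pos:
  assumes p: "p \<in> {-1..0}"
  shows "Hp p + V p > 0"
proof -
  have "((\<lambda>q. Hp p + dp (U (q, p))) \<longlongrightarrow> Hp p + V p) at_top"
    using jet_entry_tendsto(3)[OF limit[OF p]] by (intro tendsto_intros) simp
  moreover have "\<forall>\<^sub>F q in at_top. c \<le> Hp p + dp (U (q, p))"
    using solutionD(6)[OF solution, of "(_, p)"] p by simp
  ultimately have "c \<le> Hp p + V p" by (rule tendsto_lowerbound) simp
  then show ?thesis using c_pos by simp
qed

lemma integral_tendsto:
  fixes \<Psi> :: "real \<Rightarrow> jet \<Rightarrow> real"
  assumes \<Psi>: "continuous_on admissible (\<lambda>x. \<Psi> (fst x) (snd x))" "\<And>p j. \<Psi> p (first_order j) = \<Psi> p j"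
  shows "p \<in> {-1..0} \<Longrightarrow> ((\<lambda>q. \<Psi> p (U (q, p))) \<longlongrightarrow> \<Psi> p (K p)) at_top"
    "{a..b} \<subseteq> {-1..0} \<Longrightarrow> (\<lambda>p. \<Psi> p (K p)) integrable_on {a..b}"
    "{a..b} \<subseteq> {-1..0} \<Longrightarrow>
      ((\<lambda>q. integral {a..b} (\<lambda>p. \<Psi> p (U (q, p)))) \<longlongrightarrow> integral {a..b} (\<lambda>p. \<Psi> p (K p))) at_top"
proof -
  have lim: "(\<lambda>n. first_order (U (X n, p))) \<longlonglongrightarrow> K p"
    if "filterlim X at_top sequentially" "p \<in> {-1..0}" for X :: "nat \<Rightarrow> real" and p
    using filterlim_compose[OF limit[OF that(2)] that(1)] .
  note seq = integral_along_solution_LIMSEQ[OF solution \<Psi>(1) lim, unfolded \<Psi>(2)]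
  show "((\<lambda>q. \<Psi> p (U (q, p))) \<longlongrightarrow> \<Psi> p (K p)) at_top" if "p \<in> {-1..0}"
    using seq(1)[OF _ _ order_refl that] by (intro tendsto_at_topI_sequentially) blast
  show "(\<lambda>p. \<Psi> p (K p)) integrable_on {a..b}" if "{a..b} \<subseteq> {-1..0}"
    using seq(2)[OF filterlim_real_sequentially _ that] by blast
  show "((\<lambda>q. integral {a..b} (\<lambda>p. \<Psi> p (U (q, p)))) \<longlongrightarrow> integral {a..b} (\<lambda>p. \<Psi> p (K p))) at_top"
    if "{a..b} \<subseteq> {-1..0}"
    using seq(3)[OF _ _ that] by (intro tendsto_at_topI_sequentially) blast
qed

lemma conjugate_flow_equation:
  assumes p: "p \<in> {-1..0}"
  shows "(\<lambda>t. \<mu> * \<rho>p t * W t) integrable_on {p..0}"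
    "flux p (K p) = \<mu> * \<rho>0 * W 0 - integral {p..0} (\<lambda>t. \<mu> * \<rho>p t * W t)"
proof -
  have sub: "{p..0} \<subseteq> {-1..0}" using p by auto
  have "continuous_on admissible (\<lambda>x. \<mu> * \<rho>p (fst x) * val (snd x))"
    by (intro continuous_intros continuous_on_admissible_coefficients)
  note load =
    integral_tendsto[of "\<lambda>t j. \<mu> * \<rho>p t * val j", OF this, simplified first_order_entries K_entries, OF refl]
  show "(\<lambda>t. \<mu> * \<rho>p t * W t) integrable_on {p..0}" by (rule load(2)[OF sub])
  have "((\<lambda>q. integral {p..0} (\<lambda>t. slope t (U (q, t)))) \<longlongrightarrow> integral {p..0} (\<lambda>t. slope t (K t))) at_top"
    by (rule integral_tendsto(3)[OF continuous_on_admissible(2) first_order_densities(2) sub])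
  moreover have "((\<lambda>q. flux p (U (q, p)) - \<mu> * \<rho>0 * val (U (q, 0))
        + integral {p..0} (\<lambda>t. \<mu> * \<rho>p t * val (U (q, t))))
      \<longlongrightarrow> flux p (K p) - \<mu> * \<rho>0 * W 0 + integral {p..0} (\<lambda>t. \<mu> * \<rho>p t * W t)) at_top"
    using integral_tendsto(1)[OF continuous_on_admissible(1) first_order_densities(1) p] val_tendsto[of 0]
    by (intro tendsto_intros load(3)[OF sub]) simp_all
  ultimately have "flux p (K p) - \<mu> * \<rho>0 * W 0 + integral {p..0} (\<lambda>t. \<mu> * \<rho>p t * W t) = 0"
    by (rule tendsto_derivative_zero[OF slope_integral_derivative[OF solution p]])
  then show "flux p (K p) = \<mu> * \<rho>0 * W 0 - integral {p..0} (\<lambda>t. \<mu> * \<rho>p t * W t)" by linarith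
qed

lemma conjugate_flow_work: "integral {-1..0} (\<lambda>p. work_density p (K p)) = \<mu> * \<rho>0 * (W 0)\<^sup>2"
proof -
  have "continuous_on admissible (\<lambda>x. val (snd x) * slope (fst x) (snd x))"
    by (intro continuous_intros continuous_on_admissible)
  then have "((\<lambda>q. integral {-1..0} (\<lambda>p. val (U (q, p)) * slope p (U (q, p)))) \<longlongrightarrow>
      integral {-1..0} (\<lambda>p. val (K p) * slope p (K p))) at_top"
    by (rule integral_tendsto(3)[of "\<lambda>p j. val j * slope p j"]) simp_all
  moreover have "((\<lambda>q. integral {-1..0} (\<lambda>p. work_density p (U (q, p))) - \<mu> * \<rho>0 * (val (U (q, 0)))\<^sup>2) \<longlongrightarrow>
      integral {-1..0} (\<lambda>p. work_density p (K p)) - \<mu> * \<rho>0 * (W 0)\<^sup>2) at_top"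
    by (intro tendsto_intros val_tendsto
      integral_tendsto(3)[OF continuous_on_admissible(3) first_order_densities(3)]) simp_all
  ultimately have "integral {-1..0} (\<lambda>p. work_density p (K p)) - \<mu> * \<rho>0 * (W 0)\<^sup>2 = 0"
    by (rule tendsto_derivative_zero[OF work_integral_derivative[OF solution]])
  then show ?thesis by simp
qed

lemma conjugate_flow_force:
  assumes "vanishes_left U"
  shows "integral {-1..0} (\<lambda>p. force_density p (K p)) - \<mu> * \<rho>0 * (W 0)\<^sup>2 / 2
    = integral {-1..0} (\<lambda>p. force_density p 0)"
proof -
  have const: "flow_force U = (\<lambda>q. flow_force U 0)" using flow_force_constant[OF solution] by blast
  have "((\<lambda>q. flow_force U q) \<longlongrightarrow> integral {-1..0} (\<lambda>p. force_density p (K p)) - \<mu> * \<rho>0 * (W 0)\<^sup>2 / 2) at_top"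
    unfolding flow_force_def
    by (intro tendsto_intros val_tendsto
      integral_tendsto(3)[OF continuous_on_admissible(4) first_order_densities(4)]) simp_all
  then have right: "flow_force U 0 = integral {-1..0} (\<lambda>p. force_density p (K p)) - \<mu> * \<rho>0 * (W 0)\<^sup>2 / 2"
    by (subst (asm) const) (simp add: tendsto_const_iff[OF trivial_limit_at_top_linorder])
  have lim: "(\<lambda>n. first_order (U (- real n, p))) \<longlonglongrightarrow> 0" if p: "p \<in> {-1..0}" for p
  proof (rule metric_LIMSEQ_I)
    fix e :: real assume "e > 0"
    then obtain Q where Q: "\<And>z. z \<in> strip \<Longrightarrow> fst z \<le> Q \<Longrightarrow> norm (U z) < e"
      using vanishes_leftD[OF assms] by blast
    obtain N :: nat where "- Q \<le> real N" using real_arch_simple by blast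
    then have "norm (U (- real n, p)) < e" if "N \<le> n" for n using Q[of "(- real n, p)"] that p by simp
    then have "norm (first_order (U (- real n, p))) < e" if "N \<le> n" for n
      using norm_first_order_le le_less_trans that by blast
    then show "\<exists>N. \<forall>n\<ge>N. dist (first_order (U (- real n, p))) 0 < e" by auto
  qed
  have surface: "(\<lambda>n. val (U (- real n, 0))) \<longlonglongrightarrow> 0" using jet_entry_tendsto(1)[OF lim[of 0]] by simp
  have force: "(\<lambda>n. integral {-1..0} (\<lambda>p. force_density p (U (- real n, p))))
      \<longlonglongrightarrow> integral {-1..0} (\<lambda>p. force_density p 0)"
    using integral_along_solution_LIMSEQ(3)[OF solution continuous_on_admissible(4) lim order_refl] by simp
  have "(\<lambda>n. flow_force U (- real n)) \<longlonglongrightarrow> integral {-1..0} (\<lambda>p. force_density p 0) - \<mu> * \<rho>0 * 0\<^sup>2 / 2"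
    unfolding flow_force_def
    by (intro tendsto_diff tendsto_divide tendsto_mult tendsto_power tendsto_const force surface) simp
  then have "flow_force U 0 = integral {-1..0} (\<lambda>p. force_density p 0)"
    by (subst (asm) const) (simp add: LIMSEQ_const_iff)
  with right show ?thesis by simp
qed

lemma excess_force_cubic:
  assumes p: "p \<in> {-1..0}"
  shows "force_density p (K p) - force_density p 0 - work_density p (K p) / 2
    = V p ^ 3 / (4 * (Hp p + V p)\<^sup>2 * (Hp p)\<^sup>2)"
proof -
  define x y where "x = Hp p + V p" and "y = Hp p"
  have xy: "x > 0" "y > 0" "V p = x - y"
    using height_limit_pos[OF p] Hp_pos[OF p] by (simp_all add: x_def y_def)
  have "force_density p (K p) - force_density p 0 - work_density p (K p) / 2
      = 1 / (2 * x) + (x - y) / (2 * y\<^sup>2) - 1 / (2 * y) - (x - y) * (1 / (2 * y\<^sup>2) - 1 / (2 * x\<^sup>2)) / 2"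
    by (simp add: force_density_def work_density_def flux_def x_def y_def add_divide_distrib)
  also have "\<dots> = (x - y) ^ 3 / (4 * x\<^sup>2 * y\<^sup>2)"
    using xy by (simp add: field_simps power2_eq_square power3_eq_cube)
  finally show ?thesis by (simp add: x_def y_def)
qed

lemma cubic_lower_bound:
  fixes x y g h :: real
  assumes "0 < g" "0 < h" "h \<le> y" "0 < x" and g: "g \<le> 1 / (2 * y\<^sup>2) - 1 / (2 * x\<^sup>2)"
  shows "g ^ 3 * h ^ 5 / 4 \<le> (x - y) ^ 3 / (4 * x\<^sup>2 * y\<^sup>2)"
proof -
  have y: "0 < y" using assms(2,3) by simp
  have "1 / (2 * y\<^sup>2) - 1 / (2 * x\<^sup>2) = (x\<^sup>2 - y\<^sup>2) / (2 * x\<^sup>2 * y\<^sup>2)"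
    using assms(4) y by (simp add: field_simps)
  then have flux: "g * (2 * x\<^sup>2 * y\<^sup>2) \<le> x\<^sup>2 - y\<^sup>2" using g assms(4) y by (simp add: pos_le_divide_eq)
  moreover have "0 \<le> g * (2 * x\<^sup>2 * y\<^sup>2)" using assms by simp
  ultimately have "y\<^sup>2 \<le> x\<^sup>2" by linarith
  then have "y \<le> x" using assms(4) by (auto intro: power2_le_imp_le)
  have "2 * x * (g * x * y\<^sup>2) \<le> (x + y) * (x - y)" using flux by (simp add: algebra_simps power2_eq_square)
  also have "\<dots> \<le> 2 * x * (x - y)" using \<open>y \<le> x\<close> by (intro mult_right_mono) auto
  finally have "g * x * y\<^sup>2 \<le> x - y" using assms(4) by simp
  then have "(g * x * y\<^sup>2) ^ 3 \<le> (x - y) ^ 3" using assms by (intro power_mono) auto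
  then have "(g * x * y\<^sup>2) ^ 3 / (4 * x\<^sup>2 * y\<^sup>2) \<le> (x - y) ^ 3 / (4 * x\<^sup>2 * y\<^sup>2)"
    by (intro divide_right_mono) auto
  moreover have "(g * x * y\<^sup>2) ^ 3 / (4 * x\<^sup>2 * y\<^sup>2) = g ^ 3 * (x * y ^ 4) / 4"
    using assms(4) y by (simp add: field_simps eval_nat_numeral)
  moreover have "h * h ^ 4 \<le> x * y ^ 4" using assms(2,3) \<open>y \<le> x\<close> by (intro mult_mono power_mono) auto
  then have "g ^ 3 * h ^ 5 / 4 \<le> g ^ 3 * (x * y ^ 4) / 4" using assms(1) by (simp add: eval_nat_numeral)
  ultimately show ?thesis by linarith
qed

lemma conjugate_flow_trivial:
  assumes left: "vanishes_left U" and nonneg: "\<And>p. p \<in> {-1..0} \<Longrightarrow> W p \<ge> 0"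
  shows "W 0 = 0"
proof (rule ccontr)
  assume "W 0 \<noteq> 0"
  define g where "g = \<mu> * \<rho>0 * W 0"
  have g: "g > 0" using \<open>W 0 \<noteq> 0\<close> nonneg[of 0] \<mu>_pos \<rho>0_pos by (simp add: g_def)
  obtain x where x: "x \<in> {-1..0}" "\<And>p. p \<in> {-1..0} \<Longrightarrow> Hp x \<le> Hp p"
    using continuous_attains_inf[OF _ _ Hp_cont] by auto
  define k where "k = g ^ 3 * Hp x ^ 5 / 4"
  have k: "k > 0" using g Hp_pos[OF x(1)] by (simp add: k_def)
  have "k \<le> force_density p (K p) - force_density p 0 - work_density p (K p) / 2" if p: "p \<in> {-1..0}" for p
  proof -
    have "integral {p..0} (\<lambda>t. \<mu> * \<rho>p t * W t) \<le> integral {p..0} (\<lambda>t. 0)"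
      using p nonneg \<rho>p_nonpos \<mu>_pos conjugate_flow_equation(1)[OF p]
      by (intro integral_le integrable_0) (auto simp: mult_nonneg_nonpos mult_nonpos_nonneg)
    then have "g \<le> flux p (K p)" using conjugate_flow_equation(2)[OF p] by (simp add: g_def)
    also have "\<dots> = 1 / (2 * (Hp p)\<^sup>2) - 1 / (2 * (Hp p + V p)\<^sup>2)" by (simp add: flux_def)
    finally have "k \<le> (Hp p + V p - Hp p) ^ 3 / (4 * (Hp p + V p)\<^sup>2 * (Hp p)\<^sup>2)"
      unfolding k_def by (intro cubic_lower_bound g Hp_pos[OF x(1)] x(2)[OF p] height_limit_pos[OF p])
    then show ?thesis unfolding excess_force_cubic[OF p] by simp
  qed
  moreover have "((\<lambda>p. force_density p (K p) - force_density p 0 - work_density p (K p) / 2) has_integral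
      integral {-1..0} (\<lambda>p. force_density p (K p)) - integral {-1..0} (\<lambda>p. force_density p 0)
        - integral {-1..0} (\<lambda>p. work_density p (K p)) / 2) {-1..0}"
  proof -
    have "continuous_on {-1..0} (\<lambda>p. force_density p 0)"
      unfolding force_density_def using Hp_pos
      by (auto intro!: continuous_intros Hp_cont \<rho>p_cont simp: less_le)
    then have "(\<lambda>p. force_density p 0) integrable_on {-1..0}" by (rule integrable_continuous_real)
    then show ?thesis
      by (intro has_integral_diff has_integral_divide integrable_integral
          integral_tendsto(2)[OF continuous_on_admissible(4) first_order_densities(4) order_refl]
          integral_tendsto(2)[OF continuous_on_admissible(3) first_order_densities(3) order_refl])
  qed
  ultimately have "k * (0 - (-1)) \<le> integral {-1..0} (\<lambda>p. force_density p (K p))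
      - integral {-1..0} (\<lambda>p. force_density p 0) - integral {-1..0} (\<lambda>p. work_density p (K p)) / 2"
    using has_integral_le[OF has_integral_const_real[of k "-1" 0]] by fastforce
  then show False using conjugate_flow_force[OF left] conjugate_flow_work k by simp
qed

end

lemma (in elevation_wave) not_monotone: "\<not> (\<forall>p\<in>{-1..0}. mono (\<lambda>q. val (J (q, p))))"
proof
  assume mono: "\<forall>p\<in>{-1..0}. mono (\<lambda>q. val (J (q, p)))"
  obtain W V where limit: "\<And>p. p \<in> {-1..0} \<Longrightarrow> ((\<lambda>q. first_order (J (q, p))) \<longlongrightarrow> profile_jet W V (\<lambda>_. 0) p) at_top"
    using monotone_solution_converges[OF solution] mono by blast
  interpret conjugate_flow Hp Hpp \<rho>p \<rho>0 \<mu> M c J W V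
    by unfold_locales (fact solution, fact limit)
  have ge: "val (J (0, p)) \<le> W p" if p: "p \<in> {-1..0}" for p
  proof (rule tendsto_lowerbound[OF val_tendsto[OF p] _ trivial_limit_at_top_linorder])
    show "\<forall>\<^sub>F q in at_top. val (J (0, p)) \<le> val (J (q, p))"
      using mono p by (intro eventually_mono[OF eventually_ge_at_top[of 0]]) (auto dest: monoD)
  qed
  have "0 \<le> W p" if "p \<in> {-1..0}" for p using ge[OF that] val_nonneg[of "(0, p)"] that by simp
  then have "W 0 = 0" using conjugate_flow_trivial[OF vanishing] by blast
  then show False using ge[of 0] elevation[of "(0, 0)"] by simp
qed

section \<open>Symmetry\<close>

definition symmetric_crest :: "(real \<times> real \<Rightarrow> jet) \<Rightarrow> real \<Rightarrow> bool" where
  "symmetric_crest J l \<longleftrightarrow>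
     (\<forall>q p. -1 \<le> p \<and> p \<le> 0 \<longrightarrow> val (J (2 * l - q, p)) = val (J (q, p))) \<and>
     (\<forall>q p. -1 < p \<and> p \<le> 0 \<longrightarrow> (q < l \<longrightarrow> dq (J (q, p)) > 0) \<and> (q > l \<longrightarrow> dq (J (q, p)) < 0))"

lemma symmetric_crest_reflect:
  assumes "symmetric_crest (\<lambda>z. reflect (J (- fst z, snd z))) l"
  shows "symmetric_crest J (- l)"
  unfolding symmetric_crest_def
proof (intro conjI allI impI)
  note sym = assms[unfolded symmetric_crest_def reflect_entries fst_conv snd_conv]
  fix q p :: real
  show "val (J (2 * - l - q, p)) = val (J (q, p))" if "-1 \<le> p \<and> p \<le> 0"
    using sym[THEN conjunct1, rule_format, OF that, of "- q"] by simp
  show "dq (J (q, p)) > 0" if "-1 < p \<and> p \<le> 0" "q < - l"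
    using sym[THEN conjunct2, rule_format, OF that(1), of "- q"] that(2) by simp
  show "dq (J (q, p)) < 0" if "-1 < p \<and> p \<le> 0" "q > - l"
    using sym[THEN conjunct2, rule_format, OF that(1), of "- q"] that(2) by simp
qed

lemma (in elevation_wave) symmetric: "\<exists>l. symmetric_crest J l"
proof -
  obtain l where sym: "\<And>z. z \<in> strip \<Longrightarrow> val (J (2 * l - fst z, snd z)) = val (J z)"
    and inc: "\<And>z. z \<in> {..<l} \<times> {-1<..0} \<Longrightarrow> dq (J z) > 0"
    using moving_planes not_monotone by blast
  have "dq (J (q, p)) < 0" if q: "q > l" and p: "-1 < p" "p \<le> 0" for q p
  proof -
    have p': "p \<in> {-1..0}" using p by simp
    have "((\<lambda>t. val (J (2 * l - t, p))) has_real_derivative dq (J (2 * l - q, p)) * (- 1)) (at q)"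
      using holonomic_partials(1)[OF holonomic p', of "2 * l - q"]
      by (intro DERIV_chain2[of "\<lambda>t. val (J (t, p))"]) (auto intro!: derivative_eq_intros)
    moreover have "(\<lambda>t. val (J (2 * l - t, p))) = (\<lambda>t. val (J (t, p)))" using sym[of "(_, p)"] p by auto
    ultimately have "dq (J (q, p)) = - dq (J (2 * l - q, p))"
      using DERIV_unique holonomic_partials(1)[OF holonomic p', of q] by fastforce
    then show ?thesis using inc[of "(2 * l - q, p)"] p q by simp
  qed
  then have "symmetric_crest J l"
    using inc sym by (auto simp: symmetric_crest_def)
  then show ?thesis by blast
qed

lemma (in height_problem) solution_symmetric:
  assumes J: "solution J" "\<And>z. z \<in> strip \<Longrightarrow> -1 < snd z \<Longrightarrow> val (J z) > 0"
    and vanishing: "vanishes_left J \<or> vanishes_left (\<lambda>z. reflect (J (- fst z, snd z)))"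
    and "\<rho> 0 = \<rho>0" "\<And>m. 0 < m \<Longrightarrow> m \<le> \<mu> \<Longrightarrow> \<not> has_eigensolution Hp \<rho> \<rho>p m"
  shows "\<exists>l. symmetric_crest J l"
proof -
  obtain b B where bB: "b > 0" "\<And>N. \<exists>\<delta> \<Phi> \<Phi>' \<Phi>''. supersolution N b B \<delta> \<Phi> \<Phi>' \<Phi>''"
    using supersolution_exists[OF assms(4,5)] by blast
  have sym: "\<exists>l. symmetric_crest U l"
    if "solution U" "\<And>z. z \<in> strip \<Longrightarrow> -1 < snd z \<Longrightarrow> val (U z) > 0" "vanishes_left U" for U
  proof -
    interpret wave: elevation_wave Hp Hpp \<rho>p \<rho>0 \<mu> M c U b B
      by unfold_locales (use that bB in auto)
    show ?thesis by (rule wave.symmetric)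
  qed
  from vanishing show ?thesis
  proof
    assume "vanishes_left J"
    then show ?thesis using sym J by blast
  next
    assume right: "vanishes_left (\<lambda>z. reflect (J (- fst z, snd z)))"
    have "solution (\<lambda>z. reflect (J (- fst z, snd z)))" using solution_reflect[OF J(1), of 0] by simp
    moreover have "val (reflect (J (- fst z, snd z))) > 0" if "z \<in> strip" "-1 < snd z" for z
      using that J(2)[of "(- fst z, snd z)"] by (simp add: strip_def)
    ultimately show ?thesis using sym[OF _ _ right] symmetric_crest_reflect by blast
  qed
qed

section \<open>From the height equation to jets\<close>

lemma C_k_alpha_differentiable:
  assumes "C_k_alpha (Suc k) \<alpha> f"
  obtains f' where "\<And>x. x \<in> {-1..0} \<Longrightarrow> (f has_real_derivative f' x) (at x within {-1..0})"
proof -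
  obtain D where D: "\<And>x. x \<in> {-1..0} \<Longrightarrow> D 0 x = f x"
    "\<And>x. x \<in> {-1..0} \<Longrightarrow> (D 0 has_real_derivative D (Suc 0) x) (at x within {-1..0})"
    using assms unfolding C_k_alpha_def by blast
  show thesis by (rule that[OF has_real_derivative_transform[OF D(2) _ D(1)[symmetric]]])
qed

lemma C_k_alpha_derivative:
  assumes "C_k_alpha (Suc k) \<alpha> f" "\<And>x. x \<in> {-1..0} \<Longrightarrow> (f has_real_derivative f' x) (at x within {-1..0})"
  shows "C_k_alpha k \<alpha> f'"
proof -
  obtain D where D0: "\<And>x. x \<in> {-1..0} \<Longrightarrow> D 0 x = f x"
    and D: "\<And>j x. j < Suc k \<Longrightarrow> x \<in> {-1..0} \<Longrightarrow> (D j has_real_derivative D (Suc j) x) (at x within {-1..0})"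
    and top: "continuous_on {-1..0} (D (Suc k))"
      "\<exists>C. \<forall>x\<in>{-1..0}. \<forall>y\<in>{-1..0}. \<bar>D (Suc k) x - D (Suc k) y\<bar> \<le> C * \<bar>x - y\<bar> powr \<alpha>"
    using assms(1) unfolding C_k_alpha_def by blast
  have "D (Suc 0) x = f' x" if x: "x \<in> {-1..0}" for x
  proof -
    have "(D 0 has_real_derivative f' x) (at x within {-1..0})"
      by (rule has_real_derivative_transform[OF assms(2)[OF x] x D0])
    then show ?thesis using has_real_derivative_unique_Icc[OF D[of 0, OF _ x]] x by simp
  qed
  then show ?thesis
    unfolding C_k_alpha_def using D top by (intro exI[of _ "\<lambda>j. D (Suc j)"]) auto
qed

lemma C_k_alpha_continuous:
  assumes "C_k_alpha k \<alpha> f"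
  shows "continuous_on {-1..0} f"
proof (cases k)
  case 0
  then obtain D :: "nat \<Rightarrow> real \<Rightarrow> real" where "\<And>x. x \<in> {-1..0} \<Longrightarrow> D 0 x = f x" "continuous_on {-1..0} (D 0)"
    using assms unfolding C_k_alpha_def 0 by blast
  then show ?thesis by (metis (no_types, lifting) continuous_on_cong)
next
  case (Suc j)
  then show ?thesis using C_k_alpha_differentiable[of j \<alpha> f] assms DERIV_continuous_on by metis
qed

context
  fixes w wq wp wqq wqp wpq wpp :: "real \<Rightarrow> real \<Rightarrow> real"
begin

lemma norm_jet_of_le:
  assumes "\<And>g. g \<in> {w, wq, wp, wqq, wqp, wpp} \<Longrightarrow> \<bar>g (fst z) (snd z)\<bar> \<le> C"
  shows "norm (jet_of w wq wp wqq wqp wpp z) \<le> 6 * C"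
proof -
  have "\<bar>w (fst z) (snd z)\<bar> \<le> C" "\<bar>wq (fst z) (snd z)\<bar> \<le> C" "\<bar>wp (fst z) (snd z)\<bar> \<le> C"
    "\<bar>wqq (fst z) (snd z)\<bar> \<le> C" "\<bar>wqp (fst z) (snd z)\<bar> \<le> C" "\<bar>wpp (fst z) (snd z)\<bar> \<le> C"
    by (intro assms; simp)+
  then show ?thesis unfolding jet_of_def by (intro order_trans[OF norm_jet_le]) linarith
qed

lemma jet_of_bounded:
  assumes "C2_bounded [w, wq, wp, wqq, wqp, wpq, wpp]"
  obtains C where "C > 0" "\<And>z. z \<in> strip \<Longrightarrow> norm (jet_of w wq wp wqq wqp wpp z) \<le> C"
proof -
  have "\<forall>g\<in>{w, wq, wp, wqq, wqp, wpp}. \<exists>C. \<forall>z\<in>strip. \<bar>g (fst z) (snd z)\<bar> \<le> C"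
    using assms by (auto simp: C2_bounded_def)
  then obtain C where C: "\<And>g z. g \<in> {w, wq, wp, wqq, wqp, wpp} \<Longrightarrow> z \<in> strip \<Longrightarrow> \<bar>g (fst z) (snd z)\<bar> \<le> C g"
    by (metis (no_types))
  define K where "K = 1 + (\<Sum>g\<in>{w, wq, wp, wqq, wqp, wpp}. \<bar>C g\<bar>)"
  show thesis
  proof (rule that[of "6 * K"])
    show "6 * K > 0" by (simp add: K_def sum_nonneg add_pos_nonneg)
    fix z :: "real \<times> real" assume z: "z \<in> strip"
    show "norm (jet_of w wq wp wqq wqp wpp z) \<le> 6 * K"
    proof (rule norm_jet_of_le)
      fix g assume g: "g \<in> {w, wq, wp, wqq, wqp, wpp}"
      then have "\<bar>C g\<bar> \<le> (\<Sum>g\<in>{w, wq, wp, wqq, wqp, wpp}. \<bar>C g\<bar>)" by (intro member_le_sum) auto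
      then show "\<bar>g (fst z) (snd z)\<bar> \<le> K" using C[OF g z] by (simp add: K_def)
    qed
  qed
qed

lemma decays_left_vanishes:
  assumes "decays_left [w, wq, wp, wqq, wqp, wpq, wpp]"
  shows "vanishes_left (jet_of w wq wp wqq wqp wpp)"
  unfolding vanishes_left_def
proof (intro allI impI)
  fix e :: real assume e: "e > 0"
  then obtain Q where Q: "\<And>q p. q \<le> Q \<and> -1 \<le> p \<and> p \<le> 0 \<Longrightarrow>
      \<forall>g\<in>set [w, wq, wp, wqq, wqp, wpq, wpp]. \<bar>g q p\<bar> < e / 12"
    using assms unfolding decays_left_def by (metis divide_pos_pos zero_less_numeral)
  have "norm (jet_of w wq wp wqq wqp wpp z) < e" if "z \<in> strip" "fst z \<le> Q" for z
  proof -
    have "norm (jet_of w wq wp wqq wqp wpp z) \<le> 6 * (e / 12)"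
      using Q[of "fst z" "snd z"] that by (intro norm_jet_of_le less_imp_le) (auto simp: strip_def)
    then show ?thesis using e by simp
  qed
  then show "\<exists>Q. \<forall>z\<in>strip. fst z \<le> Q \<longrightarrow> norm (jet_of w wq wp wqq wqp wpp z) < e" by blast
qed

lemma decays_right_vanishes:
  assumes "decays_right [w, wq, wp, wqq, wqp, wpq, wpp]"
  shows "vanishes_left (\<lambda>z. reflect (jet_of w wq wp wqq wqp wpp (- fst z, snd z)))"
  unfolding vanishes_left_def norm_reflect
proof (intro allI impI)
  fix e :: real assume e: "e > 0"
  then obtain Q where Q: "\<And>q p. q \<ge> Q \<and> -1 \<le> p \<and> p \<le> 0 \<Longrightarrow>
      \<forall>g\<in>set [w, wq, wp, wqq, wqp, wpq, wpp]. \<bar>g q p\<bar> < e / 12"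
    using assms unfolding decays_right_def by (metis divide_pos_pos zero_less_numeral)
  have "norm (jet_of w wq wp wqq wqp wpp (- fst z, snd z)) < e" if "z \<in> strip" "fst z \<le> - Q" for z
  proof -
    have "norm (jet_of w wq wp wqq wqp wpp (- fst z, snd z)) \<le> 6 * (e / 12)"
      using Q[of "- fst z" "snd z"] that by (intro norm_jet_of_le less_imp_le) (auto simp: strip_def)
    then show ?thesis using e by simp
  qed
  then show "\<exists>Q. \<forall>z\<in>strip. fst z \<le> Q \<longrightarrow> norm (jet_of w wq wp wqq wqp wpp (- fst z, snd z)) < e" by blast
qed

end

lemma (in height_problem) height_eq_interior_op:
  assumes sol: "height_eq H Hp \<rho> \<rho>p w wq wp F" "\<mu> = 1 / F\<^sup>2" and C2: "C2_strip w wq wp wqq wqp wpq wpp"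
    and p: "-1 < p" "p < 0"
  shows "interior_op p (jet_of w wq wp wqq wqp wpp (q, p)) = 0"
proof -
  define J where "J = jet_of w wq wp wqq wqp wpp"
  have entries: "val (J (q, p)) = w q p" "dq (J (q, p)) = wq q p" "dp (J (q, p)) = wp q p" for q p
    by (simp_all add: J_def jet_of_def)
  have p': "p \<in> {-1..0}" "at p within {-1..0} = at p" using p by (auto simp: at_within_Icc_at)
  obtain c where "c > 0" "c \<le> Hp p + wp q p" using sol(1) p unfolding height_eq_def by blast
  then have x: "Hp p + dp (J (q, p)) \<noteq> 0" by (simp add: entries)
  obtain A B where A: "((\<lambda>t. - (1 + (wq q t)\<^sup>2) / (2 * (Hp t + wp q t)\<^sup>2) + 1 / (2 * (Hp t)\<^sup>2))
      has_real_derivative A) (at p)"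
    and B: "((\<lambda>t. wq t p / (Hp p + wp t p)) has_real_derivative B) (at q)"
    and AB: "A + B - (1 / F\<^sup>2) * \<rho>p p * ((H p + w q p) - H p) = 0"
    using sol(1) p unfolding height_eq_def by blast
  note derivatives = flux_derivative[OF C2_strip_jet_of(1)[OF C2] p'(1), of q]
    slope_derivative[OF C2_strip_jet_of(1)[OF C2] p'(1), of q]
  have "((\<lambda>t. flux t (J (q, t))) has_real_derivative A) (at p)"
    using A by (simp only: flux_def entries uminus_add_conv_diff minus_divide_left[symmetric])
  then have "A = flux_p p (J (q, p))" using derivatives(1) x DERIV_unique unfolding J_def p'(2) by blast
  moreover have "((\<lambda>t. slope p (J (t, p))) has_real_derivative B) (at q)"
    using B by (simp add: slope_def entries)
  then have "B = slope_q p (J (q, p))" using derivatives(2) x DERIV_unique unfolding J_def by blast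
  ultimately show ?thesis
    using interior_op_divergence[OF x] AB sol(2) by (simp add: entries flip: J_def)
qed

lemma height_eq_solution:
  assumes sol: "height_eq H Hp \<rho> \<rho>p w wq wp F" and H: "H (-1) = 0" "H 0 = 1"
    and C2: "C2_strip w wq wp wqq wqp wpq wpp" and bounded: "C2_bounded [w, wq, wp, wqq, wqp, wpq, wpp]"
    and Hp: "\<And>p. p \<in> {-1..0} \<Longrightarrow> (Hp has_real_derivative Hpp p) (at p within {-1..0})"
      "\<And>p. p \<in> {-1..0} \<Longrightarrow> Hp p > 0" "continuous_on {-1..0} Hpp"
    and \<rho>: "continuous_on {-1..0} \<rho>p" "\<And>p. p \<in> {-1..0} \<Longrightarrow> \<rho>p p \<le> 0" "\<rho> 0 > 0"
  obtains M c where "height_problem Hp Hpp \<rho>p (\<rho> 0) (1 / F\<^sup>2) M c"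
    "height_problem.solution Hp Hpp \<rho>p (\<rho> 0) (1 / F\<^sup>2) M c (jet_of w wq wp wqq wqp wpp)"
proof -
  let ?J = "jet_of w wq wp wqq wqp wpp"
  note J = C2_strip_jet_of[OF C2]
  have Hp_cont: "continuous_on {-1..0} Hp" using Hp(1) by (rule DERIV_continuous_on)
  obtain C where C: "C > 0" "\<And>z. z \<in> strip \<Longrightarrow> norm (?J z) \<le> C" using jet_of_bounded[OF bounded] by blast
  obtain R where R: "R > 0" "\<And>p. p \<in> {-1..0} \<Longrightarrow> \<bar>Hp p\<bar> \<le> R"
    using continuous_on_Icc_bounded[OF Hp_cont] by blast
  obtain c where c: "c > 0" "\<And>q p. -1 < p \<Longrightarrow> p < 0 \<Longrightarrow> c \<le> Hp p + wp q p"
    using sol unfolding height_eq_def by blast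
  define M where "M = 1 + C + R"
  have "height_problem Hp Hpp \<rho>p (\<rho> 0) (1 / F\<^sup>2) M c"
    by unfold_locales (use Hp \<rho> c(1) C(1) R(1) sol in \<open>auto simp: M_def height_eq_def\<close>)
  then interpret height_problem Hp Hpp \<rho>p "\<rho> 0" "1 / F\<^sup>2" M c .
  have lower: "c \<le> Hp p + dp (?J (q, p))" if "p \<in> {-1..0}" for q p
  proof (rule continuous_ge_on_closure[of "{-1<..<0}" "\<lambda>p. Hp p + dp (?J (q, p))"])
    show "continuous_on (closure {-1<..<0}) (\<lambda>p. Hp p + dp (?J (q, p)))"
      using continuous_on_strip_slice[OF J(2), of "{-1..0}"] Hp_cont by (simp add: continuous_intros)
  qed (use that c(2) in \<open>auto simp: jet_of_def\<close>)
  have "solution ?J"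
    unfolding solution_def
  proof (intro conjI ballI allI impI J)
    fix z :: "real \<times> real" assume z: "z \<in> strip"
    then have p: "snd z \<in> {-1..0}" by (simp add: strip_def)
    show "norm (?J z) \<le> M" using C(2)[OF z] R(1) by (simp add: M_def)
    have "\<bar>dp (?J z)\<bar> \<le> C" using jet_entry_le_norm(3) C(2)[OF z] order_trans by blast
    then show "Hp (snd z) + dp (?J z) \<in> {c..M}"
      using lower[OF p, of "fst z"] R(2)[OF p] by (auto simp: M_def)
    show "interior_op (snd z) (?J z) = 0" if "-1 < snd z" "snd z < 0"
      using height_eq_interior_op[OF sol refl C2 that, of "fst z"] by simp
  next
    fix q
    show "top_op (?J (q, 0)) = 0" "val (?J (q, -1)) = 0"
      using sol H by (simp_all add: top_op_def jet_of_def height_eq_def)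
  qed
  then show thesis using that \<open>height_problem Hp Hpp \<rho>p (\<rho> 0) (1 / F\<^sup>2) M c\<close> by blast
qed

lemma inverse_square_less_critical:
  fixes F m :: real
  assumes "m > 0" "F > 1 / sqrt m"
  shows "1 / F\<^sup>2 < m"
proof -
  have "(1 / sqrt m)\<^sup>2 < F\<^sup>2" using assms by (intro power_strict_mono) auto
  then have "1 / m < F\<^sup>2" using assms(1) by (simp add: power_divide)
  moreover have "0 < 1 / m" using assms(1) by simp
  ultimately have "0 < F\<^sup>2" by linarith
  then show ?thesis using \<open>1 / m < F\<^sup>2\<close> assms(1) by (simp add: field_simps)
qed

theorem theorem4p13:
  fixes \<alpha> :: real
    and \<rho> \<rho>p H Hp :: "real \<Rightarrow> real"
    and w wq wp wqq wqp wpq wpp :: "real \<Rightarrow> real \<Rightarrow> real"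
    and F \<mu>cr :: real
  assumes alpha: "0 < \<alpha>" "\<alpha> < 1"
    and rho_reg: "C_k_alpha 2 \<alpha> \<rho>"
    and rho_der: "\<forall>x\<in>{-1..0}. (\<rho> has_real_derivative \<rho>p x) (at x within {-1..0})"
    and rho_pos: "\<forall>x\<in>{-1..0}. \<rho> x > 0"
    and rho_dec: "\<forall>x\<in>{-1..0}. \<rho>p x \<le> 0"
    and H_reg: "C_k_alpha 3 \<alpha> H"
    and H_der: "\<forall>x\<in>{-1..0}. (H has_real_derivative Hp x) (at x within {-1..0})"
    and H_bc: "H (-1) = 0" "H 0 = 1"
    and H_inc: "\<forall>x\<in>{-1..0}. Hp x > 0"
    and mu_cr: "\<mu>cr > 0" "has_eigensolution Hp \<rho> \<rho>p \<mu>cr"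
               "\<forall>\<mu>>0. has_eigensolution Hp \<rho> \<rho>p \<mu> \<longrightarrow> \<mu>cr \<le> \<mu>"
    and w_C2: "C2_strip w wq wp wqq wqp wpq wpp"
    and w_bdd: "C2_bounded [w, wq, wp, wqq, wqp, wpq, wpp]"
    and sol: "height_eq H Hp \<rho> \<rho>p w wq wp F"
    and w_pos: "\<forall>q p. -1 < p \<and> p \<le> 0 \<longrightarrow> w q p > 0"
    and F_super: "F > 1 / sqrt \<mu>cr"
    and decay: "decays_left [w, wq, wp, wqq, wqp, wpq, wpp] \<or>
                decays_right [w, wq, wp, wqq, wqp, wpq, wpp]"
  shows "\<exists>qs. (\<forall>q p. -1 \<le> p \<and> p \<le> 0 \<longrightarrow> w (2 * qs - q) p = w q p) \<and>
              (\<forall>q p. -1 < p \<and> p \<le> 0 \<longrightarrow>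
                 (q < qs \<longrightarrow> wq q p > 0) \<and> (q > qs \<longrightarrow> wq q p < 0))"
proof -
  have Hp: "C_k_alpha (Suc 1) \<alpha> Hp"
    using C_k_alpha_derivative[of 2 \<alpha> H Hp] H_reg H_der by (simp add: eval_nat_numeral)
  obtain Hpp where Hpp: "\<And>p. p \<in> {-1..0} \<Longrightarrow> (Hp has_real_derivative Hpp p) (at p within {-1..0})"
    using C_k_alpha_differentiable[OF Hp] by blast
  have Hpp_cont: "continuous_on {-1..0} Hpp"
    by (rule C_k_alpha_continuous[OF C_k_alpha_derivative[OF Hp Hpp]])
  have \<rho>p_cont: "continuous_on {-1..0} \<rho>p"
    using C_k_alpha_derivative[of 1 \<alpha> \<rho> \<rho>p] rho_reg rho_der C_k_alpha_continuous
    by (simp add: numeral_2_eq_2)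
  let ?J = "jet_of w wq wp wqq wqp wpp"
  obtain M c where problem: "height_problem Hp Hpp \<rho>p (\<rho> 0) (1 / F\<^sup>2) M c"
    and J: "height_problem.solution Hp Hpp \<rho>p (\<rho> 0) (1 / F\<^sup>2) M c ?J"
    using height_eq_solution[OF sol H_bc w_C2 w_bdd Hpp _ Hpp_cont \<rho>p_cont] H_inc rho_dec rho_pos by auto
  have "\<not> has_eigensolution Hp \<rho> \<rho>p m" if "0 < m" "m \<le> 1 / F\<^sup>2" for m
    using inverse_square_less_critical[OF mu_cr(1) F_super] mu_cr(3) that by fastforce
  moreover have "val (?J z) > 0" if "z \<in> strip" "-1 < snd z" for z
    using w_pos that by (simp add: jet_of_def strip_def)
  moreover have "vanishes_left ?J \<or> vanishes_left (\<lambda>z. reflect (?J (- fst z, snd z)))"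
    using decay decays_left_vanishes decays_right_vanishes by blast
  ultimately obtain l where "symmetric_crest ?J l"
    using height_problem.solution_symmetric[OF problem J] by blast
  then show ?thesis by (auto simp: symmetric_crest_def jet_of_def)
qed

end
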